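(* Let $\Sigma$ be a closed surface and $X:\Sigma\setminus\{p_1,\dots,p_m\}\to\mathbb{R}^3$ a complete minimal immersion with $m$ embedded planar ends at $p_1,\dots,p_m$, and let $g$ be the metric induced by $X$. Around each $p_i$ choose a local conformal coordinate $z$ with $z(p_i)=0$ such that $$X_z\,dz=\Big(-\frac{a}{z^2}+Y(z)\Big)dz,\qquad a\in\mathbb{C}^3,\ a\cdot a=0,\ |a|^2=2,$$ with $Y$ holomorphic near $0$ ($a$ and $Y$ may depend on $i$), and set $D_\epsilon(p_i):=z^{-1}(B_\epsilon)$, where $B_\epsilon\subset\mathbb{C}$ is the disc of radius $\epsilon$ about $0$. Then $$\lim_{\epsilon\to0}\left\{\int_{\Sigma\setminus\bigcup_{i=1}^mD_\epsilon(p_i)}d\mu_g-\frac{\pi m}{\epsilon^2}\right\}=0 .$$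
   Context: Embedded planar ends: $X$ has finite total curvature and each $p_i$ has a punctured neighbourhood embedded by $X$ and asymptotic at infinity to an affine plane with multiplicity one. The notation $a\cdot b=\sum_k a_kb_k$ is the complex bilinear extension of the Euclidean inner product, and $|a|^2=\sum_k|a_k|^2$. Normalization: $X_z$ stands for the complex derivative with $X=\operatorname{Re}\int X_z\,dz$, i.e. $X_z=\partial_xX-i\,\partial_yX$ for $z=x+iy$. Thus near each end $X(z)=\operatorname{Re}\big(\frac{a}{z}+\hat Y(z)\big)$ with $\hat Y$ holomorphic. Coordinates with the stated normalization exist around each embedded planar end. The measure $d\mu_g$ is the area measure of $g$. *)

theory Defs
  imports "HOL-Analysis.Analysis"
begin

section \<open>Smooth functions\<close>

abbreviation dird :: "'a::real_normed_vector \<Rightarrow> ('a \<Rightarrow> 'b::real_normed_vector) \<Rightarrow> 'a \<Rightarrow> 'b"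
  where "dird v f \<equiv> (\<lambda>x. frechet_derivative f (at x) v)"

text \<open>Intended for open domains only.\<close>

primrec Ck_on :: "nat \<Rightarrow> 'a::real_normed_vector set \<Rightarrow> ('a \<Rightarrow> 'b::real_normed_vector) \<Rightarrow> bool"
  where
    "Ck_on 0 W f \<longleftrightarrow> continuous_on W f"
  | "Ck_on (Suc k) W f \<longleftrightarrow>
       (\<forall>x\<in>W. f differentiable (at x)) \<and> (\<forall>v. Ck_on k W (dird v f))"

definition smooth_on :: "'a::real_normed_vector set \<Rightarrow> ('a \<Rightarrow> 'b::real_normed_vector) \<Rightarrow> bool"
  where "smooth_on W f \<longleftrightarrow> (\<forall>k. Ck_on k W f)"


section \<open>Smooth surfaces\<close>

text \<open>
  A surface is a subset \<open>S\<close> of a Hausdorff space with the subspace topology, together with a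
  maximal smooth atlas. Charts take values in the complex plane, read as the real plane;
  transition maps are only required to be smooth, so neither an orientation nor a
  complex structure is part of the data.
\<close>

type_synonym 'a chart = "'a set \<times> ('a \<Rightarrow> complex)"

definition chart_on :: "'a::t2_space set \<Rightarrow> 'a chart \<Rightarrow> bool"
  where "chart_on S c \<longleftrightarrow> (case c of (U, \<phi>) \<Rightarrow>
    openin (top_of_set S) U \<and> open (\<phi> ` U) \<and> homeomorphism U (\<phi> ` U) \<phi> (inv_into U \<phi>))"

definition compatible_charts :: "'a chart \<Rightarrow> 'a chart \<Rightarrow> bool"
  where "compatible_charts c d \<longleftrightarrow> (case (c, d) of ((U, \<phi>), (V, \<psi>)) \<Rightarrow>
    smooth_on (\<phi> ` (U \<inter> V)) (\<psi> \<circ> inv_into U \<phi>) \<and>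
    smooth_on (\<psi> ` (U \<inter> V)) (\<phi> \<circ> inv_into V \<psi>))"

definition maximal_smooth_atlas :: "'a::t2_space set \<Rightarrow> 'a chart set \<Rightarrow> bool"
  where "maximal_smooth_atlas S \<A> \<longleftrightarrow>
    (\<forall>c\<in>\<A>. chart_on S c) \<and>
    (\<Union>c\<in>\<A>. fst c) = S \<and>
    (\<forall>c\<in>\<A>. \<forall>d\<in>\<A>. compatible_charts c d) \<and>
    (\<forall>c. chart_on S c \<and> (\<forall>d\<in>\<A>. compatible_charts c d) \<longrightarrow> c \<in> \<A>)"

text \<open>Second countability is automatic, since a compact surface is covered by finitely many charts.\<close>

definition closed_surface :: "'a::t2_space set \<Rightarrow> 'a chart set \<Rightarrow> bool"
  where "closed_surface S \<A> \<longleftrightarrow> compact S \<and> maximal_smooth_atlas S \<A>"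


section \<open>Parametrised surfaces in Euclidean three-space\<close>

text \<open>
  Here \<open>f\<close> is a map from an open subset of the complex plane to Euclidean three-space; the
  coordinate vector fields are the directions \<open>1\<close> and \<open>\<i>\<close>.
\<close>

definition induced_metric :: "(complex \<Rightarrow> real^3) \<Rightarrow> complex \<Rightarrow> complex \<Rightarrow> complex \<Rightarrow> real"
  where "induced_metric f w u v = dird u f w \<bullet> dird v f w"

definition metric_det :: "(complex \<Rightarrow> real^3) \<Rightarrow> complex \<Rightarrow> real"
  where "metric_det f w =
    induced_metric f w 1 1 * induced_metric f w \<i> \<i> - (induced_metric f w 1 \<i>)\<^sup>2"

definition unit_normal :: "(complex \<Rightarrow> real^3) \<Rightarrow> complex \<Rightarrow> real^3"
  where "unit_normal f w = sgn (cross3 (dird 1 f w) (dird \<i> f w))"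

definition second_form :: "(complex \<Rightarrow> real^3) \<Rightarrow> complex \<Rightarrow> complex \<Rightarrow> complex \<Rightarrow> real"
  where "second_form f w u v = dird u (dird v f) w \<bullet> unit_normal f w"

definition mean_curvature :: "(complex \<Rightarrow> real^3) \<Rightarrow> complex \<Rightarrow> real"
  where "mean_curvature f w =
    (induced_metric f w 1 1 * second_form f w \<i> \<i>
     - 2 * induced_metric f w 1 \<i> * second_form f w 1 \<i>
     + induced_metric f w \<i> \<i> * second_form f w 1 1) / (2 * metric_det f w)"

definition gauss_curvature :: "(complex \<Rightarrow> real^3) \<Rightarrow> complex \<Rightarrow> real"
  where "gauss_curvature f w =
    (second_form f w 1 1 * second_form f w \<i> \<i> - (second_form f w 1 \<i>)\<^sup>2) / metric_det f w"

definition conformal_on :: "complex set \<Rightarrow> (complex \<Rightarrow> real^3) \<Rightarrow> bool"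
  where "conformal_on W f \<longleftrightarrow>
    (\<forall>w\<in>W. induced_metric f w 1 1 = induced_metric f w \<i> \<i> \<and> induced_metric f w 1 \<i> = 0)"

text \<open>The complex derivative, normalised without the factor one half.\<close>

definition complex_deriv :: "(complex \<Rightarrow> real^3) \<Rightarrow> complex \<Rightarrow> complex^3"
  where "complex_deriv f w =
    (\<chi> k. complex_of_real (dird 1 f w $ k) - \<i> * complex_of_real (dird \<i> f w $ k))"

text \<open>The complex bilinear (not Hermitian) extension of the Euclidean inner product.\<close>

definition cdot :: "complex^3 \<Rightarrow> complex^3 \<Rightarrow> complex"
  where "cdot a b = (\<Sum>k\<in>UNIV. a $ k * b $ k)"


section \<open>Minimal immersions of a punctured surface\<close>

text \<open>
  Throughout, \<open>P\<close> is the finite set of punctures and \<open>X\<close> is regarded as a map on \<open>S - P\<close>; its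
  values on \<open>P\<close> are irrelevant.
\<close>

definition local_rep :: "('a \<Rightarrow> 'b) \<Rightarrow> 'a chart \<Rightarrow> complex \<Rightarrow> 'b"
  where "local_rep X c = X \<circ> inv_into (fst c) (snd c)"

definition immersion :: "'a chart set \<Rightarrow> 'a set \<Rightarrow> ('a \<Rightarrow> real^3) \<Rightarrow> bool"
  where "immersion \<A> P X \<longleftrightarrow> (\<forall>(U, \<phi>)\<in>\<A>.
    smooth_on (\<phi> ` (U - P)) (local_rep X (U, \<phi>)) \<and>
    (\<forall>w \<in> \<phi> ` (U - P). inj (frechet_derivative (local_rep X (U, \<phi>)) (at w))))"

definition minimal_immersion :: "'a chart set \<Rightarrow> 'a set \<Rightarrow> ('a \<Rightarrow> real^3) \<Rightarrow> bool"
  where "minimal_immersion \<A> P X \<longleftrightarrow> immersion \<A> P X \<and>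
    (\<forall>(U, \<phi>)\<in>\<A>. \<forall>w \<in> \<phi> ` (U - P). mean_curvature (local_rep X (U, \<phi>)) w = 0)"

text \<open>
  Since \<open>X\<close> is an immersion, a continuous curve \<open>\<gamma>\<close> in \<open>S - P\<close> is piecewise continuously
  differentiable iff \<open>X \<circ> \<gamma>\<close> is, and its length in the induced metric is the Euclidean
  length of \<open>X \<circ> \<gamma>\<close>.
\<close>

definition curve_length :: "('a \<Rightarrow> real^3) \<Rightarrow> (real \<Rightarrow> 'a) \<Rightarrow> ennreal"
  where "curve_length X \<gamma> =
    (\<integral>\<^sup>+t\<in>{0..1}. ennreal (norm (vector_derivative (X \<circ> \<gamma>) (at t))) \<partial>lborel)"

definition induced_dist ::
    "'a::t2_space set \<Rightarrow> 'a set \<Rightarrow> ('a \<Rightarrow> real^3) \<Rightarrow> 'a \<Rightarrow> 'a \<Rightarrow> ennreal"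
  where "induced_dist S P X x y =
    Inf {curve_length X \<gamma> | \<gamma>. path \<gamma> \<and> path_image \<gamma> \<subseteq> S - P \<and>
      pathstart \<gamma> = x \<and> pathfinish \<gamma> = y \<and>
      (X \<circ> \<gamma>) piecewise_C1_differentiable_on {0..1}}"

definition complete_immersion :: "'a::t2_space set \<Rightarrow> 'a set \<Rightarrow> ('a \<Rightarrow> real^3) \<Rightarrow> bool"
  where "complete_immersion S P X \<longleftrightarrow>
    (\<forall>\<sigma>::nat \<Rightarrow> 'a. range \<sigma> \<subseteq> S - P \<and>
       (\<forall>e>0. \<exists>N. \<forall>k\<ge>N. \<forall>l\<ge>N. induced_dist S P X (\<sigma> k) (\<sigma> l) < e) \<longrightarrow>
       (\<exists>x\<in>S - P. (\<lambda>k. induced_dist S P X (\<sigma> k) x) \<longlonglongrightarrow> 0))"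

text \<open>
  The Riemannian area measure of the induced metric is the unique Borel measure on \<open>S - P\<close>
  which in every chart has density \<open>sqrt (det g)\<close> with respect to Lebesgue measure. Uniqueness
  holds because \<open>S\<close> is covered by finitely many charts; consistency between charts is
  the change of variables formula.
\<close>

definition is_area_measure ::
    "'a::t2_space set \<Rightarrow> 'a chart set \<Rightarrow> 'a set \<Rightarrow> ('a \<Rightarrow> real^3) \<Rightarrow> 'a measure \<Rightarrow> bool"
  where "is_area_measure S \<A> P X \<mu> \<longleftrightarrow>
    space \<mu> = S - P \<and> sets \<mu> = sets (restrict_space borel (S - P)) \<and>
    (\<forall>(U, \<phi>)\<in>\<A>. \<forall>E\<in>sets \<mu>. E \<subseteq> U \<longrightarrow>
       emeasure \<mu> E =
         (\<integral>\<^sup>+w\<in>\<phi> ` E. ennreal (sqrt (metric_det (local_rep X (U, \<phi>)) w)) \<partial>lborel))"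

text \<open>The Gauss curvature at a point does not depend on the chart used to compute it.\<close>

definition gauss_curvature_at ::
    "'a chart set \<Rightarrow> ('a \<Rightarrow> real^3) \<Rightarrow> 'a \<Rightarrow> real"
  where "gauss_curvature_at \<A> X x =
    (let c = (SOME c. c \<in> \<A> \<and> x \<in> fst c) in gauss_curvature (local_rep X c) (snd c x))"

definition finite_total_curvature ::
    "'a chart set \<Rightarrow> ('a \<Rightarrow> real^3) \<Rightarrow> 'a measure \<Rightarrow> bool"
  where "finite_total_curvature \<A> X \<mu> \<longleftrightarrow> integrable \<mu> (gauss_curvature_at \<A> X)"

text \<open>
  A punctured neighbourhood \<open>N - {q}\<close> is embedded, is mapped to infinity towards the puncture,
  and approaches the plane \<open>{y. \<nu> \<bullet> y = h}\<close>; multiplicity one means that over every point of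
  the plane far out there is exactly one point of the end, with respect to orthogonal projection.
\<close>

definition embedded_planar_end ::
    "'a::t2_space set \<Rightarrow> 'a set \<Rightarrow> ('a \<Rightarrow> real^3) \<Rightarrow> 'a \<Rightarrow> bool"
  where "embedded_planar_end S P X q \<longleftrightarrow>
    (\<exists>N \<nu> h R. openin (top_of_set S) N \<and> N \<inter> P = {q} \<and>
       homeomorphism (N - {q}) (X ` (N - {q})) X (inv_into (N - {q}) X) \<and>
       norm \<nu> = 1 \<and>
       filterlim X at_infinity (at q within S) \<and>
       ((\<lambda>x. \<nu> \<bullet> X x) \<longlongrightarrow> h) (at q within S) \<and>
       (\<forall>y. \<nu> \<bullet> y = h \<and> norm y > R \<longrightarrow>
          (\<exists>!x. x \<in> N - {q} \<and> X x - (\<nu> \<bullet> X x - h) *\<^sub>R \<nu> = y)))"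

text \<open>A conformal coordinate \<open>(U, z)\<close> at \<open>q\<close> in which the complex derivative of \<open>X\<close> is \<open>-a / z\<^sup>2 + Y\<close>.\<close>

definition normalized_end_coordinate ::
    "'a chart set \<Rightarrow> 'a set \<Rightarrow> ('a \<Rightarrow> real^3) \<Rightarrow> 'a \<Rightarrow> 'a chart \<Rightarrow>
     complex^3 \<Rightarrow> (complex \<Rightarrow> complex^3) \<Rightarrow> bool"
  where "normalized_end_coordinate \<A> P X q c a Y \<longleftrightarrow> (case c of (U, z) \<Rightarrow>
    (U, z) \<in> \<A> \<and> q \<in> U \<and> z q = 0 \<and>
    conformal_on (z ` (U - P)) (local_rep X (U, z)) \<and>
    cdot a a = 0 \<and> (norm a)\<^sup>2 = 2 \<and>
    (\<forall>k. (\<lambda>w. Y w $ k) analytic_on {0}) \<and>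
    (\<forall>\<^sub>F w in at 0. complex_deriv (local_rep X (U, z)) w = - ((1 / w\<^sup>2) *s a) + Y w))"

definition coordinate_disc :: "'a chart \<Rightarrow> real \<Rightarrow> 'a set"
  where "coordinate_disc c \<epsilon> = {x \<in> fst c. snd c x \<in> ball 0 \<epsilon>}"

end

theory Submission
  imports Defs "HOL-Complex_Analysis.Cauchy_Integral_Theorem"
begin

text \<open>
  Let \<open>X\<^sup>T\<close> be the tangential part of the position vector, regarded as a vector field on the surface (the
  position field). Minimality says that the divergence of \<open>X\<^sup>T\<close> is \<open>2\<close>, so every continuously
  differentiable function \<open>\<eta>\<close> that vanishes near the punctures satisfies
  \<open>\<integral> (2 \<eta> + d\<eta>(X\<^sup>T)) d\<mu> = 0\<close>; this is lemma \<open>divergence_theorem\<close>. In a chart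
  it amounts to the vanishing of the integral of a directional derivative of a compactly supported function
  (\<open>planar_divergence\<close>), since the two conormal fields \<open>f\<^sub>y \<times> n\<close> and \<open>n \<times> f\<^sub>x\<close> form a divergence-free pair
  (\<open>divergence_conormal\<close>); a partition of unity made of bumps in coordinate discs passes from charts
  to the compact surface. Neither an orientation nor a complex structure is needed.

  Take \<open>\<eta> = 1 - \<Sum>\<^sub>i \<kappa>\<^sub>i\<close>, where \<open>\<kappa>\<^sub>i\<close> is a radial cutoff in the \<open>i\<close>-th coordinate, equal to \<open>1\<close> for
  \<open>|z| \<le> \<epsilon>/2\<close> and to \<open>0\<close> for \<open>|z| \<ge> \<epsilon>\<close>. The area outside the discs becomes a sum of integrals
  \<open>\<integral> d\<kappa>\<^sub>i(X\<^sup>T) d\<mu> / 2 - \<integral> (1 - \<kappa>\<^sub>i) d\<mu>\<close> over the discs of radius \<open>\<epsilon>\<close> alone (\<open>area_outside_discs\<close>).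

  Near an end the density of \<open>\<mu>\<close> is \<open>1/|z|\<^sup>4 - Re(a \<bullet> cnj Y(0) / z\<^sup>2) + O(1/|z|)\<close>, and its product with
  \<open>d\<kappa>(X\<^sup>T)\<close> is a radial factor times \<open>X \<bullet> Re(z X\<^sub>z) = - 1/|z|\<^sup>2 - c \<bullet> Re(a/z) + O(|z|)\<close>, where \<open>c\<close> is a
  constant vector; the conditions \<open>a \<cdot> a = 0\<close> and \<open>|a|\<^sup>2 = 2\<close> produce the leading coefficients
  (\<open>end_expansion\<close>). Averaging over the rotations by powers of \<open>\<i>\<close> removes the two intermediate terms,
  the remainders contribute \<open>O(\<epsilon>)\<close>, and the leading terms form a radial function whose integral
  is exactly \<open>\<pi>/\<epsilon>\<^sup>2\<close>, being the derivative of \<open>(1 - \<kappa>)/s\<close> in the variable \<open>s = |z|\<^sup>2\<close>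
  (\<open>end_integral\<close>).
\<close>

section \<open>Continuously differentiable functions\<close>

text \<open>
  A function is of class \<open>C\<^sup>1\<close> on \<open>W\<close> if it is differentiable at every point of \<open>W\<close> and all its
  directional derivatives are continuous on \<open>W\<close>. As the derivative is two-sided, the notion is meant for
  open \<open>W\<close>; on a finite-dimensional domain it is the usual one.
\<close>

definition c1_on :: "'a::real_normed_vector set \<Rightarrow> ('a \<Rightarrow> 'b::real_normed_vector) \<Rightarrow> bool"
  where "c1_on W f \<longleftrightarrow> (\<forall>x\<in>W. f differentiable (at x)) \<and> (\<forall>v. continuous_on W (dird v f))"

lemma c1_onI:
  assumes "\<And>x. x \<in> W \<Longrightarrow> (f has_derivative f' x) (at x)"
    and "\<And>v. continuous_on W (\<lambda>x. f' x v)"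
  shows "c1_on W f"
proof -
  have "frechet_derivative f (at x) = f' x" if "x \<in> W" for x
    using frechet_derivative_at[OF assms(1)[OF that]] by simp
  then have "continuous_on W (dird v f)" for v
    using assms(2)[of v] by (simp cong: continuous_on_cong)
  then show ?thesis
    using assms(1) unfolding c1_on_def differentiable_def by blast
qed

lemma c1_on_has_derivative:
  "c1_on W f \<Longrightarrow> x \<in> W \<Longrightarrow> (f has_derivative frechet_derivative f (at x)) (at x)"
  unfolding c1_on_def by (simp add: frechet_derivative_works)

lemma c1_on_dird_continuous: "c1_on W f \<Longrightarrow> continuous_on W (dird v f)"
  unfolding c1_on_def by simp

lemma c1_on_continuous: "c1_on W f \<Longrightarrow> continuous_on W f"
  using c1_on_has_derivative has_derivative_continuous continuous_at_imp_continuous_on by metis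

lemma Ck_on_imp_c1_on: "Ck_on (Suc 0) W f \<Longrightarrow> c1_on W f"
  by (simp add: c1_on_def)

lemma smooth_on_imp_c1_on: "smooth_on W f \<Longrightarrow> c1_on W f"
  unfolding smooth_on_def by (metis Ck_on_imp_c1_on)

lemma smooth_on_dird: "smooth_on W f \<Longrightarrow> smooth_on W (dird v f)"
  unfolding smooth_on_def by (metis Ck_on.simps(2))

lemma c1_on_subset: "c1_on W f \<Longrightarrow> V \<subseteq> W \<Longrightarrow> c1_on V f"
  unfolding c1_on_def by (meson continuous_on_subset subsetD)

lemma dird_cong_open:
  assumes "open W" "x \<in> W" "\<And>y. y \<in> W \<Longrightarrow> f y = g y"
  shows "frechet_derivative f (at x) = frechet_derivative g (at x)"
proof -
  have "(f has_derivative f') (at x) = (g has_derivative f') (at x)" for f'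
    using has_derivative_transform_within_open[OF _ assms(1,2), of f f' UNIV g]
      has_derivative_transform_within_open[OF _ assms(1,2), of g f' UNIV f] assms(3) by auto
  then show ?thesis by (simp add: frechet_derivative_def)
qed

lemma c1_on_cong_open:
  assumes "open W" "\<And>x. x \<in> W \<Longrightarrow> f x = g x" "c1_on W f"
  shows "c1_on W g"
proof (rule c1_onI)
  fix x assume x: "x \<in> W"
  show "(g has_derivative frechet_derivative f (at x)) (at x)"
    using has_derivative_transform_within_open[OF c1_on_has_derivative[OF assms(3) x] assms(1) x]
      assms(2) by simp
qed (rule c1_on_dird_continuous[OF assms(3)])

lemma c1_on_local:
  assumes "\<And>x. x \<in> W \<Longrightarrow> \<exists>V. open V \<and> x \<in> V \<and> c1_on V f"
  shows "c1_on W f"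
  unfolding c1_on_def
proof (intro conjI ballI allI)
  fix x assume "x \<in> W"
  then show "f differentiable (at x)" using assms unfolding c1_on_def by blast
next
  fix v
  have "isCont (dird v f) x" if x: "x \<in> W" for x
    using assms[OF x] c1_on_dird_continuous continuous_on_eq_continuous_at by blast
  then show "continuous_on W (dird v f)"
    by (simp add: continuous_at_imp_continuous_on)
qed

lemma c1_on_const [intro]: "c1_on W (\<lambda>x. c)"
  by (rule c1_onI[where f' = "\<lambda>x v. 0"]) auto

lemma c1_on_bounded_bilinear:
  assumes bb: "bounded_bilinear pr" and f: "c1_on W f" and g: "c1_on W g"
  shows "c1_on W (\<lambda>x. pr (f x) (g x))"
proof (rule c1_onI)
  show "((\<lambda>x. pr (f x) (g x)) has_derivative
      (\<lambda>h. pr (f x) (dird h g x) + pr (dird h f x) (g x))) (at x)" if "x \<in> W" for x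
    by (rule bounded_bilinear.FDERIV[OF bb]) (use that f g in \<open>simp_all add: c1_on_has_derivative\<close>)
  show "continuous_on W (\<lambda>x. pr (f x) (dird v g x) + pr (dird v f x) (g x))" for v
    by (intro continuous_intros bounded_bilinear.continuous_on[OF bb] c1_on_dird_continuous
        c1_on_continuous f g)
qed

lemmas c1_on_mult = c1_on_bounded_bilinear[OF bounded_bilinear_mult]
lemmas c1_on_inner = c1_on_bounded_bilinear[OF bounded_bilinear_inner]
lemmas c1_on_scaleR = c1_on_bounded_bilinear[OF bounded_bilinear_scaleR]

lemma bounded_bilinear_cross3: "bounded_bilinear cross3"
  using bilinear_cross bilinear_conv_bounded_bilinear by blast

lemmas c1_on_cross3 = c1_on_bounded_bilinear[OF bounded_bilinear_cross3]

lemma c1_on_add: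
  assumes "c1_on W f" "c1_on W g"
  shows "c1_on W (\<lambda>x. f x + g x)"
  by (rule c1_onI[where f' = "\<lambda>x v. dird v f x + dird v g x"])
    (auto intro!: derivative_intros continuous_intros c1_on_has_derivative c1_on_dird_continuous assms)

lemma c1_on_diff:
  assumes "c1_on W f" "c1_on W g"
  shows "c1_on W (\<lambda>x. f x - g x)"
  by (rule c1_onI[where f' = "\<lambda>x v. dird v f x - dird v g x"])
    (auto intro!: derivative_intros continuous_intros c1_on_has_derivative c1_on_dird_continuous assms)

lemma c1_on_sum:
  assumes "\<And>i. i \<in> I \<Longrightarrow> c1_on W (f i)"
  shows "c1_on W (\<lambda>x. \<Sum>i\<in>I. f i x)"
  using assms
  by (induction I rule: infinite_finite_induct) (auto intro!: c1_on_add)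

lemma c1_on_compose:
  fixes f :: "'a::real_normed_vector \<Rightarrow> 'b::euclidean_space" and g :: "'b \<Rightarrow> 'c::real_normed_vector"
  assumes f: "c1_on W f" and g: "c1_on T g" and fW: "f ` W \<subseteq> T"
  shows "c1_on W (g \<circ> f)"
proof (rule c1_onI)
  fix x assume x: "x \<in> W"
  show "(g \<circ> f has_derivative frechet_derivative g (at (f x)) \<circ> frechet_derivative f (at x)) (at x)"
    using c1_on_has_derivative[OF f x] c1_on_has_derivative[OF g, of "f x"] x fW
    by (intro diff_chain_at) auto
next
  fix v
  have lin: "linear (frechet_derivative g (at (f x)))" if "x \<in> W" for x
    using c1_on_has_derivative[OF g, of "f x"] that fW has_derivative_linear by blast
  have eq: "(frechet_derivative g (at (f x)) \<circ> frechet_derivative f (at x)) v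
      = (\<Sum>b\<in>Basis. (dird v f x \<bullet> b) *\<^sub>R dird b g (f x))" if "x \<in> W" for x
  proof -
    have "dird v f x = (\<Sum>b\<in>Basis. (dird v f x \<bullet> b) *\<^sub>R b)"
      by (simp add: euclidean_representation)
    then have "dird (dird v f x) g (f x)
       = dird (\<Sum>b\<in>Basis. (dird v f x \<bullet> b) *\<^sub>R b) g (f x)" by simp
    then show ?thesis
      by (simp add: linear_sum[OF lin[OF that]] linear_cmul[OF lin[OF that]])
  qed
  have "continuous_on W (\<lambda>x. \<Sum>b\<in>Basis. (dird v f x \<bullet> b) *\<^sub>R dird b g (f x))"
    by (intro continuous_intros c1_on_dird_continuous[OF f]
        continuous_on_compose2[OF c1_on_dird_continuous[OF g] c1_on_continuous[OF f] fW])
  then show "continuous_on W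
      (\<lambda>x. (frechet_derivative g (at (f x)) \<circ> frechet_derivative f (at x)) v)"
    by (subst continuous_on_cong[OF refl eq])
qed

lemma c1_on_inverse:
  fixes f :: "'a::real_normed_vector \<Rightarrow> real"
  assumes "c1_on W f" "\<And>x. x \<in> W \<Longrightarrow> f x \<noteq> 0"
  shows "c1_on W (\<lambda>x. inverse (f x))"
proof -
  have "c1_on (- {0}) (inverse :: real \<Rightarrow> real)"
    by (rule c1_onI[where f' = "\<lambda>x h. - (inverse x * h * inverse x)"])
      (auto intro!: derivative_intros continuous_intros)
  from c1_on_compose[OF assms(1) this] show ?thesis
    using assms(2) by (fastforce simp: comp_def)
qed

lemma c1_on_sqrt:
  fixes f :: "'a::real_normed_vector \<Rightarrow> real"
  assumes "c1_on W f" "\<And>x. x \<in> W \<Longrightarrow> f x > 0"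
  shows "c1_on W (\<lambda>x. sqrt (f x))"
proof -
  have "c1_on {0<..} sqrt"
    by (rule c1_onI[where f' = "\<lambda>x h. (inverse (sqrt x) / 2) * h"])
      (auto intro!: derivative_eq_intros continuous_intros simp: field_simps)
  from c1_on_compose[OF assms(1) this] show ?thesis
    using assms(2) by (fastforce simp: comp_def)
qed

lemma linear_frechet:
  assumes "f differentiable (at x)" shows "linear (frechet_derivative f (at x))"
  using assms frechet_derivative_works has_derivative_linear by blast

lemma has_derivative_along_line:
  fixes f :: "'a::real_normed_vector \<Rightarrow> real"
  assumes "f differentiable (at (x + t *\<^sub>R v))"
  shows "((\<lambda>t. f (x + t *\<^sub>R v)) has_real_derivative dird v f (x + t *\<^sub>R v)) (at t)"
proof -
  have "(f has_derivative frechet_derivative f (at (x + t *\<^sub>R v))) (at (x + t *\<^sub>R v))"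
    using assms frechet_derivative_works by blast
  then have "((\<lambda>t. f (x + t *\<^sub>R v)) has_derivative
      (\<lambda>h. dird (h *\<^sub>R v) f (x + t *\<^sub>R v))) (at t)"
    by (rule has_derivative_compose[rotated]) (auto intro!: derivative_eq_intros)
  moreover have "(\<lambda>h. dird (h *\<^sub>R v) f (x + t *\<^sub>R v))
      = (*) (dird v f (x + t *\<^sub>R v))"
    using linear_cmul[OF linear_frechet[OF assms]] by (auto simp: fun_eq_iff)
  ultimately show ?thesis
    by (simp add: has_field_derivative_def)
qed

text \<open>
  Two applications of the mean value theorem write the second difference of \<open>f\<close> over a parallelogram
  as a mixed second derivative at a nearby point. The second difference is symmetric in the two
  directions, hence the mixed derivatives agree in the limit.
\<close>

lemma second_difference_mvt:
  fixes f :: "'a::real_normed_vector \<Rightarrow> real"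
  assumes ball: "ball w r \<subseteq> W" and h: "0 < h" "h * (norm u + norm v) < r"
    and f: "\<And>x. x \<in> W \<Longrightarrow> f differentiable (at x)"
    and fu: "\<And>x. x \<in> W \<Longrightarrow> dird u f differentiable (at x)"
  obtains y where "dist y w < r"
    "f (w + h *\<^sub>R u + h *\<^sub>R v) - f (w + h *\<^sub>R u) - f (w + h *\<^sub>R v) + f w
      = h * h * dird v (dird u f) y"
proof -
  have mem: "w + s *\<^sub>R u + t *\<^sub>R v \<in> W" if "0 \<le> s" "s \<le> h" "0 \<le> t" "t \<le> h" for s t
  proof -
    have "norm (s *\<^sub>R u + t *\<^sub>R v) \<le> norm (s *\<^sub>R u) + norm (t *\<^sub>R v)"
      by (rule norm_triangle_ineq)
    also have "\<dots> = s * norm u + t * norm v" using that by simp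
    also have "\<dots> \<le> h * norm u + h * norm v"
      using that by (intro add_mono mult_right_mono) auto
    also have "\<dots> < r" using h(2) by (simp add: distrib_left)
    finally show ?thesis
      using ball by (auto simp: dist_norm algebra_simps norm_minus_commute subset_iff)
  qed
  have "\<exists>s. 0 < s \<and> s < h \<and>
      (f (w + h *\<^sub>R v + h *\<^sub>R u) - f (w + h *\<^sub>R u)) - (f (w + h *\<^sub>R v + 0 *\<^sub>R u) - f (w + 0 *\<^sub>R u))
      = (h - 0) * (dird u f (w + h *\<^sub>R v + s *\<^sub>R u) - dird u f (w + s *\<^sub>R u))"
  proof (rule MVT2[OF h(1)])
    fix s assume s: "0 \<le> s" "s \<le> h"
    have m: "w + h *\<^sub>R v + s *\<^sub>R u \<in> W" "w + s *\<^sub>R u \<in> W"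
      using mem[of s h] mem[of s 0] s h by (simp_all add: algebra_simps)
    show "((\<lambda>s. f (w + h *\<^sub>R v + s *\<^sub>R u) - f (w + s *\<^sub>R u)) has_real_derivative
        dird u f (w + h *\<^sub>R v + s *\<^sub>R u) - dird u f (w + s *\<^sub>R u)) (at s)"
      by (intro derivative_intros has_derivative_along_line f m)
  qed
  then obtain s where s: "0 < s" "s < h"
    and 1: "(f (w + h *\<^sub>R v + h *\<^sub>R u) - f (w + h *\<^sub>R u)) - (f (w + h *\<^sub>R v + 0 *\<^sub>R u) - f (w + 0 *\<^sub>R u))
      = (h - 0) * (dird u f (w + h *\<^sub>R v + s *\<^sub>R u) - dird u f (w + s *\<^sub>R u))"
    by blast
  have "\<exists>t. 0 < t \<and> t < h \<and>
      dird u f (w + s *\<^sub>R u + h *\<^sub>R v) - dird u f (w + s *\<^sub>R u + 0 *\<^sub>R v)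
      = (h - 0) * dird v (dird u f) (w + s *\<^sub>R u + t *\<^sub>R v)"
  proof (rule MVT2[OF h(1)])
    fix t assume t: "0 \<le> t" "t \<le> h"
    show "((\<lambda>t. dird u f (w + s *\<^sub>R u + t *\<^sub>R v)) has_real_derivative
        dird v (dird u f) (w + s *\<^sub>R u + t *\<^sub>R v)) (at t)"
      by (rule has_derivative_along_line) (use mem s t in \<open>auto intro!: fu\<close>)
  qed
  then obtain t where t: "0 < t" "t < h"
    and 2: "dird u f (w + s *\<^sub>R u + h *\<^sub>R v) - dird u f (w + s *\<^sub>R u + 0 *\<^sub>R v)
      = (h - 0) * dird v (dird u f) (w + s *\<^sub>R u + t *\<^sub>R v)" by blast
  have d: "dist (w + s *\<^sub>R u + t *\<^sub>R v) w < r"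
  proof -
    have "norm (s *\<^sub>R u + t *\<^sub>R v) \<le> norm (s *\<^sub>R u) + norm (t *\<^sub>R v)"
      by (rule norm_triangle_ineq)
    also have "\<dots> \<le> h * norm u + h * norm v"
      using s t by (auto intro!: add_mono mult_right_mono)
    finally show ?thesis using h(2) by (simp add: dist_norm distrib_left algebra_simps)
  qed
  have "f (w + h *\<^sub>R u + h *\<^sub>R v) - f (w + h *\<^sub>R u) - f (w + h *\<^sub>R v) + f w
      = h * (dird u f (w + s *\<^sub>R u + h *\<^sub>R v) - dird u f (w + s *\<^sub>R u))"
    using 1 by (simp add: add.commute add.left_commute)
  also have "\<dots> = h * h * dird v (dird u f) (w + s *\<^sub>R u + t *\<^sub>R v)"
    using 2 by simp
  finally show ?thesis using d that by blast
qed

lemma mixed_partials_commute_real: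
  fixes f :: "'a::real_normed_vector \<Rightarrow> real"
  assumes W: "open W" "w \<in> W"
    and f: "\<And>x. x \<in> W \<Longrightarrow> f differentiable (at x)"
    and fu: "c1_on W (dird u f)" and fv: "c1_on W (dird v f)"
  shows "dird v (dird u f) w = dird u (dird v f) w"
proof (rule ccontr)
  define A where "A = dird v (dird u f)"
  define B where "B = dird u (dird v f)"
  assume "dird v (dird u f) w \<noteq> dird u (dird v f) w"
  then have pos: "\<bar>A w - B w\<bar> / 2 > 0" by (simp add: A_def B_def)
  have "isCont A w" "isCont B w"
    using c1_on_dird_continuous[OF fu, of v] c1_on_dird_continuous[OF fv, of u] W
    by (simp_all add: A_def B_def continuous_on_eq_continuous_at)
  then obtain r1 r2 where r1: "r1 > 0" "\<And>y. dist y w < r1 \<Longrightarrow> dist (A y) (A w) < \<bar>A w - B w\<bar> / 2"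
    and r2: "r2 > 0" "\<And>y. dist y w < r2 \<Longrightarrow> dist (B y) (B w) < \<bar>A w - B w\<bar> / 2"
    using pos unfolding continuous_at_eps_delta by metis
  obtain r3 where r3: "r3 > 0" "ball w r3 \<subseteq> W" using W open_contains_ball by blast
  define r where "r = min r1 (min r2 r3)"
  have r: "r > 0" "ball w r \<subseteq> W" using r1 r2 r3 by (auto simp: r_def)
  define h where "h = r / (norm u + norm v + 1)"
  have pos1: "norm u + norm v + 1 > 0" by (smt (verit) norm_ge_zero)
  have h: "h > 0" "h * (norm u + norm v) < r"
    using r pos1 by (auto simp: h_def field_simps)
  have du: "dird u f differentiable (at x)" if "x \<in> W" for x using fu that by (simp add: c1_on_def)
  have dv: "dird v f differentiable (at x)" if "x \<in> W" for x using fv that by (simp add: c1_on_def)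
  obtain y where y: "dist y w < r"
    "f (w + h *\<^sub>R u + h *\<^sub>R v) - f (w + h *\<^sub>R u) - f (w + h *\<^sub>R v) + f w = h * h * A y"
    using second_difference_mvt[OF r(2) h f du] unfolding A_def by blast
  obtain y' where y': "dist y' w < r"
    "f (w + h *\<^sub>R v + h *\<^sub>R u) - f (w + h *\<^sub>R v) - f (w + h *\<^sub>R u) + f w = h * h * B y'"
    using second_difference_mvt[OF r(2) h(1) _ f dv, of u] h(2) unfolding B_def
    by (metis add.commute)
  have "h * h * A y = h * h * B y'"
    using y(2) y'(2) unfolding add.assoc add.commute[of "h *\<^sub>R v" "h *\<^sub>R u"] by linarith
  then have "A y = B y'" using h(1) by simp
  moreover have "dist (A y) (A w) < \<bar>A w - B w\<bar> / 2" "dist (B y') (B w) < \<bar>A w - B w\<bar> / 2"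
    using r1 r2 y y' by (auto simp: r_def)
  ultimately show False
    unfolding dist_real_def by (smt (verit) field_sum_of_halves)
qed

lemma dird_inner_const:
  assumes "f differentiable (at x)"
  shows "dird v (\<lambda>x. f x \<bullet> b) x = dird v f x \<bullet> b"
proof -
  have "((\<lambda>x. f x \<bullet> b) has_derivative (\<lambda>v. dird v f x \<bullet> b)) (at x)"
    using assms unfolding frechet_derivative_works by (auto intro!: derivative_eq_intros)
  from frechet_derivative_at[OF this] show ?thesis by metis
qed

lemma mixed_partials_commute:
  fixes f :: "'a::real_normed_vector \<Rightarrow> 'b::euclidean_space"
  assumes W: "open W" "w \<in> W"
    and f: "\<And>x. x \<in> W \<Longrightarrow> f differentiable (at x)"
    and fu: "c1_on W (dird u f)" and fv: "c1_on W (dird v f)"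
  shows "dird v (dird u f) w = dird u (dird v f) w"
proof (rule euclidean_eqI)
  fix b :: 'b assume b: "b \<in> Basis"
  let ?f = "\<lambda>x. f x \<bullet> b"
  have d: "?f differentiable (at x)" if "x \<in> W" for x
    using f[OF that] by (auto intro!: derivative_intros)
  have c1: "c1_on W (dird u' ?f)" if "c1_on W (dird u' f)" for u'
  proof (rule c1_on_cong_open[OF W(1)])
    show "c1_on W (\<lambda>x. dird u' f x \<bullet> b)" using that by (intro c1_on_inner c1_on_const)
    show "dird u' f x \<bullet> b = dird u' ?f x" if "x \<in> W" for x
      using dird_inner_const[OF f[OF that]] by simp
  qed
  have dd: "dird v' (dird u' ?f) w = dird v' (dird u' f) w \<bullet> b" if "c1_on W (dird u' f)" for u' v'
  proof -
    have "frechet_derivative (dird u' ?f) (at w) = frechet_derivative (\<lambda>x. dird u' f x \<bullet> b) (at w)"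
      by (rule dird_cong_open[OF W]) (simp add: dird_inner_const f)
    then show ?thesis
      using dird_inner_const[of "dird u' f" w b v'] that W(2) by (simp add: c1_on_def)
  qed
  show "dird v (dird u f) w \<bullet> b = dird u (dird v f) w \<bullet> b"
    using mixed_partials_commute_real[OF W d c1[OF fu] c1[OF fv]] dd fu fv by simp
qed

lemma lborel_integral_translate:
  fixes G :: "'a::euclidean_space \<Rightarrow> real"
  assumes "G \<in> borel_measurable borel"
  shows "(\<integral>x. G (x + c) \<partial>lborel) = (\<integral>x. G x \<partial>lborel)"
proof -
  have "(\<integral>x. G x \<partial>lborel) = (\<integral>x. G x \<partial>distr lborel borel ((+) c))"
    by (simp add: lborel_distr_plus)
  also have "\<dots> = (\<integral>x. G (c + x) \<partial>lborel)"
    by (rule integral_distr) (use assms in auto)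
  finally show ?thesis by (simp add: add.commute)
qed

lemma lborel_integrable_translate:
  fixes G :: "'a::euclidean_space \<Rightarrow> real"
  assumes "integrable lborel G"
  shows "integrable lborel (\<lambda>x. G (x + c))"
proof -
  have "integrable (distr lborel borel ((+) c)) G"
    using assms by (simp add: lborel_distr_plus)
  then show ?thesis
    using integrable_distr[of "(+) c" lborel borel G] by (simp add: add.commute)
qed

lemma integrable_continuous_compact_support:
  fixes G :: "'a::euclidean_space \<Rightarrow> real"
  assumes "continuous_on K G" "compact K" "\<And>x. x \<notin> K \<Longrightarrow> G x = 0"
  shows "integrable lborel G"
proof -
  have "G = (\<lambda>x. indicator K x *\<^sub>R G x)" using assms(3) by (auto simp: indicator_def fun_eq_iff)
  then show ?thesis using borel_integrable_compact[OF assms(2,1)] by simp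
qed

text \<open>
  The integral of a directional derivative of a compactly supported \<open>C\<^sup>1\<close> function is zero: the
  difference quotients have integral zero by translation invariance and converge to the derivative with
  a common integrable bound.
\<close>

lemma integral_dird_compact_support:
  fixes G :: "'a::euclidean_space \<Rightarrow> real"
  assumes G: "c1_on UNIV G" and K: "compact K" and out: "\<And>x. x \<notin> K \<Longrightarrow> G x = 0"
  shows "integrable lborel (dird v G)" and "(\<integral>x. dird v G x \<partial>lborel) = 0"
proof -
  have d0: "dird v G x = 0" if "x \<notin> K" for x
  proof -
    have "frechet_derivative G (at x) = frechet_derivative (\<lambda>x. 0::real) (at x)"
      by (rule dird_cong_open[of "- K"]) (use K that out in \<open>auto simp: compact_imp_closed open_Compl\<close>)
    then show ?thesis by simp
  qed
  have cont: "continuous_on A (dird v G)" "continuous_on A G" for A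
    using c1_on_dird_continuous[OF G] c1_on_continuous[OF G] continuous_on_subset by blast+
  show int: "integrable lborel (dird v G)"
    by (rule integrable_continuous_compact_support[OF cont(1) K d0])
  have intG: "integrable lborel G"
    by (rule integrable_continuous_compact_support[OF cont(2) K out])
  obtain R where R: "K \<subseteq> cball 0 R"
    using bounded_subset_ballD[OF compact_imp_bounded[OF K], of 0] ball_subset_cball by fast
  have "bounded (dird v G ` K)"
    by (rule compact_imp_bounded[OF compact_continuous_image[OF cont(1) K]])
  then obtain M where M: "\<And>x. x \<in> K \<Longrightarrow> norm (dird v G x) \<le> M"
    by (auto simp: bounded_iff)
  define M' where "M' = max 0 M"
  have M': "\<bar>dird v G x\<bar> \<le> M'" for x
    using M[of x] d0[of x] by (cases "x \<in> K") (auto simp: M'_def)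
  define h where "h n = inverse (real (Suc n))" for n
  have h: "h n > 0" "h n \<le> 1" for n by (auto simp: h_def field_simps)
  \<comment> \<open>difference quotients with step \<open>h n\<close>; for \<open>h n \<le> 1\<close> all are supported in one ball\<close>
  define q where "q n x = (G (x + h n *\<^sub>R v) - G x) / h n" for n x
  have qb: "\<bar>q n x\<bar> \<le> M' * indicator (cball 0 (R + norm v)) x" for n x
  proof (cases "x \<in> cball 0 (R + norm v)")
    case True
    have "\<exists>t. 0 < t \<and> t < h n \<and>
        G (x + h n *\<^sub>R v) - G (x + 0 *\<^sub>R v) = (h n - 0) * dird v G (x + t *\<^sub>R v)"
      by (rule MVT2[OF h(1)], rule has_derivative_along_line) (use G in \<open>auto simp: c1_on_def\<close>)
    then obtain t where "G (x + h n *\<^sub>R v) - G x = h n * dird v G (x + t *\<^sub>R v)" by auto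
    then have "q n x = dird v G (x + t *\<^sub>R v)" using h[of n] by (simp add: q_def)
    then show ?thesis using M' True by simp
  next
    case False
    then have x: "norm x > R + norm v" by simp
    have "norm (h n *\<^sub>R v) \<le> norm v" using h[of n] by (simp add: mult_left_le_one_le)
    then have "norm (x + h n *\<^sub>R v) > R" using x norm_diff_ineq[of x "h n *\<^sub>R v"] by linarith
    moreover have "norm x > R" using x norm_ge_zero[of v] by linarith
    ultimately have "x + h n *\<^sub>R v \<notin> K" "x \<notin> K" using R by (auto simp: subset_iff)
    then show ?thesis using out False by (simp add: q_def)
  qed
  have "(\<lambda>n. \<integral>x. q n x \<partial>lborel) \<longlonglongrightarrow> (\<integral>x. dird v G x \<partial>lborel)"
  proof (rule integral_dominated_convergence)
    show "dird v G \<in> borel_measurable lborel" using int by auto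
    show "q n \<in> borel_measurable lborel" for n
    proof -
      have "continuous_on UNIV (\<lambda>x. G (x + h n *\<^sub>R v))"
        by (rule continuous_on_compose2[OF cont(2)[of UNIV]]) (auto intro!: continuous_intros)
      then have "(\<lambda>x. G (x + h n *\<^sub>R v)) \<in> borel_measurable borel" "G \<in> borel_measurable borel"
        using cont(2)[of UNIV] by (auto intro: borel_measurable_continuous_onI)
      then show ?thesis unfolding q_def by measurable
    qed
    show "integrable lborel (\<lambda>x. M' * indicator (cball 0 (R + norm v)) x)"
      by (auto intro!: integrable_mult_right emeasure_compact_finite)
    show "AE x in lborel. (\<lambda>n. q n x) \<longlonglongrightarrow> dird v G x"
    proof (rule AE_I2)
      fix x
      have "((\<lambda>t. G (x + t *\<^sub>R v)) has_real_derivative dird v G (x + 0 *\<^sub>R v)) (at 0)"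
        by (rule has_derivative_along_line) (use G in \<open>auto simp: c1_on_def\<close>)
      then have "(\<lambda>t. (G (x + t *\<^sub>R v) - G x) / t) \<midarrow>0\<rightarrow> dird v G x"
        by (simp add: DERIV_def)
      moreover have "filterlim h (at 0) sequentially"
      proof -
        have "h = (\<lambda>n. inverse (real (Suc n)))" by (simp add: h_def fun_eq_iff)
        then show ?thesis
          unfolding filterlim_at using h(1) LIMSEQ_inverse_real_of_nat
          by (auto simp: less_imp_neq[symmetric])
      qed
      ultimately show "(\<lambda>n. q n x) \<longlonglongrightarrow> dird v G x"
        unfolding q_def by (rule filterlim_compose)
    qed
    show "AE x in lborel. norm (q n x) \<le> M' * indicator (cball 0 (R + norm v)) x" for n
      using qb by simp
  qed
  moreover have "(\<integral>x. q n x \<partial>lborel) = 0" for n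
  proof -
    have "(\<integral>x. q n x \<partial>lborel) = ((\<integral>x. G (x + h n *\<^sub>R v) \<partial>lborel) - (\<integral>x. G x \<partial>lborel)) / h n"
      unfolding q_def using intG lborel_integrable_translate[OF intG] by simp
    then show ?thesis
      using lborel_integral_translate[of G "h n *\<^sub>R v"] intG by simp
  qed
  ultimately show "(\<integral>x. dird v G x \<partial>lborel) = 0"
    by (simp add: LIMSEQ_const_iff)
qed

section \<open>Minimal surfaces in a chart\<close>

abbreviation area_density :: "(complex \<Rightarrow> real^3) \<Rightarrow> complex \<Rightarrow> real"
  where "area_density f w \<equiv> sqrt (metric_det f w)"

text \<open>
  The conormal fields of a parametrised surface. Writing \<open>g\<close> for the induced metric and \<open>A\<close> for its
  area density, they are \<open>A (g\<^sup>1\<^sup>1 f\<^sub>x + g\<^sup>1\<^sup>2 f\<^sub>y)\<close> and \<open>A (g\<^sup>2\<^sup>1 f\<^sub>x + g\<^sup>2\<^sup>2 f\<^sub>y)\<close>; the cross product avoids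
  inverting the metric. The divergence of the pair is \<open>A\<close> times the Laplacian of \<open>f\<close>.
\<close>

definition conormal_x :: "(complex \<Rightarrow> real^3) \<Rightarrow> complex \<Rightarrow> real^3"
  where "conormal_x f w = cross3 (dird \<i> f w) (unit_normal f w)"

definition conormal_y :: "(complex \<Rightarrow> real^3) \<Rightarrow> complex \<Rightarrow> real^3"
  where "conormal_y f w = cross3 (unit_normal f w) (dird 1 f w)"

text \<open>
  The tangential part of the position vector, expressed in the coordinates of the chart.
\<close>

definition position_field :: "(complex \<Rightarrow> real^3) \<Rightarrow> complex \<Rightarrow> complex"
  where "position_field f w =
    Complex ((f w \<bullet> conormal_x f w) / area_density f w) ((f w \<bullet> conormal_y f w) / area_density f w)"

lemma linear_complex_expand:
  assumes "linear (L :: complex \<Rightarrow> 'b::real_vector)"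
  shows "L v = Re v *\<^sub>R L 1 + Im v *\<^sub>R L \<i>"
proof -
  have "v = Re v *\<^sub>R 1 + Im v *\<^sub>R \<i>" by (simp add: complex_eq_iff)
  then show ?thesis
    using linear_add[OF assms] linear_cmul[OF assms] by metis
qed

lemma cross3_cross3_right:
  "cross3 x (cross3 y z) = (x \<bullet> z) *\<^sub>R y - (x \<bullet> y) *\<^sub>R z" for x y z :: "real^3"
  by (simp add: cross3_simps forall_3)

lemma cross3_inner_cyclic: "cross3 x y \<bullet> z = cross3 y z \<bullet> x" for x y z :: "real^3"
  by (simp add: cross3_simps)

lemma inj_linear_cross3_nonzero:
  assumes L: "linear L" "inj L" shows "cross3 (L 1) (L \<i>) \<noteq> (0 :: real^3)"
proof
  assume 0: "cross3 (L 1) (L \<i>) = 0"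
  have "cross3 (L \<i>) (cross3 (L 1) (L \<i>)) = 0" by (simp add: 0)
  then have "L (Complex (L \<i> \<bullet> L \<i>) (- (L \<i> \<bullet> L 1))) = 0"
    unfolding cross3_cross3_right linear_complex_expand[OF L(1), of "Complex _ _"]
    by (simp add: algebra_simps)
  then have "Complex (L \<i> \<bullet> L \<i>) (- (L \<i> \<bullet> L 1)) = 0"
    using linear_injective_0[OF L(1)] L(2) by blast
  then have "L \<i> = 0" by (simp add: complex_eq_iff)
  then show False using linear_injective_0[OF L(1)] L(2) by fastforce
qed

lemma metric_det_cross3: "metric_det f w = (norm (cross3 (dird 1 f w) (dird \<i> f w)))\<^sup>2"
  using norm_cross_dot[of "dird 1 f w" "dird \<i> f w"]
  by (simp add: metric_det_def induced_metric_def power_mult_distrib dot_square_norm)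

lemma area_density_cross3: "area_density f w = norm (cross3 (dird 1 f w) (dird \<i> f w))"
  by (simp add: metric_det_cross3)

lemma unit_normal_cross3:
  "area_density f w *\<^sub>R unit_normal f w = cross3 (dird 1 f w) (dird \<i> f w)"
  by (cases "cross3 (dird 1 f w) (dird \<i> f w) = 0")
    (simp_all add: area_density_cross3 unit_normal_def sgn_div_norm)

lemma area_density_conormal_x:
  "area_density f w *\<^sub>R conormal_x f w = (dird \<i> f w \<bullet> dird \<i> f w) *\<^sub>R dird 1 f w
    - (dird 1 f w \<bullet> dird \<i> f w) *\<^sub>R dird \<i> f w"
proof -
  have "area_density f w *\<^sub>R conormal_x f w
      = cross3 (dird \<i> f w) (cross3 (dird 1 f w) (dird \<i> f w))"
    unfolding conormal_x_def unit_normal_cross3[symmetric] by (simp add: cross_mult_right)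
  then show ?thesis by (simp add: cross3_cross3_right inner_commute)
qed

lemma area_density_conormal_y:
  "area_density f w *\<^sub>R conormal_y f w = (dird 1 f w \<bullet> dird 1 f w) *\<^sub>R dird \<i> f w
    - (dird 1 f w \<bullet> dird \<i> f w) *\<^sub>R dird 1 f w"
proof -
  have "area_density f w *\<^sub>R conormal_y f w
      = - cross3 (dird 1 f w) (cross3 (dird 1 f w) (dird \<i> f w))"
    unfolding conormal_y_def unit_normal_cross3[symmetric]
    by (simp add: cross_mult_right cross_skew[of "unit_normal f w"])
  then show ?thesis by (simp add: cross3_cross3_right)
qed

text \<open>
  The image of the position field under the derivative of \<open>f\<close> is the orthogonal projection of \<open>f\<close> to the
  tangent plane. For an immersion this determines the field, and it does not mention coordinates.
\<close>

lemma position_field_tangent: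
  assumes lin: "linear (frechet_derivative f (at w))" and pos: "area_density f w > 0"
  shows "dird (position_field f w) f w \<bullet> dird v f w
    = f w \<bullet> dird v f w"
proof -
  let ?D = "frechet_derivative f (at w)"
  let ?A = "area_density f w"
  define E where "E = ?D 1 \<bullet> ?D 1"
  define F where "F = ?D 1 \<bullet> ?D \<i>"
  define G where "G = ?D \<i> \<bullet> ?D \<i>"
  define p where "p = f w \<bullet> ?D 1"
  define q where "q = f w \<bullet> ?D \<i>"
  have A2: "?A * ?A = E * G - F\<^sup>2"
    using pos by (simp add: metric_det_def induced_metric_def E_def F_def G_def)
  have Vx: "?A * (f w \<bullet> conormal_x f w) = G * p - F * q"
    using arg_cong[OF area_density_conormal_x[of f w], of "\<lambda>x. f w \<bullet> x"]
    by (simp add: inner_diff_right E_def F_def G_def p_def q_def)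
  have Vy: "?A * (f w \<bullet> conormal_y f w) = E * q - F * p"
    using arg_cong[OF area_density_conormal_y[of f w], of "\<lambda>x. f w \<bullet> x"]
    by (simp add: inner_diff_right E_def F_def G_def p_def q_def)
  define s where "s = Re (position_field f w)"
  define t where "t = Im (position_field f w)"
  have s: "?A * ?A * s = G * p - F * q" and t: "?A * ?A * t = E * q - F * p"
  proof -
    have AA: "\<And>A x :: real. A > 0 \<Longrightarrow> A * A * (x / A) = A * x" by simp
    show "?A * ?A * s = G * p - F * q"
      unfolding s_def position_field_def complex.sel AA[OF pos] by (rule Vx)
    show "?A * ?A * t = E * q - F * p"
      unfolding t_def position_field_def complex.sel AA[OF pos] by (rule Vy)
  qed
  have ne: "E * G - F\<^sup>2 \<noteq> 0" using A2 pos by (metis less_irrefl mult_pos_pos)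
  note st = s[unfolded A2] t[unfolded A2]
  have "(E * G - F\<^sup>2) * (E * s + F * t) = E * ((E * G - F\<^sup>2) * s) + F * ((E * G - F\<^sup>2) * t)"
    by (simp add: algebra_simps)
  also have "\<dots> = E * (G * p - F * q) + F * (E * q - F * p)" unfolding st ..
  also have "\<dots> = (E * G - F\<^sup>2) * p" by (simp add: algebra_simps power2_eq_square)
  finally have 1: "E * s + F * t = p" using ne by simp
  have "(E * G - F\<^sup>2) * (F * s + G * t) = F * ((E * G - F\<^sup>2) * s) + G * ((E * G - F\<^sup>2) * t)"
    by (simp add: algebra_simps)
  also have "\<dots> = F * (G * p - F * q) + G * (E * q - F * p)" unfolding st ..
  also have "\<dots> = (E * G - F\<^sup>2) * q" by (simp add: algebra_simps power2_eq_square)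
  finally have 2: "F * s + G * t = q" using ne by simp
  have D: "?D v = Re v *\<^sub>R ?D 1 + Im v *\<^sub>R ?D \<i>" for v
    using linear_complex_expand[OF lin] .
  have "?D (position_field f w) \<bullet> ?D v = Re v * (E * s + F * t) + Im v * (F * s + G * t)"
    unfolding D[of v] D[of "position_field f w"] E_def F_def G_def s_def t_def
    by (simp add: inner_add_left inner_add_right inner_commute[of "?D \<i>" "?D 1"] algebra_simps)
  also have "\<dots> = f w \<bullet> ?D v"
    unfolding 1 2 D[of v] by (simp add: p_def q_def inner_add_right)
  finally show ?thesis .
qed

lemma tangent_field_unique:
  fixes L :: "'a::real_vector \<Rightarrow> 'b::real_inner"
  assumes "linear L" "inj L" "\<And>v. L x \<bullet> L v = p \<bullet> L v" "\<And>v. L y \<bullet> L v = p \<bullet> L v"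
  shows "x = y"
proof -
  have "L (x - y) \<bullet> L v = 0" for v
    using assms(3,4)[of v] linear_diff[OF assms(1)] by (simp add: inner_diff_left)
  then have "L (x - y) = 0" by (metis inner_eq_zero_iff)
  then show ?thesis
    using linear_injective_0[OF assms(1)] assms(2) by force
qed

text \<open>
  A minimal immersion of an open subset of the plane.
\<close>

locale minimal_patch =
  fixes W :: "complex set" and f :: "complex \<Rightarrow> real^3"
  assumes open_W: "open W" and smooth: "smooth_on W f"
    and immersed: "w \<in> W \<Longrightarrow> inj (frechet_derivative f (at w))"
    and minimal: "w \<in> W \<Longrightarrow> mean_curvature f w = 0"
begin

lemma c1: "c1_on W f" "c1_on W (dird v f)"
  using smooth smooth_on_dird smooth_on_imp_c1_on by blast+

lemma linear_df: "w \<in> W \<Longrightarrow> linear (frechet_derivative f (at w))"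
  using c1(1) by (simp add: c1_on_def linear_frechet)

lemma normal_nonzero: "w \<in> W \<Longrightarrow> cross3 (dird 1 f w) (dird \<i> f w) \<noteq> 0"
  using inj_linear_cross3_nonzero[OF linear_df immersed] by blast

lemma area_density_pos: "w \<in> W \<Longrightarrow> area_density f w > 0"
  using normal_nonzero by (simp only: area_density_cross3 zero_less_norm_iff not_False_eq_True)

lemma c1_area_density: "c1_on W (area_density f)"
proof -
  have "c1_on W (\<lambda>w. sqrt (cross3 (dird 1 f w) (dird \<i> f w) \<bullet> cross3 (dird 1 f w) (dird \<i> f w)))"
    by (intro c1_on_sqrt c1_on_inner c1_on_cross3 c1) (simp add: normal_nonzero)
  then show ?thesis
    by (simp add: metric_det_cross3 dot_square_norm)
qed

lemma c1_unit_normal: "c1_on W (unit_normal f)"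
proof -
  have "c1_on W (\<lambda>w. inverse (area_density f w) *\<^sub>R cross3 (dird 1 f w) (dird \<i> f w))"
    using area_density_pos
    by (intro c1_on_scaleR c1_on_inverse c1_area_density c1_on_cross3 c1) force
  moreover have "unit_normal f = (\<lambda>w. inverse (area_density f w) *\<^sub>R cross3 (dird 1 f w) (dird \<i> f w))"
    by (simp only: fun_eq_iff area_density_cross3 unit_normal_def sgn_div_norm) simp
  ultimately show ?thesis by simp
qed

lemma c1_conormal: "c1_on W (conormal_x f)" "c1_on W (conormal_y f)"
  unfolding conormal_x_def[abs_def] conormal_y_def[abs_def]
  by (intro c1_on_cross3 c1 c1_unit_normal)+

lemma unit_normal_orthogonal:
  assumes w: "w \<in> W"
  shows "unit_normal f w \<bullet> dird 1 f w = 0" "unit_normal f w \<bullet> dird \<i> f w = 0"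
    "unit_normal f w \<bullet> unit_normal f w = 1"
  using normal_nonzero[OF w]
  by (simp_all add: unit_normal_def sgn_div_norm dot_cross_self dot_square_norm norm_sgn
       power2_eq_square)

lemma dird_inner_zero:
  fixes g h :: "complex \<Rightarrow> real^3"
  assumes w: "w \<in> W" and "c1_on W g" "c1_on W h" and const: "\<And>x. x \<in> W \<Longrightarrow> g x \<bullet> h x = c"
  shows "g w \<bullet> dird v h w + dird v g w \<bullet> h w = 0"
proof -
  have "((\<lambda>x. g x \<bullet> h x) has_derivative (\<lambda>v. g w \<bullet> dird v h w + dird v g w \<bullet> h w)) (at w)"
    using assms by (auto intro!: derivative_eq_intros c1_on_has_derivative)
  moreover have "((\<lambda>x. g x \<bullet> h x) has_derivative (\<lambda>v. 0)) (at w)"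
    by (rule has_derivative_transform_within_open[OF has_derivative_const open_W w])
      (simp add: const)
  ultimately show ?thesis by (rule has_derivative_unique[THEN fun_cong])
qed

text \<open>
  The derivatives of the unit normal are tangential, with components given by the second fundamental form.
\<close>

lemma Weingarten:
  assumes w: "w \<in> W"
  shows "dird u (unit_normal f) w \<bullet> unit_normal f w = 0"
    "dird u (unit_normal f) w \<bullet> dird 1 f w = - second_form f w u 1"
    "dird u (unit_normal f) w \<bullet> dird \<i> f w = - second_form f w u \<i>"
  using dird_inner_zero[OF w c1_unit_normal c1_unit_normal, of 1 u]
    dird_inner_zero[OF w c1_unit_normal c1(2)[of 1], of 0 u]
    dird_inner_zero[OF w c1_unit_normal c1(2)[of \<i>], of 0 u]
  by (simp_all add: unit_normal_orthogonal second_form_def inner_commute)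

lemma mixed_partials: "w \<in> W \<Longrightarrow> dird \<i> (dird 1 f) w = dird 1 (dird \<i> f) w"
  using mixed_partials_commute[OF open_W _ _ c1(2) c1(2)] c1(1) by (simp add: c1_on_def)

text \<open>
  Each coordinate of a minimal immersion is harmonic. The divergence is orthogonal to both tangent
  vectors because the derivatives of the unit normal are tangential, and its normal component is twice the mean
  curvature times the area density.
\<close>

lemma divergence_conormal:
  assumes w: "w \<in> W"
  shows "dird 1 (conormal_x f) w + dird \<i> (conormal_y f) w = 0"
proof -
  let ?n = "unit_normal f w" and ?a = "dird 1 f w" and ?b = "dird \<i> f w"
  let ?n1 = "dird 1 (unit_normal f) w" and ?n2 = "dird \<i> (unit_normal f) w"
  let ?A = "area_density f w"
  have dx: "(conormal_x f has_derivative (\<lambda>v. cross3 ?b (dird v (unit_normal f) w)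
      + cross3 (dird v (dird \<i> f) w) ?n)) (at w)"
    unfolding conormal_x_def[abs_def]
    by (rule bounded_bilinear.FDERIV[OF bounded_bilinear_cross3])
      (use c1_on_has_derivative[OF c1(2) w] c1_on_has_derivative[OF c1_unit_normal w] in auto)
  have dy: "(conormal_y f has_derivative (\<lambda>v. cross3 ?n (dird v (dird 1 f) w)
      + cross3 (dird v (unit_normal f) w) ?a)) (at w)"
    unfolding conormal_y_def[abs_def]
    by (rule bounded_bilinear.FDERIV[OF bounded_bilinear_cross3])
      (use c1_on_has_derivative[OF c1(2) w] c1_on_has_derivative[OF c1_unit_normal w] in auto)
  \<comment> \<open>the second derivatives of \<open>f\<close> cancel, since mixed partial derivatives commute\<close>
  define Q where "Q = cross3 ?b ?n1 + cross3 ?n2 ?a"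
  have Q: "dird 1 (conormal_x f) w + dird \<i> (conormal_y f) w = Q"
    unfolding frechet_derivative_at[OF dx, symmetric] frechet_derivative_at[OF dy, symmetric]
    using mixed_partials[OF w] cross_skew[of ?n "dird 1 (dird \<i> f) w"] by (simp add: Q_def)
  have Qa: "Q \<bullet> ?a = ?A * (?n1 \<bullet> ?n)"
  proof -
    have "Q \<bullet> ?a = cross3 ?a ?b \<bullet> ?n1"
      by (simp add: Q_def inner_add_left dot_cross_self cross3_inner_cyclic[of ?b ?n1]
          cross3_inner_cyclic[of ?n1 ?a])
    then show ?thesis by (simp flip: unit_normal_cross3 add: inner_commute)
  qed
  have Qb: "Q \<bullet> ?b = ?A * (?n2 \<bullet> ?n)"
  proof -
    have "Q \<bullet> ?b = cross3 ?a ?b \<bullet> ?n2"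
      by (simp add: Q_def inner_add_left dot_cross_self cross3_inner_cyclic[of ?n2 ?a])
    then show ?thesis by (simp flip: unit_normal_cross3 add: inner_commute)
  qed
  have Qn_conormal: "Q \<bullet> ?n = - (?n1 \<bullet> conormal_x f w) - ?n2 \<bullet> conormal_y f w"
    unfolding Q_def conormal_x_def conormal_y_def by (simp add: cross3_simps)
  have "?A * (Q \<bullet> ?n) = - (?n1 \<bullet> (?A *\<^sub>R conormal_x f w)) - ?n2 \<bullet> (?A *\<^sub>R conormal_y f w)"
    unfolding Qn_conormal by (simp add: right_diff_distrib)
  also have "\<dots> = induced_metric f w \<i> \<i> * second_form f w 1 1
      - induced_metric f w 1 \<i> * second_form f w 1 \<i>
      + induced_metric f w 1 1 * second_form f w \<i> \<i>
      - induced_metric f w 1 \<i> * second_form f w \<i> 1"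
    unfolding area_density_conormal_x area_density_conormal_y inner_diff_right inner_scaleR_right
      Weingarten[OF w] induced_metric_def by (simp add: algebra_simps)
  also have "\<dots> = 2 * metric_det f w * mean_curvature f w"
  proof -
    have "second_form f w \<i> 1 = second_form f w 1 \<i>"
      using mixed_partials[OF w] by (simp add: second_form_def)
    moreover have "metric_det f w \<noteq> 0" using area_density_pos[OF w] by auto
    ultimately show ?thesis by (simp add: mean_curvature_def)
  qed
  finally have Qn: "Q \<bullet> ?n = 0" using minimal[OF w] area_density_pos[OF w] by simp
  define N where "N = cross3 ?a ?b"
  have "cross3 Q N = 0"
    using Qa Qb Weingarten(1)[OF w] by (simp add: N_def cross3_cross3_right)
  moreover have "Q \<bullet> N = 0"
    unfolding N_def unit_normal_cross3[symmetric] using Qn by simp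
  ultimately have "norm Q * norm N = 0" using norm_cross_dot[of Q N] by simp
  then have "Q = 0" using normal_nonzero[OF w] by (simp add: N_def)
  then show ?thesis using Q by simp
qed

lemma position_field_unique:
  assumes "w \<in> W" "\<And>v. dird z f w \<bullet> dird v f w
      = f w \<bullet> dird v f w"
  shows "position_field f w = z"
  by (rule tangent_field_unique[OF linear_df[OF assms(1)] immersed[OF assms(1)] _ assms(2)])
    (rule position_field_tangent[OF linear_df[OF assms(1)] area_density_pos[OF assms(1)]])

lemma continuous_position_field: "continuous_on W (position_field f)"
proof -
  have "continuous_on W (\<lambda>w. complex_of_real ((f w \<bullet> conormal_x f w) / area_density f w)
      + \<i> * complex_of_real ((f w \<bullet> conormal_y f w) / area_density f w))"
    using area_density_pos
    by (intro continuous_intros c1_on_continuous[OF c1(1)] c1_conormal[THEN c1_on_continuous]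
        c1_on_continuous[OF c1_area_density]) force+
  then show ?thesis by (simp add: position_field_def[abs_def] Complex_eq)
qed

text \<open>
  The divergence of \<open>\<psi> X\<^sup>T\<close>, multiplied by the area density.
\<close>

lemma divergence_identity:
  assumes w: "w \<in> W" and \<psi>: "c1_on W \<psi>"
  shows "dird 1 (\<lambda>w. \<psi> w * (f w \<bullet> conormal_x f w)) w + dird \<i> (\<lambda>w. \<psi> w * (f w \<bullet> conormal_y f w)) w
    = area_density f w * (2 * \<psi> w + dird (position_field f w) \<psi> w)"
proof -
  let ?a = "dird 1 f w" and ?b = "dird \<i> f w" and ?n = "unit_normal f w"
  let ?X = "conormal_x f" and ?Y = "conormal_y f" and ?A = "area_density f w"
  have d: "((\<lambda>w. \<psi> w * (f w \<bullet> V w)) has_derivative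
      (\<lambda>v. \<psi> w * (f w \<bullet> dird v V w + dird v f w \<bullet> V w) + dird v \<psi> w * (f w \<bullet> V w))) (at w)"
    if "c1_on W V" for V
    by (rule has_derivative_mult has_derivative_inner c1_on_has_derivative \<psi> c1 w that)+
  have Aab: "?a \<bullet> ?X w = ?A" "?b \<bullet> ?Y w = ?A"
  proof -
    have nn: "cross3 ?a ?b \<bullet> ?n = ?A"
      unfolding unit_normal_cross3[symmetric] by (simp add: unit_normal_orthogonal(3)[OF w])
    show "?a \<bullet> ?X w = ?A" "?b \<bullet> ?Y w = ?A"
      using nn unfolding conormal_x_def conormal_y_def
      by (simp_all add: cross3_simps)
  qed
  have lin: "linear (frechet_derivative \<psi> (at w))"
    using \<psi> w by (simp add: c1_on_def linear_frechet)
  have "?A * dird (position_field f w) \<psi> w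
      = dird 1 \<psi> w * (f w \<bullet> ?X w) + dird \<i> \<psi> w * (f w \<bullet> ?Y w)"
    unfolding linear_complex_expand[OF lin, of "position_field f w"]
    using area_density_pos[OF w] by (simp add: position_field_def field_simps)
  moreover have "f w \<bullet> dird 1 ?X w + f w \<bullet> dird \<i> ?Y w = 0"
    using divergence_conormal[OF w] by (simp flip: inner_add_right)
  ultimately show ?thesis
    unfolding frechet_derivative_at[OF d[OF c1_conormal(1)], symmetric]
      frechet_derivative_at[OF d[OF c1_conormal(2)], symmetric]
    using Aab by algebra
qed

lemma planar_divergence:
  assumes \<psi>: "c1_on W \<psi>" and K: "compact K" "K \<subseteq> W" and out: "\<And>w. w \<in> W - K \<Longrightarrow> \<psi> w = 0"
  shows "integrable lborel (\<lambda>w. indicator W w * (area_density f w * \<psi> w))" (is ?th1)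
    and "integrable lborel (\<lambda>w. indicator W w *
      (area_density f w * dird (position_field f w) \<psi> w))" (is ?th2)
    and "2 * (\<integral>w. indicator W w * (area_density f w * \<psi> w) \<partial>lborel)
      + (\<integral>w. indicator W w * (area_density f w * dird (position_field f w) \<psi> w)
          \<partial>lborel) = 0" (is ?th3)
proof -
  have d0: "dird v \<psi> w = 0" if "w \<in> W - K" for w v
  proof -
    have "frechet_derivative \<psi> (at w) = frechet_derivative (\<lambda>x. 0::real) (at w)"
      by (rule dird_cong_open[of "W - K"])
        (use K that out open_W in \<open>auto simp: compact_imp_closed open_Diff\<close>)
    then show ?thesis by simp
  qed
  have contK: "continuous_on K g" if "continuous_on W g" for g :: "complex \<Rightarrow> real"
    using that K(2) continuous_on_subset by blast
  have cA: "continuous_on K (area_density f)" "continuous_on K \<psi>"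
    using c1_on_continuous[OF c1_area_density] c1_on_continuous[OF \<psi>] contK by blast+
  show th1: ?th1
    by (rule integrable_continuous_compact_support[OF _ K(1)], rule contK)
      (use out K(2) cA c1_on_continuous[OF \<psi>] c1_on_continuous[OF c1_area_density] in
        \<open>auto intro!: continuous_intros simp: indicator_def cong: continuous_on_cong\<close>)
  have cd: "continuous_on W (\<lambda>w. dird (position_field f w) \<psi> w)"
  proof -
    have "linear (frechet_derivative \<psi> (at w))" if "w \<in> W" for w
      using \<psi> that by (simp add: c1_on_def linear_frechet)
    note expand = linear_complex_expand[OF this]
    have "continuous_on W (\<lambda>w. Re (position_field f w) *\<^sub>R dird 1 \<psi> w
        + Im (position_field f w) *\<^sub>R dird \<i> \<psi> w)"
      by (intro continuous_intros continuous_position_field c1_on_dird_continuous \<psi>)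
    then show ?thesis by (subst continuous_on_cong[OF refl expand])
  qed
  show th2: ?th2
    by (rule integrable_continuous_compact_support[OF _ K(1)], rule contK)
      (use d0 K(2) cA cd c1_on_continuous[OF c1_area_density] in
        \<open>auto intro!: continuous_intros simp: indicator_def cong: continuous_on_cong\<close>)
  have main: "(\<integral>w. dird v G w \<partial>lborel) = 0 \<and> integrable lborel (dird v G)
      \<and> (\<forall>w. dird v G w = indicator W w * dird v (\<lambda>w. \<psi> w * (f w \<bullet> V w)) w)"
    if V: "c1_on W V" and G: "G = (\<lambda>w. if w \<in> W then \<psi> w * (f w \<bullet> V w) else 0)" for V v G
  proof -
    have o: "open (- K)" "open W" using K(1) open_W by (auto simp: compact_imp_closed open_Compl)
    have GW: "c1_on W G"
      by (rule c1_on_cong_open[OF o(2) _ c1_on_mult[OF \<psi> c1_on_inner[OF c1(1) V]]]) (simp add: G)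
    have GK: "c1_on (-K) G"
      by (rule c1_on_cong_open[OF o(1) _ c1_on_const[of _ 0]]) (use out in \<open>auto simp: G\<close>)
    have c: "c1_on UNIV G"
      by (rule c1_on_local) (use GW GK o K(2) in blast)
    have "dird v G w = indicator W w * dird v (\<lambda>w. \<psi> w * (f w \<bullet> V w)) w" for w
    proof (cases "w \<in> W")
      case True
      then have "frechet_derivative G (at w) = frechet_derivative (\<lambda>w. \<psi> w * (f w \<bullet> V w)) (at w)"
        by (rule dird_cong_open[OF o(2)]) (simp add: G)
      then show ?thesis using True by simp
    next
      case False
      then have "frechet_derivative G (at w) = frechet_derivative (\<lambda>w. 0::real) (at w)"
        by (intro dird_cong_open[OF o(1)]) (use out K(2) in \<open>auto simp: G\<close>)
      then show ?thesis using False by simp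
    qed
    then show ?thesis
      using integral_dird_compact_support[OF c K(1), of v] out by (auto simp: G)
  qed
  define G1 where "G1 = (\<lambda>w. if w \<in> W then \<psi> w * (f w \<bullet> conormal_x f w) else 0)"
  define G2 where "G2 = (\<lambda>w. if w \<in> W then \<psi> w * (f w \<bullet> conormal_y f w) else 0)"
  note m1 = main[OF c1_conormal(1) G1_def, of 1] and m2 = main[OF c1_conormal(2) G2_def, of \<i>]
  let ?h = "\<lambda>w. indicator W w * (area_density f w * \<psi> w)"
  let ?k = "\<lambda>w. indicator W w *
      (area_density f w * dird (position_field f w) \<psi> w)"
  have "2 * (\<integral>w. ?h w \<partial>lborel) + (\<integral>w. ?k w \<partial>lborel) = (\<integral>w. 2 * ?h w + ?k w \<partial>lborel)"
    using th1 th2 by simp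
  also have "\<dots> = (\<integral>w. indicator W w * dird 1 (\<lambda>w. \<psi> w * (f w \<bullet> conormal_x f w)) w
      + indicator W w * dird \<i> (\<lambda>w. \<psi> w * (f w \<bullet> conormal_y f w)) w \<partial>lborel)"
  proof (rule Bochner_Integration.integral_cong[OF refl])
    fix w
    show "2 * ?h w + ?k w = indicator W w * dird 1 (\<lambda>w. \<psi> w * (f w \<bullet> conormal_x f w)) w
      + indicator W w * dird \<i> (\<lambda>w. \<psi> w * (f w \<bullet> conormal_y f w)) w"
      using divergence_identity[OF _ \<psi>, of w] by (cases "w \<in> W") (simp_all add: algebra_simps)
  qed
  also have "\<dots> = (\<integral>w. dird 1 G1 w + dird \<i> G2 w \<partial>lborel)"
    using m1 m2 by simp
  also have "\<dots> = 0"
    using Bochner_Integration.integral_add[OF m1[THEN conjunct2, THEN conjunct1]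
        m2[THEN conjunct2, THEN conjunct1]] m1[THEN conjunct1] m2[THEN conjunct1]
    by (simp only: add_0)
  finally show ?th3 .
qed

end

section \<open>Functions on the surface\<close>

text \<open>
  The squared positive part is \<open>C\<^sup>1\<close> on the real line; it is the only building block of the bump and
  cutoff functions below, all of which need one derivative only.
\<close>

definition sqpos :: "real \<Rightarrow> real"
  where "sqpos t = (max 0 t)\<^sup>2"

lemma sqpos_has_derivative: "(sqpos has_real_derivative 2 * max 0 t) (at t)"
proof -
  consider "t < 0" | "t > 0" | "t = 0" by linarith
  then show ?thesis
  proof cases
    case 1
    have "(sqpos has_real_derivative 0) (at t)"
      by (rule has_field_derivative_transform_within_open[where f = "\<lambda>t. 0" and S = "{..<0}"])
        (use 1 in \<open>auto simp: sqpos_def\<close>)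
    then show ?thesis using 1 by simp
  next
    case 2
    have "(sqpos has_real_derivative 2 * t) (at t)"
      by (rule has_field_derivative_transform_within_open[where f = "\<lambda>t. t\<^sup>2" and S = "{0<..}"])
        (use 2 in \<open>auto simp: sqpos_def intro!: derivative_eq_intros\<close>)
    then show ?thesis using 2 by simp
  next
    case 3
    have "((\<lambda>h. sqpos h / h) \<longlongrightarrow> 0) (at 0)"
    proof (rule Lim_null_comparison)
      show "\<forall>\<^sub>F h in at 0. norm (sqpos h / h) \<le> \<bar>h\<bar>"
        by (rule always_eventually) (auto simp: sqpos_def power2_eq_square max_def)
      show "((\<lambda>h::real. \<bar>h\<bar>) \<longlongrightarrow> 0) (at 0)" by (auto intro!: tendsto_eq_intros)
    qed
    then show ?thesis using 3 by (simp add: DERIV_def sqpos_def)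
  qed
qed

lemma c1_on_sqpos: "c1_on W sqpos"
  by (rule c1_onI[where f' = "\<lambda>t h. 2 * max 0 t * h"])
    (use sqpos_has_derivative in \<open>auto simp: has_field_derivative_def intro!: continuous_intros\<close>)

lemma c1_on_id: "c1_on W (\<lambda>x. x)"
  by (rule c1_onI[where f' = "\<lambda>x h. h"]) auto

text \<open>
  A radial \<open>C\<^sup>1\<close> bump, for \<open>r > 0\<close> positive exactly on the ball of radius \<open>r\<close> about \<open>c\<close>.
\<close>

definition bump :: "complex \<Rightarrow> real \<Rightarrow> complex \<Rightarrow> real"
  where "bump c r w = sqpos (1 - (w - c) \<bullet> (w - c) / r\<^sup>2)"

lemma c1_on_bump: "c1_on W (bump c r)"
proof -
  have "c1_on W (\<lambda>w. 1 - (w - c) \<bullet> (w - c) * inverse (r\<^sup>2))"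
    by (intro c1_on_diff c1_on_mult c1_on_inner c1_on_id c1_on_const)
  from c1_on_compose[OF this c1_on_sqpos[of UNIV]] show ?thesis
    by (simp add: comp_def bump_def[abs_def] divide_inverse)
qed

lemma bump_nonneg: "bump c r w \<ge> 0"
  by (simp add: bump_def sqpos_def)

lemma bump_pos:
  assumes "w \<in> ball c r" shows "bump c r w > 0"
proof -
  have r: "r > 0" "norm (w - c) < r"
    using assms by (auto simp: dist_norm norm_minus_commute intro: le_less_trans[OF norm_ge_zero])
  then have "(w - c) \<bullet> (w - c) < r\<^sup>2"
    by (simp add: dot_square_norm power_strict_mono)
  then show ?thesis using r by (simp add: bump_def sqpos_def max_def)
qed

lemma bump_zero:
  assumes "r > 0" "w \<notin> cball c r" shows "bump c r w = 0"
proof -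
  have "r < norm (w - c)" using assms by (auto simp: dist_norm norm_minus_commute)
  then have "r\<^sup>2 < (w - c) \<bullet> (w - c)"
    using assms(1) by (simp add: dot_square_norm power_strict_mono)
  then show ?thesis using assms(1) by (simp add: bump_def sqpos_def max_def)
qed

text \<open>
  A real function on the surface is of class \<open>C\<^sup>1\<close> if its representative in every chart of the atlas is.
\<close>

definition C1_surface :: "'a chart set \<Rightarrow> ('a \<Rightarrow> real) \<Rightarrow> bool"
  where "C1_surface \<A> \<psi> \<longleftrightarrow> (\<forall>c\<in>\<A>. c1_on (snd c ` fst c) (local_rep \<psi> c))"

lemma local_rep_pair: "local_rep \<psi> (U, \<phi>) = (\<lambda>w. \<psi> (inv_into U \<phi> w))"
  by (simp add: local_rep_def comp_def)

lemma local_rep_lambda: "local_rep \<psi> c = (\<lambda>w. \<psi> (inv_into (fst c) (snd c) w))"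
  by (simp add: local_rep_def comp_def)

lemma C1_surface_const: "C1_surface \<A> (\<lambda>x. k)"
  by (auto simp: C1_surface_def local_rep_lambda)

lemma C1_surface_mult: "C1_surface \<A> f \<Longrightarrow> C1_surface \<A> g \<Longrightarrow> C1_surface \<A> (\<lambda>x. f x * g x)"
  by (auto simp: C1_surface_def local_rep_lambda intro!: c1_on_mult)

lemma C1_surface_diff: "C1_surface \<A> f \<Longrightarrow> C1_surface \<A> g \<Longrightarrow> C1_surface \<A> (\<lambda>x. f x - g x)"
  by (auto simp: C1_surface_def local_rep_lambda intro!: c1_on_diff)

lemma C1_surface_sum:
  "(\<And>i. i \<in> I \<Longrightarrow> C1_surface \<A> (f i)) \<Longrightarrow> C1_surface \<A> (\<lambda>x. \<Sum>i\<in>I. f i x)"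
  by (auto simp: C1_surface_def local_rep_lambda intro!: c1_on_sum)

text \<open>
  The derivative of a function on the surface along the position field. It is computed in an arbitrary
  chart around the point; lemma \<open>position_deriv_chart\<close> shows that the choice is immaterial away from the
  punctures, for \<open>C\<^sup>1\<close> functions.
\<close>

definition position_deriv :: "'a chart set \<Rightarrow> ('a \<Rightarrow> real^3) \<Rightarrow> ('a \<Rightarrow> real) \<Rightarrow> 'a \<Rightarrow> real"
  where "position_deriv \<A> X \<psi> x =
    (let c = (SOME c. c \<in> \<A> \<and> x \<in> fst c) in
      dird (position_field (local_rep X c) (snd c x)) (local_rep \<psi> c) (snd c x))"

text \<open>
  The function on the surface that is \<open>k\<close> in the coordinate of the chart and zero off its domain.
\<close>

definition extend_chart :: "'a chart \<Rightarrow> (complex \<Rightarrow> real) \<Rightarrow> 'a \<Rightarrow> real"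
  where "extend_chart c k x = (if x \<in> fst c then k (snd c x) else 0)"

text \<open>
  A closed surface with a minimal immersion off a finite set \<open>P\<close> of punctures, and the area measure of the
  induced metric.
\<close>

locale minimal_surface =
  fixes S :: "'a::t2_space set" and \<A> :: "'a chart set" and P :: "'a set"
    and X :: "'a \<Rightarrow> real^3" and \<mu> :: "'a measure"
  assumes closed: "closed_surface S \<A>" and finite_P: "finite P"
    and minimal: "minimal_immersion \<A> P X" and area: "is_area_measure S \<A> P X \<mu>"
begin

lemma compact_S: "compact S"
  using closed by (simp add: closed_surface_def)

lemma chart:
  assumes "(U, \<phi>) \<in> \<A>"
  shows "openin (top_of_set S) U" "U \<subseteq> S" "open (\<phi> ` U)" "homeomorphism U (\<phi> ` U) \<phi> (inv_into U \<phi>)"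
    "continuous_on U \<phi>" "continuous_on (\<phi> ` U) (inv_into U \<phi>)" "inj_on \<phi> U"
    "x \<in> U \<Longrightarrow> inv_into U \<phi> (\<phi> x) = x"
proof -
  have "chart_on S (U, \<phi>)"
    using assms closed unfolding closed_surface_def maximal_smooth_atlas_def by blast
  then show h: "openin (top_of_set S) U" "open (\<phi> ` U)" "homeomorphism U (\<phi> ` U) \<phi> (inv_into U \<phi>)"
    by (auto simp: chart_on_def)
  then show "U \<subseteq> S" "continuous_on U \<phi>" "continuous_on (\<phi> ` U) (inv_into U \<phi>)"
    "x \<in> U \<Longrightarrow> inv_into U \<phi> (\<phi> x) = x"
    by (auto simp: homeomorphism_def openin_imp_subset)
  show "inj_on \<phi> U"
    by (rule inj_on_inverseI[where g = "inv_into U \<phi>"]) (use h(3) in \<open>auto simp: homeomorphism_def\<close>)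
qed

lemma chart_covers:
  assumes "x \<in> S" obtains U \<phi> where "(U, \<phi>) \<in> \<A>" "x \<in> U"
proof -
  have "x \<in> (\<Union>c\<in>\<A>. fst c)"
    using assms closed by (simp add: closed_surface_def maximal_smooth_atlas_def)
  then obtain c where "c \<in> \<A>" "x \<in> fst c" by blast
  then show ?thesis using that[of "fst c" "snd c"] by simp
qed

lemma open_chart_image:
  assumes "(U, \<phi>) \<in> \<A>" "openin (top_of_set S) V" "V \<subseteq> U"
  shows "open (\<phi> ` V)"
proof -
  have "openin (top_of_set U) V"
    using assms(2,3) chart(2)[OF assms(1)] by (rule openin_subset_trans)
  then have "openin (top_of_set (\<phi> ` U)) (\<phi> ` V)"
    using homeomorphism_imp_open_map[OF chart(4)[OF assms(1)]] by blast
  then show ?thesis using chart(3)[OF assms(1)] openin_open_trans by blast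
qed

lemma openin_minus_finite:
  assumes "openin (top_of_set S) U" "finite Q" shows "openin (top_of_set S) (U - Q)"
proof -
  obtain T where T: "open T" "U = S \<inter> T" using assms(1) unfolding openin_open by blast
  have "open (T - Q)" using T(1) finite_imp_closed[OF assms(2)] by (rule open_Diff)
  moreover have "U - Q = S \<inter> (T - Q)" using T(2) by blast
  ultimately show ?thesis unfolding openin_open by blast
qed

lemma openin_minus_chart_compact:
  assumes c: "(U, \<phi>) \<in> \<A>" and K: "compact K" "K \<subseteq> \<phi> ` U" and V: "openin (top_of_set S) V"
  shows "openin (top_of_set S) (V - inv_into U \<phi> ` K)"
proof -
  obtain T where T: "open T" "V = S \<inter> T" using V unfolding openin_open by blast
  have "compact (inv_into U \<phi> ` K)"
    using compact_continuous_image[OF continuous_on_subset[OF chart(6)[OF c] K(2)] K(1)] .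
  then have "open (T - inv_into U \<phi> ` K)"
    using T(1) compact_imp_closed by blast
  moreover have "V - inv_into U \<phi> ` K = S \<inter> (T - inv_into U \<phi> ` K)" using T(2) by blast
  ultimately show ?thesis unfolding openin_open by blast
qed

lemma open_punctured_chart: "(U, \<phi>) \<in> \<A> \<Longrightarrow> open (\<phi> ` (U - P))"
  using open_chart_image openin_minus_finite[OF chart(1) finite_P] by blast

lemma transition:
  assumes "(U, \<phi>) \<in> \<A>" "(V, \<theta>) \<in> \<A>"
  shows "open (\<theta> ` (U \<inter> V))" "c1_on (\<theta> ` (U \<inter> V)) (\<phi> \<circ> inv_into V \<theta>)"
    "(\<phi> \<circ> inv_into V \<theta>) ` \<theta> ` (U \<inter> V) \<subseteq> \<phi> ` U"
    "w \<in> \<theta> ` (U \<inter> V) \<Longrightarrow> local_rep \<psi> (V, \<theta>) w = local_rep \<psi> (U, \<phi>) ((\<phi> \<circ> inv_into V \<theta>) w)"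
proof -
  show "open (\<theta> ` (U \<inter> V))"
    using open_chart_image[OF assms(2), of "U \<inter> V"] openin_Int chart(1) assms by blast
  have "compatible_charts (U, \<phi>) (V, \<theta>)"
    using assms closed unfolding closed_surface_def maximal_smooth_atlas_def by blast
  then show "c1_on (\<theta> ` (U \<inter> V)) (\<phi> \<circ> inv_into V \<theta>)"
    by (intro smooth_on_imp_c1_on) (auto simp: compatible_charts_def)
  show "(\<phi> \<circ> inv_into V \<theta>) ` \<theta> ` (U \<inter> V) \<subseteq> \<phi> ` U"
    using chart(8)[OF assms(2)] by auto
  show "w \<in> \<theta> ` (U \<inter> V) \<Longrightarrow> local_rep \<psi> (V, \<theta>) w = local_rep \<psi> (U, \<phi>) ((\<phi> \<circ> inv_into V \<theta>) w)"
    using chart(8)[OF assms(1)] chart(8)[OF assms(2)] by (auto simp: local_rep_pair)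
qed

lemma patch:
  assumes c: "(U, \<phi>) \<in> \<A>"
  shows "minimal_patch (\<phi> ` (U - P)) (local_rep X (U, \<phi>))"
proof
  have imm: "\<forall>(U, \<phi>)\<in>\<A>. smooth_on (\<phi> ` (U - P)) (local_rep X (U, \<phi>)) \<and>
      (\<forall>w \<in> \<phi> ` (U - P). inj (frechet_derivative (local_rep X (U, \<phi>)) (at w)))"
    and mc: "\<forall>(U, \<phi>)\<in>\<A>. \<forall>w \<in> \<phi> ` (U - P). mean_curvature (local_rep X (U, \<phi>)) w = 0"
    using minimal unfolding minimal_immersion_def immersion_def by blast+
  show "open (\<phi> ` (U - P))" by (rule open_punctured_chart[OF c])
  show "smooth_on (\<phi> ` (U - P)) (local_rep X (U, \<phi>))"
    using bspec[OF imm c] by simp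
  show "inj (frechet_derivative (local_rep X (U, \<phi>)) (at w))" if "w \<in> \<phi> ` (U - P)" for w
    using bspec[OF imm c] that by auto
  show "mean_curvature (local_rep X (U, \<phi>)) w = 0" if "w \<in> \<phi> ` (U - P)" for w
    using bspec[OF mc c] that by auto
qed

lemma C1_surfaceD: "C1_surface \<A> \<psi> \<Longrightarrow> (U, \<phi>) \<in> \<A> \<Longrightarrow> c1_on (\<phi> ` U) (local_rep \<psi> (U, \<phi>))"
  by (fastforce simp: C1_surface_def)

lemma C1_surface_divide:
  assumes "C1_surface \<A> f" "C1_surface \<A> g" "\<And>x. x \<in> S \<Longrightarrow> g x \<noteq> 0"
  shows "C1_surface \<A> (\<lambda>x. f x / g x)"
  unfolding C1_surface_def divide_inverse local_rep_lambda
proof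
  fix c assume c: "c \<in> \<A>"
  show "c1_on (snd c ` fst c) (\<lambda>w. f (inv_into (fst c) (snd c) w) * inverse (g (inv_into (fst c) (snd c) w)))"
  proof (intro c1_on_mult c1_on_inverse)
    show "c1_on (snd c ` fst c) (\<lambda>w. f (inv_into (fst c) (snd c) w))"
      "c1_on (snd c ` fst c) (\<lambda>w. g (inv_into (fst c) (snd c) w))"
      using assms(1,2) c by (auto simp: C1_surface_def local_rep_lambda)
    show "g (inv_into (fst c) (snd c) w) \<noteq> 0" if "w \<in> snd c ` fst c" for w
      using assms(3) chart(2)[of "fst c" "snd c"] c inv_into_into[OF that] by auto
  qed
qed

lemma C1_surface_extend_chart:
  assumes c: "(U, \<phi>) \<in> \<A>" and k: "c1_on UNIV k" and K: "compact K" "K \<subseteq> \<phi> ` U"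
    and out: "\<And>w. w \<notin> K \<Longrightarrow> k w = 0"
  shows "C1_surface \<A> (extend_chart (U, \<phi>) k)"
  unfolding C1_surface_def
proof
  fix d assume d: "d \<in> \<A>"
  obtain V \<theta> where V: "d = (V, \<theta>)" by fastforce
  note d = d[unfolded V]
  let ?e = "extend_chart (U, \<phi>) k"
  have "c1_on (\<theta> ` V) (local_rep ?e (V, \<theta>))"
  proof (rule c1_on_local)
    fix w assume "w \<in> \<theta> ` V"
    then obtain x where x: "x \<in> V" "w = \<theta> x" by blast
    show "\<exists>T. open T \<and> w \<in> T \<and> c1_on T (local_rep ?e (V, \<theta>))"
    proof (cases "x \<in> U")
      case True
      have "c1_on (\<theta> ` (U \<inter> V)) (local_rep ?e (V, \<theta>))"
      proof (rule c1_on_cong_open[OF transition(1)[OF c d] _ c1_on_compose[OF transition(2)[OF c d] k]])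
        show "(k \<circ> (\<phi> \<circ> inv_into V \<theta>)) y = local_rep ?e (V, \<theta>) y" if "y \<in> \<theta> ` (U \<inter> V)" for y
          using that chart(8)[OF d] by (auto simp: local_rep_pair extend_chart_def)
      qed simp
      then show ?thesis using transition(1)[OF c d] x True by blast
    next
      case False
      let ?V = "V - inv_into U \<phi> ` K"
      have o: "open (\<theta> ` ?V)"
        using open_chart_image[OF d openin_minus_chart_compact[OF c K chart(1)[OF d]]] by blast
      have "c1_on (\<theta> ` ?V) (local_rep ?e (V, \<theta>))"
      proof (rule c1_on_cong_open[OF o _ c1_on_const[of _ 0]])
        show "0 = local_rep ?e (V, \<theta>) y" if y: "y \<in> \<theta> ` ?V" for y
        proof -
          obtain x where x: "x \<in> ?V" "y = \<theta> x" using y by blast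
          then have "\<phi> x \<notin> K" if "x \<in> U" using chart(8)[OF c that] by force
          then show ?thesis using x chart(8)[OF d] out
            by (auto simp: local_rep_pair extend_chart_def)
        qed
      qed
      moreover have "inv_into U \<phi> ` K \<subseteq> U" using K(2) by (auto intro: inv_into_into)
      then have "w \<in> \<theta> ` ?V" using x False by blast
      ultimately show ?thesis using o by (intro exI[of _ "\<theta> ` ?V"] conjI)
    qed
  qed
  then show "c1_on (snd d ` fst d) (local_rep ?e d)" by (simp add: V)
qed

abbreviation "along \<equiv> position_deriv \<A> X"

text \<open>
  Under a change of charts the position fields correspond to each other, since both project
  to the same tangential vector and the immersion is injective on tangent vectors.
\<close>

lemma position_deriv_chart_change:
  assumes \<psi>: "C1_surface \<A> \<psi>" and c: "(U, \<phi>) \<in> \<A>" and d: "(V, \<theta>) \<in> \<A>" and x: "x \<in> U \<inter> V - P"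
  shows "dird (position_field (local_rep X (V, \<theta>)) (\<theta> x)) (local_rep \<psi> (V, \<theta>)) (\<theta> x)
    = dird (position_field (local_rep X (U, \<phi>)) (\<phi> x)) (local_rep \<psi> (U, \<phi>)) (\<phi> x)"
proof -
  interpret pU: minimal_patch "\<phi> ` (U - P)" "local_rep X (U, \<phi>)" by (rule patch[OF c])
  interpret pV: minimal_patch "\<theta> ` (V - P)" "local_rep X (V, \<theta>)" by (rule patch[OF d])
  let ?\<tau> = "\<phi> \<circ> inv_into V \<theta>" and ?\<sigma> = "\<theta> \<circ> inv_into U \<phi>"
  let ?D\<tau> = "frechet_derivative ?\<tau> (at (\<theta> x))"
  have xU: "\<phi> x \<in> \<phi> ` (U - P)" and xV: "\<theta> x \<in> \<theta> ` (V - P)" and xUV: "\<theta> x \<in> \<theta> ` (U \<inter> V)"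
    and xVU: "\<phi> x \<in> \<phi> ` (V \<inter> U)"
    using x by auto
  have \<tau>x: "?\<tau> (\<theta> x) = \<phi> x" using x chart(8)[OF d] by simp
  have \<sigma>x: "?\<sigma> (\<phi> x) = \<theta> x" using x chart(8)[OF c] by simp
  have d\<tau>: "(?\<tau> has_derivative ?D\<tau>) (at (\<theta> x))"
    using c1_on_has_derivative[OF transition(2)[OF c d] xUV] .
  have chain: "dird v (local_rep g (V, \<theta>)) (\<theta> x)
      = dird (?D\<tau> v) (local_rep g (U, \<phi>)) (\<phi> x)"
    if "local_rep g (U, \<phi>) differentiable (at (\<phi> x))"
    for g :: "'a \<Rightarrow> 'b::real_normed_vector" and v
  proof -
    have "(local_rep g (U, \<phi>) has_derivative frechet_derivative (local_rep g (U, \<phi>)) (at (\<phi> x)))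
        (at (?\<tau> (\<theta> x)))"
      unfolding \<tau>x using that by (simp flip: frechet_derivative_works)
    from diff_chain_at[OF d\<tau> this]
    have "(local_rep g (V, \<theta>) has_derivative
        frechet_derivative (local_rep g (U, \<phi>)) (at (\<phi> x)) \<circ> ?D\<tau>) (at (\<theta> x))"
      by (rule has_derivative_transform_within_open[OF _ transition(1)[OF c d] xUV])
        (simp only: comp_apply[of "local_rep g (U, \<phi>)"] transition(4)[OF c d])
    from frechet_derivative_at[OF this] show ?thesis by (metis comp_apply)
  qed
  have surj: "\<exists>u. ?D\<tau> u = v" for v
  proof -
    have "(?\<sigma> has_derivative frechet_derivative ?\<sigma> (at (\<phi> x))) (at (\<phi> x))"
      using c1_on_has_derivative[OF transition(2)[OF d c] xVU] .
    moreover have "(?\<tau> has_derivative ?D\<tau>) (at (?\<sigma> (\<phi> x)))"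
      using d\<tau> \<sigma>x by (simp del: comp_apply)
    ultimately have "(?\<tau> \<circ> ?\<sigma> has_derivative ?D\<tau> \<circ> frechet_derivative ?\<sigma> (at (\<phi> x))) (at (\<phi> x))"
      by (rule diff_chain_at)
    then have "((\<lambda>w. w) has_derivative ?D\<tau> \<circ> frechet_derivative ?\<sigma> (at (\<phi> x))) (at (\<phi> x))"
      by (rule has_derivative_transform_within_open[OF _ transition(1)[OF d c] xVU])
        (use chart(8)[OF c] chart(8)[OF d] in auto)
    then have "?D\<tau> \<circ> frechet_derivative ?\<sigma> (at (\<phi> x)) = (\<lambda>v. v)"
      using has_derivative_unique[OF _ has_derivative_ident] by blast
    then show ?thesis by (metis comp_apply)
  qed
  let ?z = "position_field (local_rep X (V, \<theta>)) (\<theta> x)"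
  have dX: "local_rep X (U, \<phi>) differentiable (at (\<phi> x))"
    using pU.c1(1) xU unfolding c1_on_def by blast
  have d\<psi>: "local_rep \<psi> (U, \<phi>) differentiable (at (\<phi> x))"
    using C1_surfaceD[OF \<psi> c] x by (auto simp: c1_on_def)
  have "position_field (local_rep X (U, \<phi>)) (\<phi> x) = ?D\<tau> ?z"
  proof (rule pU.position_field_unique[OF xU])
    fix v
    obtain u where u: "v = ?D\<tau> u" using surj by metis
    have "local_rep X (V, \<theta>) (\<theta> x) = local_rep X (U, \<phi>) (\<phi> x)"
      using x chart(8)[OF c] chart(8)[OF d] by (simp add: local_rep_pair)
    then show "dird (?D\<tau> ?z) (local_rep X (U, \<phi>)) (\<phi> x)
        \<bullet> dird v (local_rep X (U, \<phi>)) (\<phi> x)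
      = local_rep X (U, \<phi>) (\<phi> x) \<bullet> dird v (local_rep X (U, \<phi>)) (\<phi> x)"
      unfolding u chain[OF dX, symmetric]
      using position_field_tangent[OF pV.linear_df[OF xV] pV.area_density_pos[OF xV]] by simp
  qed
  then show ?thesis by (simp add: chain[OF d\<psi>])
qed

lemma position_deriv_chart:
  assumes \<psi>: "C1_surface \<A> \<psi>" and c: "(U, \<phi>) \<in> \<A>" and x: "x \<in> U - P"
  shows "along \<psi> x = dird (position_field (local_rep X (U, \<phi>)) (\<phi> x)) (local_rep \<psi> (U, \<phi>)) (\<phi> x)"
proof -
  obtain V \<theta> where d: "(SOME c. c \<in> \<A> \<and> x \<in> fst c) = (V, \<theta>)" by fastforce
  have "(V, \<theta>) \<in> \<A> \<and> x \<in> fst (V, \<theta>)"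
    unfolding d[symmetric] by (rule someI[where x = "(U, \<phi>)"]) (use c x in auto)
  then show ?thesis
    using position_deriv_chart_change[OF \<psi> c, of V \<theta> x] x by (simp add: position_deriv_def d)
qed

lemma continuous_on_surface:
  assumes "\<And>U \<phi>. (U, \<phi>) \<in> \<A> \<Longrightarrow> continuous_on (\<phi> ` (U - P)) (\<lambda>w. g (inv_into U \<phi> w))"
  shows "continuous_on (S - P) g"
  unfolding continuous_on_eq_continuous_within
proof
  fix x assume x: "x \<in> S - P"
  then obtain U \<phi> where c: "(U, \<phi>) \<in> \<A>" "x \<in> U" using chart_covers by blast
  obtain T where T: "open T" "U = S \<inter> T" using chart(1)[OF c(1)] unfolding openin_open by blast
  have "continuous_on (U - P) (\<lambda>x. g (inv_into U \<phi> (\<phi> x)))"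
    by (rule continuous_on_compose2[OF assms[OF c(1)]])
      (auto intro: continuous_on_subset[OF chart(5)[OF c(1)]])
  then have "continuous_on (U - P) g"
    by (rule continuous_on_eq) (use chart(8)[OF c(1)] in auto)
  then have "continuous (at x within (U - P)) g"
    using x c(2) by (simp add: continuous_on_eq_continuous_within)
  moreover have "at x within (U - P) = at x within (S - P)"
    by (rule at_within_nhd[of x T]) (use T c(2) in auto)
  ultimately show "continuous (at x within (S - P)) g" by simp
qed

lemma borel_measurable_continuous_surface:
  assumes "continuous_on (S - P) (g :: 'a \<Rightarrow> real)" shows "g \<in> borel_measurable \<mu>"
proof -
  have "g \<in> borel_measurable (restrict_space borel (S - P))"
    by (rule borel_measurable_continuous_on_restrict[OF assms])
  moreover have "sets \<mu> = sets (restrict_space borel (S - P))"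
    using area by (simp add: is_area_measure_def)
  ultimately show ?thesis using measurable_cong_sets[of \<mu> _ borel borel] by blast
qed

lemma C1_surface_continuous: "C1_surface \<A> \<psi> \<Longrightarrow> continuous_on (S - P) \<psi>"
  by (rule continuous_on_surface)
    (use c1_on_continuous[OF C1_surfaceD] in \<open>auto simp: local_rep_pair intro: continuous_on_subset\<close>)

lemma continuous_position_deriv:
  assumes "C1_surface \<A> \<psi>" shows "continuous_on (S - P) (along \<psi>)"
proof (rule continuous_on_surface)
  fix U \<phi> assume c: "(U, \<phi>) \<in> \<A>"
  interpret pU: minimal_patch "\<phi> ` (U - P)" "local_rep X (U, \<phi>)" by (rule patch[OF c])
  note c1 = C1_surfaceD[OF assms c]
  let ?Z = "position_field (local_rep X (U, \<phi>))"
  have "continuous_on (\<phi> ` (U - P)) (\<lambda>w. Re (?Z w) *\<^sub>R dird 1 (local_rep \<psi> (U, \<phi>)) w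
      + Im (?Z w) *\<^sub>R dird \<i> (local_rep \<psi> (U, \<phi>)) w)"
    by (intro continuous_intros pU.continuous_position_field
        continuous_on_subset[OF c1_on_dird_continuous[OF c1]]) auto
  then show "continuous_on (\<phi> ` (U - P)) (\<lambda>w. along \<psi> (inv_into U \<phi> w))"
  proof (rule continuous_on_eq)
    fix w assume "w \<in> \<phi> ` (U - P)"
    then obtain x where x: "x \<in> U - P" "w = \<phi> x" by blast
    have "linear (frechet_derivative (local_rep \<psi> (U, \<phi>)) (at w))"
      using c1 x by (auto simp: c1_on_def linear_frechet)
    from linear_complex_expand[OF this, of "?Z w"]
    show "Re (?Z w) *\<^sub>R dird 1 (local_rep \<psi> (U, \<phi>)) w + Im (?Z w) *\<^sub>R dird \<i> (local_rep \<psi> (U, \<phi>)) w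
        = along \<psi> (inv_into U \<phi> w)"
      using position_deriv_chart[OF assms c x(1)] x chart(8)[OF c] by simp
  qed
qed

end

section \<open>The area measure and the divergence theorem\<close>

context minimal_surface begin

lemma sets_area: "sets \<mu> = sets (restrict_space borel (S - P))" and space_area: "space \<mu> = S - P"
  using area by (simp_all add: is_area_measure_def)

lemma openin_area_measurable:
  assumes "openin (top_of_set S) T" shows "T - P \<in> sets \<mu>"
proof -
  obtain O' where O: "open O'" "T = S \<inter> O'" using assms unfolding openin_open by blast
  then have "T - P = (S - P) \<inter> O'" by blast
  then show ?thesis
    unfolding sets_area sets_restrict_space using O(1) by auto
qed

lemma inv_chart_measurable:
  assumes c: "(U, \<phi>) \<in> \<A>"
  shows "inv_into U \<phi> \<in> measurable (restrict_space lborel (\<phi> ` (U - P))) \<mu>"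
proof -
  let ?R = "restrict_space lborel (\<phi> ` (U - P)) :: complex measure"
  have "inv_into U \<phi> \<in> borel_measurable (restrict_space borel (\<phi> ` (U - P)))"
    by (rule borel_measurable_continuous_on_restrict, rule continuous_on_subset[OF chart(6)[OF c]]) auto
  then have b: "inv_into U \<phi> \<in> borel_measurable ?R"
    using measurable_cong_sets[OF sets_restrict_space_cong[OF sets_lborel, of "\<phi> ` (U - P)"] refl, of borel]
    by blast
  have "inv_into U \<phi> \<in> measurable ?R (restrict_space borel (S - P))"
    by (rule measurable_restrict_space2[OF _ b])
      (use chart(2)[OF c] chart(8)[OF c] in \<open>auto simp: space_restrict_space\<close>)
  then show ?thesis
    using measurable_cong_sets[OF refl sets_area, of ?R] by simp
qed

text \<open>
  Inside a chart, the area measure is the image under the inverse chart of Lebesgue measure weighted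
  by the area density.
\<close>

lemma area_chart_measure:
  assumes c: "(U, \<phi>) \<in> \<A>"
  shows "density \<mu> (\<lambda>x. ennreal (indicator (U - P) x))
    = distr (density (restrict_space lborel (\<phi> ` (U - P)))
        (\<lambda>w. ennreal (area_density (local_rep X (U, \<phi>)) w))) \<mu> (inv_into U \<phi>)"
    and "area_density (local_rep X (U, \<phi>)) \<in> borel_measurable (restrict_space lborel (\<phi> ` (U - P)))"
proof -
  interpret pU: minimal_patch "\<phi> ` (U - P)" "local_rep X (U, \<phi>)" by (rule patch[OF c])
  let ?W = "\<phi> ` (U - P)" and ?D = "area_density (local_rep X (U, \<phi>))" and ?h = "inv_into U \<phi>"
  let ?R = "restrict_space lborel ?W :: complex measure"
  have "?D \<in> borel_measurable (restrict_space borel ?W)"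
    by (rule borel_measurable_continuous_on_restrict[OF c1_on_continuous[OF pU.c1_area_density]])
  then show D: "?D \<in> borel_measurable ?R"
    using measurable_cong_sets[OF sets_restrict_space_cong[OF sets_lborel, of "\<phi> ` (U - P)"] refl, of borel]
    by blast
  have h: "?h \<in> measurable ?R \<mu>" by (rule inv_chart_measurable[OF c])
  have U: "U - P \<in> sets \<mu>" using openin_area_measurable[OF chart(1)[OF c]] .
  have W: "?W \<in> sets lborel" using pU.open_W by simp
  have E: "emeasure \<mu> E = (\<integral>\<^sup>+w\<in>\<phi> ` E. ennreal (?D w) \<partial>lborel)" if "E \<in> sets \<mu>" "E \<subseteq> U" for E
  proof -
    have "\<forall>(U, \<phi>)\<in>\<A>. \<forall>E\<in>sets \<mu>. E \<subseteq> U \<longrightarrow>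
       emeasure \<mu> E = (\<integral>\<^sup>+w\<in>\<phi> ` E. ennreal (sqrt (metric_det (local_rep X (U, \<phi>)) w)) \<partial>lborel)"
      using area unfolding is_area_measure_def by blast
    from bspec[OF this c] that show ?thesis by simp
  qed
  show "density \<mu> (\<lambda>x. ennreal (indicator (U - P) x)) = distr (density ?R (\<lambda>w. ennreal (?D w))) \<mu> ?h"
  proof (rule measure_eqI)
    fix E assume "E \<in> sets (density \<mu> (\<lambda>x. ennreal (indicator (U - P) x)))"
    then have Es: "E \<in> sets \<mu>" by simp
    then have ES: "E \<subseteq> S - P" using sets.sets_into_space space_area by blast
    have "emeasure (density \<mu> (\<lambda>x. ennreal (indicator (U - P) x))) E
        = (\<integral>\<^sup>+x. indicator ((U - P) \<inter> E) x \<partial>\<mu>)"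
    proof -
      have "(\<lambda>x. ennreal (indicator (U - P) x)) \<in> borel_measurable \<mu>"
        using U by (intro measurable_compose[OF _ measurable_ennreal] borel_measurable_indicator)
      from emeasure_density[OF this Es] show ?thesis
        by (simp add: indicator_inter_arith indicator_def cong: if_cong)
          (auto intro!: nn_integral_cong)
    qed
    also have "\<dots> = emeasure \<mu> ((U - P) \<inter> E)" using Es U by simp
    also have "\<dots> = (\<integral>\<^sup>+w\<in>\<phi> ` ((U - P) \<inter> E). ennreal (?D w) \<partial>lborel)"
      using Es U by (intro E) auto
    also have "\<dots> = (\<integral>\<^sup>+w. ennreal (?D w) * indicator (?h -` E \<inter> ?W) w * indicator ?W w \<partial>lborel)"
    proof (rule nn_integral_cong)
      fix w
      have "w \<in> \<phi> ` ((U - P) \<inter> E) \<longleftrightarrow> w \<in> ?h -` E \<inter> ?W"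
        using chart(8)[OF c] by force
      then show "ennreal (?D w) * indicator (\<phi> ` ((U - P) \<inter> E)) w
          = ennreal (?D w) * indicator (?h -` E \<inter> ?W) w * indicator ?W w"
        by (simp add: indicator_def)
    qed
    also have "\<dots> = (\<integral>\<^sup>+w. ennreal (?D w) * indicator (?h -` E \<inter> ?W) w \<partial>?R)"
      by (rule nn_integral_restrict_space[symmetric]) (use W in simp)
    also have "\<dots> = emeasure (density ?R (\<lambda>w. ennreal (?D w))) (?h -` E \<inter> ?W)"
    proof (rule emeasure_density[symmetric])
      show "(\<lambda>w. ennreal (?D w)) \<in> borel_measurable ?R" using D by measurable
      show "?h -` E \<inter> ?W \<in> sets ?R"
        using measurable_sets[OF h Es] by (simp add: space_restrict_space)
    qed
    also have "\<dots> = emeasure (distr (density ?R (\<lambda>w. ennreal (?D w))) \<mu> ?h) E"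
      using h Es by (subst emeasure_distr) (simp_all add: space_restrict_space)
    finally show "emeasure (density \<mu> (\<lambda>x. ennreal (indicator (U - P) x))) E
      = emeasure (distr (density ?R (\<lambda>w. ennreal (?D w))) \<mu> ?h) E" .
  qed simp
qed

lemma area_chart_integral:
  fixes g :: "'a \<Rightarrow> real"
  assumes c: "(U, \<phi>) \<in> \<A>" and g: "g \<in> borel_measurable \<mu>" and out: "\<And>x. x \<in> S - P - U \<Longrightarrow> g x = 0"
  shows "integrable \<mu> g \<longleftrightarrow> integrable lborel (\<lambda>w. indicator (\<phi> ` (U - P)) w *
      (area_density (local_rep X (U, \<phi>)) w * g (inv_into U \<phi> w)))" (is ?th1)
    and "integral\<^sup>L \<mu> g = (\<integral>w. indicator (\<phi> ` (U - P)) w *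
      (area_density (local_rep X (U, \<phi>)) w * g (inv_into U \<phi> w)) \<partial>lborel)" (is ?th2)
proof -
  interpret pU: minimal_patch "\<phi> ` (U - P)" "local_rep X (U, \<phi>)" by (rule patch[OF c])
  let ?W = "\<phi> ` (U - P)" and ?D = "area_density (local_rep X (U, \<phi>))" and ?h = "inv_into U \<phi>"
  let ?R = "restrict_space lborel ?W :: complex measure"
  note D = area_chart_measure(2)[OF c]
  have W: "?W \<in> sets lborel" using pU.open_W by simp
  have h: "?h \<in> measurable ?R \<mu>" by (rule inv_chart_measurable[OF c])
  have h': "?h \<in> measurable (density ?R (\<lambda>w. ennreal (?D w))) \<mu>"
    using h by simp
  have gh: "(\<lambda>w. g (?h w)) \<in> borel_measurable ?R"
    using measurable_compose[OF h g] .
  have U: "indicator (U - P) \<in> borel_measurable \<mu>"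
    using openin_area_measurable[OF chart(1)[OF c]] by simp
  have D0: "AE w in ?R. 0 \<le> ?D w"
    by (rule AE_I2) (use pU.area_density_pos in \<open>force simp: space_restrict_space\<close>)
  have eq: "g x = indicator (U - P) x *\<^sub>R g x" if "x \<in> space \<mu>" for x
    using that out[of x] by (auto simp: space_area indicator_def)
  have "integrable \<mu> g \<longleftrightarrow> integrable \<mu> (\<lambda>x. indicator (U - P) x *\<^sub>R g x)"
    by (rule Bochner_Integration.integrable_cong[OF refl eq])
  also have "\<dots> \<longleftrightarrow> integrable (density \<mu> (\<lambda>x. ennreal (indicator (U - P) x))) g"
    by (rule integrable_density[OF g U, symmetric]) simp
  also have "\<dots> \<longleftrightarrow> integrable (density ?R (\<lambda>w. ennreal (?D w))) (\<lambda>w. g (?h w))"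
    unfolding area_chart_measure(1)[OF c] by (rule integrable_distr_eq[OF h' g])
  also have "\<dots> \<longleftrightarrow> integrable ?R (\<lambda>w. ?D w *\<^sub>R g (?h w))"
    by (rule integrable_density[OF gh D D0])
  also have "\<dots> \<longleftrightarrow> integrable lborel (\<lambda>w. indicator ?W w *\<^sub>R (?D w *\<^sub>R g (?h w)))"
    by (rule integrable_restrict_space) (use W in simp)
  finally show ?th1 by simp
  have "integral\<^sup>L \<mu> g = (\<integral>x. indicator (U - P) x *\<^sub>R g x \<partial>\<mu>)"
    by (rule Bochner_Integration.integral_cong[OF refl eq])
  also have "\<dots> = integral\<^sup>L (density \<mu> (\<lambda>x. ennreal (indicator (U - P) x))) g"
    by (rule integral_density[OF g U, symmetric]) simp
  also have "\<dots> = (\<integral>w. g (?h w) \<partial>density ?R (\<lambda>w. ennreal (?D w)))"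
    unfolding area_chart_measure(1)[OF c] by (rule integral_distr[OF h' g])
  also have "\<dots> = (\<integral>w. ?D w *\<^sub>R g (?h w) \<partial>?R)"
    by (rule integral_density[OF gh D D0])
  also have "\<dots> = (\<integral>w. indicator ?W w *\<^sub>R (?D w *\<^sub>R g (?h w)) \<partial>lborel)"
    by (rule integral_restrict_space) (use W in simp)
  finally show ?th2 by simp
qed

lemma position_deriv_cong:
  assumes f: "C1_surface \<A> f" and g: "C1_surface \<A> g"
    and T: "openin (top_of_set S) T" "x \<in> T - P" and eq: "\<And>y. y \<in> T \<Longrightarrow> f y = g y"
  shows "along f x = along g x"
proof -
  have "x \<in> S" using T openin_imp_subset by blast
  then obtain U \<phi> where c: "(U, \<phi>) \<in> \<A>" "x \<in> U" using chart_covers by blast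
  have o: "open (\<phi> ` (U \<inter> T))"
    using open_chart_image[OF c(1), of "U \<inter> T"] openin_Int chart(1)[OF c(1)] T(1) by blast
  have "frechet_derivative (local_rep f (U, \<phi>)) (at (\<phi> x))
      = frechet_derivative (local_rep g (U, \<phi>)) (at (\<phi> x))"
    by (rule dird_cong_open[OF o]) (use c T eq chart(8)[OF c(1)] in \<open>auto simp: local_rep_pair\<close>)
  then show ?thesis
    using position_deriv_chart[OF f c(1), of x] position_deriv_chart[OF g c(1), of x] c T by simp
qed

lemma position_deriv_const:
  assumes "x \<in> S - P" shows "along (\<lambda>x. k) x = 0"
proof -
  obtain U \<phi> where c: "(U, \<phi>) \<in> \<A>" "x \<in> U" using chart_covers assms by blast
  show ?thesis
    using position_deriv_chart[OF C1_surface_const c(1), of x k] c assms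
    by (simp add: local_rep_lambda)
qed

lemma position_deriv_sum:
  assumes f: "\<And>i. i \<in> I \<Longrightarrow> C1_surface \<A> (f i)" and x: "x \<in> S - P"
  shows "along (\<lambda>x. \<Sum>i\<in>I. f i x) x = (\<Sum>i\<in>I. along (f i) x)"
proof -
  obtain U \<phi> where c: "(U, \<phi>) \<in> \<A>" "x \<in> U" using chart_covers x by blast
  let ?Z = "position_field (local_rep X (U, \<phi>)) (\<phi> x)"
  have "(local_rep (\<lambda>x. \<Sum>i\<in>I. f i x) (U, \<phi>) has_derivative
      (\<lambda>v. \<Sum>i\<in>I. dird v (local_rep (f i) (U, \<phi>)) (\<phi> x))) (at (\<phi> x))"
    unfolding local_rep_lambda[of "\<lambda>x. \<Sum>i\<in>I. f i x"]
  proof (rule has_derivative_sum)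
    fix i assume "i \<in> I"
    from c1_on_has_derivative[OF C1_surfaceD[OF f[OF this] c(1)]] c(2)
    show "((\<lambda>w. f i (inv_into (fst (U, \<phi>)) (snd (U, \<phi>)) w)) has_derivative
        (\<lambda>v. dird v (local_rep (f i) (U, \<phi>)) (\<phi> x))) (at (\<phi> x))"
      by (simp add: local_rep_pair)
  qed
  note sum_deriv = frechet_derivative_at[OF this, symmetric]
  have "C1_surface \<A> (\<lambda>x. \<Sum>i\<in>I. f i x)"
    by (rule C1_surface_sum) (rule f)
  then have "along (\<lambda>x. \<Sum>i\<in>I. f i x) x
      = (\<Sum>i\<in>I. dird ?Z (local_rep (f i) (U, \<phi>)) (\<phi> x))"
    by (subst position_deriv_chart[OF _ c(1)]) (use c x sum_deriv in auto)
  also have "\<dots> = (\<Sum>i\<in>I. along (f i) x)"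
    by (rule sum.cong[OF refl]) (use position_deriv_chart[OF f c(1), of _ x] c x in simp)
  finally show ?thesis .
qed

lemma position_deriv_diff:
  assumes f: "C1_surface \<A> f" and g: "C1_surface \<A> g" and x: "x \<in> S - P"
  shows "along (\<lambda>x. f x - g x) x = along f x - along g x"
proof -
  obtain U \<phi> where c: "(U, \<phi>) \<in> \<A>" "x \<in> U" using chart_covers x by blast
  have "((\<lambda>w. local_rep f (U, \<phi>) w - local_rep g (U, \<phi>) w) has_derivative
      (\<lambda>v. dird v (local_rep f (U, \<phi>)) (\<phi> x) - dird v (local_rep g (U, \<phi>)) (\<phi> x))) (at (\<phi> x))"
    by (rule has_derivative_diff; rule c1_on_has_derivative[OF C1_surfaceD[OF _ c(1)]]) (use f g c in auto)
  then have "(local_rep (\<lambda>x. f x - g x) (U, \<phi>) has_derivative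
      (\<lambda>v. dird v (local_rep f (U, \<phi>)) (\<phi> x) - dird v (local_rep g (U, \<phi>)) (\<phi> x))) (at (\<phi> x))"
    by (simp add: local_rep_pair)
  from frechet_derivative_at[OF this, symmetric] show ?thesis
    using position_deriv_chart[OF C1_surface_diff[OF f g] c(1), of x]
      position_deriv_chart[OF f c(1), of x] position_deriv_chart[OF g c(1), of x] c x by simp
qed

text \<open>
  The divergence theorem for a function supported in a compact part of one punctured chart.
\<close>

lemma divergence_theorem_chart:
  assumes \<psi>: "C1_surface \<A> \<psi>" and c: "(U, \<phi>) \<in> \<A>" and K: "compact K" "K \<subseteq> \<phi> ` (U - P)"
    and out: "\<And>x. x \<in> S \<Longrightarrow> x \<notin> inv_into U \<phi> ` K \<Longrightarrow> \<psi> x = 0"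
  shows "integrable \<mu> \<psi>" "integrable \<mu> (along \<psi>)"
    "2 * integral\<^sup>L \<mu> \<psi> + integral\<^sup>L \<mu> (along \<psi>) = 0"
proof -
  interpret pU: minimal_patch "\<phi> ` (U - P)" "local_rep X (U, \<phi>)" by (rule patch[OF c])
  have KU: "K \<subseteq> \<phi> ` U" using K(2) by blast
  have hK: "inv_into U \<phi> ` K \<subseteq> U" using KU by (auto intro: inv_into_into)
  have c1: "c1_on (\<phi> ` (U - P)) (local_rep \<psi> (U, \<phi>))"
    by (rule c1_on_subset[OF C1_surfaceD[OF \<psi> c]]) auto
  have z: "local_rep \<psi> (U, \<phi>) w = 0" if w: "w \<in> \<phi> ` (U - P) - K" for w
  proof -
    obtain x where x: "x \<in> U" "w = \<phi> x" "w \<notin> K" using w by blast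
    have "x \<notin> inv_into U \<phi> ` K"
    proof
      assume "x \<in> inv_into U \<phi> ` K"
      then obtain k where "k \<in> K" "x = inv_into U \<phi> k" by blast
      then show False using x KU f_inv_into_f[of k \<phi> U] by auto
    qed
    then show ?thesis using out chart(2)[OF c] chart(8)[OF c] x by (auto simp: local_rep_pair)
  qed
  note pd = pU.planar_divergence[OF c1 K z]
  have m1: "\<psi> \<in> borel_measurable \<mu>" "along \<psi> \<in> borel_measurable \<mu>"
    using borel_measurable_continuous_surface C1_surface_continuous[OF \<psi>]
      continuous_position_deriv[OF \<psi>] by blast+
  have o1: "\<psi> x = 0" if "x \<in> S - P - U" for x
    using out[of x] that hK by blast
  have o2: "along \<psi> x = 0" if x: "x \<in> S - P - U" for x
  proof -
    have "openin (top_of_set S) (S - inv_into U \<phi> ` K)"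
      by (rule openin_minus_chart_compact[OF c K(1) KU openin_subtopology_self])
    from position_deriv_cong[OF \<psi> C1_surface_const this, of x 0] x hK out
    show ?thesis using position_deriv_const[of x 0] by auto
  qed
  have e: "indicator (\<phi> ` (U - P)) w * (area_density (local_rep X (U, \<phi>)) w *
        along \<psi> (inv_into U \<phi> w))
     = indicator (\<phi> ` (U - P)) w * (area_density (local_rep X (U, \<phi>)) w *
        dird (position_field (local_rep X (U, \<phi>)) w) (local_rep \<psi> (U, \<phi>)) w)" for w
    using position_deriv_chart[OF \<psi> c] chart(8)[OF c] by (auto simp: indicator_def)
  note i1 = area_chart_integral[OF c m1(1) o1, folded local_rep_pair]
    and i2 = area_chart_integral[OF c m1(2) o2, unfolded e]
  show "integrable \<mu> \<psi>" "integrable \<mu> (along \<psi>)"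
    "2 * integral\<^sup>L \<mu> \<psi> + integral\<^sup>L \<mu> (along \<psi>) = 0"
    using pd i1 i2 by (simp_all only: local_rep_pair)
qed

text \<open>
  The divergence theorem for a function that vanishes on a neighbourhood \<open>N\<close> of the punctures, by a partition of
  unity.
\<close>

theorem divergence_theorem:
  assumes \<eta>: "C1_surface \<A> \<eta>" and N: "openin (top_of_set S) N" "P \<inter> S \<subseteq> N"
    and zero: "\<And>x. x \<in> N \<Longrightarrow> \<eta> x = 0"
  shows "integrable \<mu> \<eta>" "integrable \<mu> (along \<eta>)"
    "2 * integral\<^sup>L \<mu> \<eta> + integral\<^sup>L \<mu> (along \<eta>) = 0"
proof -
  have "\<exists>U \<phi> r. (U, \<phi>) \<in> \<A> \<and> x \<in> U \<and> r > 0 \<and> cball (\<phi> x) r \<subseteq> \<phi> ` U" if "x \<in> S" for x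
  proof -
    obtain U \<phi> where c: "(U, \<phi>) \<in> \<A>" "x \<in> U" using chart_covers \<open>x \<in> S\<close> by blast
    then obtain r where "r > 0" "cball (\<phi> x) r \<subseteq> \<phi> ` U"
      using chart(3)[OF c(1)] open_contains_cball by blast
    then show ?thesis using c by blast
  qed
  then obtain U \<phi> r where c: "\<And>x. x \<in> S \<Longrightarrow> (U x, \<phi> x) \<in> \<A>"
    and xU: "\<And>x. x \<in> S \<Longrightarrow> x \<in> U x" and r: "\<And>x. x \<in> S \<Longrightarrow> r x > (0::real)"
    and cb: "\<And>x. x \<in> S \<Longrightarrow> cball (\<phi> x x) (r x) \<subseteq> \<phi> x ` U x"
    by metis
  define B where "B x = {y \<in> U x. \<phi> x y \<in> ball (\<phi> x x) (r x)}" for x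
  have oB: "openin (top_of_set S) (B x)" if "x \<in> S" for x
  proof -
    have "openin (top_of_set (U x)) (U x \<inter> \<phi> x -` ball (\<phi> x x) (r x))"
      by (rule continuous_openin_preimage_gen[OF chart(5)[OF c[OF that]]]) simp
    then show ?thesis
      using openin_trans[OF _ chart(1)[OF c[OF that]]] by (simp add: B_def vimage_def Int_def)
  qed
  obtain J where J: "J \<subseteq> S" "finite J" "S \<subseteq> (\<Union>x\<in>J. B x)"
  proof -
    have "\<exists>T. open T \<and> B x = S \<inter> T" if "x \<in> S" for x
      using oB[OF that] unfolding openin_open by blast
    then obtain T where T: "\<And>x. x \<in> S \<Longrightarrow> open (T x)" "\<And>x. x \<in> S \<Longrightarrow> B x = S \<inter> T x" by metis
    have "S \<subseteq> (\<Union>x\<in>S. T x)"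
    proof
      fix x assume "x \<in> S"
      moreover from this have "x \<in> B x" using xU r by (simp add: B_def)
      ultimately show "x \<in> (\<Union>x\<in>S. T x)" using T(2) by blast
    qed
    then obtain J where J: "J \<subseteq> S" "finite J" "S \<subseteq> (\<Union>x\<in>J. T x)"
      using compactE_image[OF compact_S, of S T] T(1) by blast
    have "S \<subseteq> (\<Union>x\<in>J. B x)"
    proof
      fix y assume y: "y \<in> S"
      then obtain x where "x \<in> J" "y \<in> T x" using J(3) by blast
      with y J(1) T(2)[of x] show "y \<in> (\<Union>x\<in>J. B x)" by blast
    qed
    with J(1,2) show ?thesis by (rule that)
  qed
  define b where "b x = extend_chart (U x, \<phi> x) (bump (\<phi> x x) (r x))" for x
  have b: "C1_surface \<A> (b x)" if "x \<in> S" for x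
    unfolding b_def
    by (rule C1_surface_extend_chart[OF c[OF that] c1_on_bump compact_cball cb[OF that]])
      (use bump_zero r that in blast)
  have b0: "b x y \<ge> 0" for x y by (simp add: b_def extend_chart_def bump_nonneg)
  have b1: "b x y > 0" if "x \<in> S" "y \<in> B x" for x y
    using that bump_pos by (simp add: b_def extend_chart_def B_def)
  define \<beta> where "\<beta> y = (\<Sum>x\<in>J. b x y)" for y
  have \<beta>: "\<beta> y > 0" if "y \<in> S" for y
  proof -
    obtain x where "x \<in> J" "y \<in> B x" using J(3) \<open>y \<in> S\<close> by blast
    then show ?thesis
      unfolding \<beta>_def using J by (intro sum_pos2[OF J(2)]) (auto intro: b0 b1)
  qed
  define \<psi> where "\<psi> x y = \<eta> y * b x y / \<beta> y" for x y
  have c1\<beta>: "C1_surface \<A> \<beta>"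
    unfolding \<beta>_def[abs_def] by (rule C1_surface_sum) (use b J in blast)
  have \<psi>: "C1_surface \<A> (\<psi> x)" if "x \<in> J" for x
    unfolding \<psi>_def[abs_def]
    by (intro C1_surface_divide C1_surface_mult \<eta> b c1\<beta>) (use \<beta> J that in force)+
  have part: "integrable \<mu> (\<psi> x) \<and> integrable \<mu> (along (\<psi> x)) \<and>
      2 * integral\<^sup>L \<mu> (\<psi> x) + integral\<^sup>L \<mu> (along (\<psi> x)) = 0" if "x \<in> J" for x
  proof -
    have x: "x \<in> S" using that J by blast
    \<comment> \<open>removing the open set \<open>N\<close> keeps the support compact and takes it off the punctures\<close>
    define K where "K = cball (\<phi> x x) (r x) - \<phi> x ` (U x \<inter> N)"
    have "open (\<phi> x ` (U x \<inter> N))"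
      using open_chart_image[OF c[OF x], of "U x \<inter> N"] openin_Int chart(1)[OF c[OF x]] N(1) by blast
    then have K1: "compact K" unfolding K_def by (intro compact_diff compact_cball)
    have K2: "K \<subseteq> \<phi> x ` (U x - P)"
    proof
      fix w assume w: "w \<in> K"
      then obtain y where y: "y \<in> U x" "w = \<phi> x y" using cb[OF x] by (auto simp: K_def)
      then have "y \<notin> N" using w by (auto simp: K_def)
      then have "y \<notin> P" using N(2) chart(2)[OF c[OF x]] y by blast
      then show "w \<in> \<phi> x ` (U x - P)" using y by blast
    qed
    have K3: "\<psi> x y = 0" if y: "y \<in> S" "y \<notin> inv_into (U x) (\<phi> x) ` K" for y
    proof (rule ccontr)
      assume "\<psi> x y \<noteq> 0"
      then have n: "\<eta> y \<noteq> 0" "b x y \<noteq> 0" by (auto simp: \<psi>_def)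
      then have yU: "y \<in> U x" and cby: "\<phi> x y \<in> cball (\<phi> x x) (r x)"
        using bump_zero[OF r[OF x]] by (auto simp: b_def extend_chart_def split: if_splits)
      have "\<phi> x y \<notin> \<phi> x ` (U x \<inter> N)"
        using n(1) zero chart(7)[OF c[OF x]] yU by (auto simp: inj_on_def)
      then have "\<phi> x y \<in> K" using cby by (simp add: K_def)
      then have "inv_into (U x) (\<phi> x) (\<phi> x y) \<in> inv_into (U x) (\<phi> x) ` K" by (rule imageI)
      then show False using y(2) chart(8)[OF c[OF x] yU] by simp
    qed
    from divergence_theorem_chart[OF \<psi>[OF that] c[OF x] K1 K2 K3] show ?thesis by blast
  qed
  have sum\<psi>: "\<eta> y = (\<Sum>x\<in>J. \<psi> x y)" if "y \<in> S" for y
  proof -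
    have "(\<Sum>x\<in>J. \<psi> x y) = \<eta> y * \<beta> y / \<beta> y"
      by (simp add: \<psi>_def \<beta>_def sum_distrib_left sum_divide_distrib)
    then show ?thesis using \<beta>[OF that] by simp
  qed
  have sumd: "along \<eta> y = (\<Sum>x\<in>J. along (\<psi> x) y)" if y: "y \<in> S - P" for y
    using position_deriv_cong[OF \<eta> C1_surface_sum[of J \<A> \<psi>, OF \<psi>] openin_subtopology_self y sum\<psi>]
      position_deriv_sum[of J \<psi>, OF \<psi> y] by simp
  have "integrable \<mu> \<eta> \<longleftrightarrow> integrable \<mu> (\<lambda>y. \<Sum>x\<in>J. \<psi> x y)"
    by (rule Bochner_Integration.integrable_cong) (use sum\<psi> in \<open>auto simp: space_area\<close>)
  then show "integrable \<mu> \<eta>" using part by (simp add: Bochner_Integration.integrable_sum)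
  have "integrable \<mu> (along \<eta>)
      \<longleftrightarrow> integrable \<mu> (\<lambda>y. \<Sum>x\<in>J. along (\<psi> x) y)"
    by (rule Bochner_Integration.integrable_cong) (use sumd in \<open>auto simp: space_area\<close>)
  then show "integrable \<mu> (along \<eta>)"
    using part by (simp add: Bochner_Integration.integrable_sum)
  have "integral\<^sup>L \<mu> \<eta> = (\<integral>y. (\<Sum>x\<in>J. \<psi> x y) \<partial>\<mu>)"
    by (rule Bochner_Integration.integral_cong) (use sum\<psi> in \<open>auto simp: space_area\<close>)
  also have "\<dots> = (\<Sum>x\<in>J. integral\<^sup>L \<mu> (\<psi> x))"
    by (rule Bochner_Integration.integral_sum) (use part in blast)
  finally have 1: "integral\<^sup>L \<mu> \<eta> = (\<Sum>x\<in>J. integral\<^sup>L \<mu> (\<psi> x))" .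
  have "integral\<^sup>L \<mu> (along \<eta>) = (\<integral>y. (\<Sum>x\<in>J. along (\<psi> x) y) \<partial>\<mu>)"
    by (rule Bochner_Integration.integral_cong) (use sumd in \<open>auto simp: space_area\<close>)
  also have "\<dots> = (\<Sum>x\<in>J. integral\<^sup>L \<mu> (along (\<psi> x)))"
    by (rule Bochner_Integration.integral_sum) (use part in blast)
  finally have 2: "integral\<^sup>L \<mu> (along \<eta>)
      = (\<Sum>x\<in>J. integral\<^sup>L \<mu> (along (\<psi> x)))" .
  show "2 * integral\<^sup>L \<mu> \<eta> + integral\<^sup>L \<mu> (along \<eta>) = 0"
    unfolding 1 2 sum_distrib_left sum.distrib[symmetric] using part by simp
qed

end

section \<open>Asymptotics at an end\<close>

lemma lborel_distr_rotate: "distr lborel borel ((*) \<i>) = lborel"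
proof (rule lborel_eqI[symmetric])
  fix l u :: complex assume lu: "\<And>b. b \<in> Basis \<Longrightarrow> l \<bullet> b \<le> u \<bullet> b"
  have lu': "Re l \<le> Re u" "Im l \<le> Im u"
    using lu[of 1] lu[of \<i>] by (auto simp: Basis_complex_def)
  have m: "(*) \<i> \<in> borel_measurable (borel :: complex measure)"
    by (intro borel_measurable_continuous_onI continuous_intros)
  have "((*) \<i>) -` box l u = box (Complex (Im l) (- Re u)) (Complex (Im u) (- Re l))"
    by (auto simp: box_def Basis_complex_def)
  then have "emeasure (distr lborel borel ((*) \<i>)) (box l u)
      = emeasure lborel (box (Complex (Im l) (- Re u)) (Complex (Im u) (- Re l)))"
    using m by (subst emeasure_distr) auto
  also have "\<dots> = (\<Prod>b\<in>Basis. (Complex (Im u) (- Re l) - Complex (Im l) (- Re u)) \<bullet> b)"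
    using lu' by (intro emeasure_lborel_box) (auto simp: Basis_complex_def)
  also have "\<dots> = (\<Prod>b\<in>Basis. (u - l) \<bullet> b)"
    by (simp add: Basis_complex_def mult.commute)
  finally show "emeasure (distr lborel borel ((*) \<i>)) (box l u) = (\<Prod>b\<in>Basis. (u - l) \<bullet> b)" .
qed simp

lemma rotate_borel_measurable: "(*) \<i> \<in> borel_measurable (lborel :: complex measure)"
  by (simp add: borel_measurable_continuous_onI continuous_intros)

lemma lborel_integral_rotate:
  fixes g :: "complex \<Rightarrow> real"
  assumes g: "integrable lborel g"
  shows "integrable lborel (\<lambda>w. g (\<i> * w))" "(\<integral>w. g (\<i> * w) \<partial>lborel) = (\<integral>w. g w \<partial>lborel)"
proof -
  have m: "g \<in> borel_measurable borel" using g by auto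
  show "integrable lborel (\<lambda>w. g (\<i> * w))"
    using integrable_distr_eq[OF rotate_borel_measurable m] g by (simp add: lborel_distr_rotate)
  show "(\<integral>w. g (\<i> * w) \<partial>lborel) = (\<integral>w. g w \<partial>lborel)"
    using integral_distr[OF rotate_borel_measurable m] by (simp add: lborel_distr_rotate)
qed

text \<open>
  Averaging over the four rotations by powers of \<open>\<i>\<close> does not change an integral. It kills every function
  with \<open>h(-w) = -h(w)\<close> or \<open>h(\<i>w) = -h(w)\<close>.
\<close>

lemma lborel_integral_rotation_average:
  fixes g :: "complex \<Rightarrow> real"
  assumes g: "integrable lborel g"
  shows "integrable lborel (\<lambda>w. (g w + g (\<i> * w) + g (- w) + g (- \<i> * w)) / 4)"
    "(\<integral>w. (g w + g (\<i> * w) + g (- w) + g (- \<i> * w)) / 4 \<partial>lborel) = (\<integral>w. g w \<partial>lborel)"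
proof -
  note g1 = lborel_integral_rotate[OF g]
  note g2 = lborel_integral_rotate[OF g1(1), simplified mult.assoc[symmetric], simplified]
  note g3 = lborel_integral_rotate[OF g2(1), simplified]
  show "integrable lborel (\<lambda>w. (g w + g (\<i> * w) + g (- w) + g (- \<i> * w)) / 4)"
    using g g1 g2 g3 by simp
  show "(\<integral>w. (g w + g (\<i> * w) + g (- w) + g (- \<i> * w)) / 4 \<partial>lborel) = (\<integral>w. g w \<partial>lborel)"
    using g g1 g2 g3 by simp
qed

text \<open>
  The image of planar Lebesgue measure under \<open>w \<mapsto> |w|\<^sup>2\<close> is \<open>\<pi>\<close> times Lebesgue measure on the half-line, because
  a disc of squared radius \<open>t\<close> has area \<open>\<pi>t\<close>. This takes the place of polar coordinates.
\<close>

lemma distr_norm_squared: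
  "distr lborel borel (\<lambda>w::complex. (norm w)\<^sup>2)
    = density lborel (\<lambda>s::real. ennreal (pi * indicator {0..} s))"
proof (rule measure_eqI_generator_eq[where E = "range (\<lambda>t::real. {..t})" and \<Omega> = UNIV
      and A = "\<lambda>n. {..real n}"])
  have m: "(\<lambda>w::complex. (norm w)\<^sup>2) \<in> borel_measurable lborel" by measurable
  have e1: "emeasure (distr lborel borel (\<lambda>w::complex. (norm w)\<^sup>2)) {..t} = ennreal (pi * max 0 t)" for t
  proof -
    have "emeasure (distr lborel borel (\<lambda>w::complex. (norm w)\<^sup>2)) {..t}
        = emeasure lborel {w::complex. (norm w)\<^sup>2 \<le> t}"
      using m by (subst emeasure_distr) (auto simp: vimage_def)
    also have "\<dots> = ennreal (pi * max 0 t)"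
    proof (cases "t \<ge> 0")
      case True
      have "{w::complex. (norm w)\<^sup>2 \<le> t} = cball 0 (sqrt t)"
      proof -
        have "(norm w)\<^sup>2 \<le> t \<longleftrightarrow> norm w \<le> sqrt t" for w :: complex
          using real_sqrt_le_iff[of "(norm w)\<^sup>2" t] by simp
        then show ?thesis by (intro set_eqI) (simp only: mem_Collect_eq mem_cball dist_0_norm)
      qed
      then show ?thesis
        using True by (simp add: emeasure_cball unit_ball_vol_2)
    next
      case False
      then have "{w::complex. (norm w)\<^sup>2 \<le> t} = {}"
        by (auto simp: not_le intro: less_le_trans[of t 0])
      then show ?thesis using False by simp
    qed
    finally show ?thesis .
  qed
  have e2: "emeasure (density lborel (\<lambda>s::real. ennreal (pi * indicator {0..} s))) {..t}
      = ennreal (pi * max 0 t)" for t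
  proof -
    have "emeasure (density lborel (\<lambda>s::real. ennreal (pi * indicator {0..} s))) {..t}
        = (\<integral>\<^sup>+s. ennreal pi * indicator {0..t} s \<partial>lborel)"
      by (subst emeasure_density) (auto intro!: nn_integral_cong simp: indicator_def)
    also have "\<dots> = ennreal pi * emeasure lborel {0..t}" by (simp add: nn_integral_cmult)
    also have "\<dots> = ennreal (pi * max 0 t)"
      by (cases "t \<ge> 0") (simp_all add: ennreal_mult)
    finally show ?thesis .
  qed
  show "emeasure (distr lborel borel (\<lambda>w::complex. (norm w)\<^sup>2)) T
      = emeasure (density lborel (\<lambda>s::real. ennreal (pi * indicator {0..} s))) T"
    if "T \<in> range (\<lambda>t. {..t})" for T
    using that e1 e2 by auto
  show "Int_stable (range (\<lambda>t::real. {..t}))"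
    by (auto simp: Int_stable_def)
  show "sets (distr lborel borel (\<lambda>w::complex. (norm w)\<^sup>2)) = sigma_sets UNIV (range (\<lambda>t::real. {..t}))"
    "sets (density lborel (\<lambda>s::real. ennreal (pi * indicator {0..} s))) = sigma_sets UNIV (range (\<lambda>t::real. {..t}))"
    by (simp_all add: borel_eq_atMost)
  show "(\<Union>i. {..real i}) = UNIV" by (auto simp: real_arch_simple)
  show "emeasure (distr lborel borel (\<lambda>w::complex. (norm w)\<^sup>2)) {..real i} \<noteq> \<infinity>" for i
    by (simp add: e1)
qed auto

lemma lborel_integral_radial:
  fixes G :: "real \<Rightarrow> real"
  assumes G: "G \<in> borel_measurable borel"
  shows "(\<integral>w. G ((norm w)\<^sup>2) \<partial>(lborel :: complex measure)) = pi * (\<integral>s. indicator {0..} s * G s \<partial>lborel)"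
    and "integrable (lborel :: complex measure) (\<lambda>w. G ((norm w)\<^sup>2))
      \<longleftrightarrow> integrable lborel (\<lambda>s. indicator {0..} s * G s)"
proof -
  have m: "(\<lambda>w::complex. (norm w)\<^sup>2) \<in> borel_measurable lborel" by measurable
  have G': "G \<in> borel_measurable lborel" using G by simp
  have "(\<integral>w. G ((norm w)\<^sup>2) \<partial>(lborel :: complex measure))
      = (\<integral>s. G s \<partial>density lborel (\<lambda>s. ennreal (pi * indicator {0..} s)))"
    using integral_distr[OF m G] by (simp add: distr_norm_squared)
  also have "\<dots> = (\<integral>s. (pi * indicator {0..} s) *\<^sub>R G s \<partial>lborel)"
    by (rule integral_density[OF G']) auto
  also have "\<dots> = pi * (\<integral>s. indicator {0..} s * G s \<partial>lborel)" by (simp add: mult.assoc)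
  finally show "(\<integral>w. G ((norm w)\<^sup>2) \<partial>(lborel :: complex measure))
      = pi * (\<integral>s. indicator {0..} s * G s \<partial>lborel)" .
  have "integrable (lborel :: complex measure) (\<lambda>w. G ((norm w)\<^sup>2))
      \<longleftrightarrow> integrable (density lborel (\<lambda>s. ennreal (pi * indicator {0..} s))) G"
    using integrable_distr_eq[OF m G] by (simp add: distr_norm_squared)
  also have "\<dots> \<longleftrightarrow> integrable lborel (\<lambda>s. (pi * indicator {0..} s) *\<^sub>R G s)"
    by (rule integrable_density[OF G']) auto
  finally show "integrable (lborel :: complex measure) (\<lambda>w. G ((norm w)\<^sup>2))
      \<longleftrightarrow> integrable lborel (\<lambda>s. indicator {0..} s * G s)" by (simp add: mult.assoc)
qed

lemma analytic_primitive_bounds: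
  fixes y :: "complex \<Rightarrow> complex"
  assumes "y analytic_on {0}"
  shows "\<exists>r>0. \<exists>M>0. \<exists>g. \<forall>w\<in>ball 0 r. (g has_field_derivative y w) (at w) \<and> norm (y w) \<le> M \<and>
    norm (y w - y 0) \<le> M * norm w \<and> norm (g w) \<le> M * norm w \<and>
    norm (g w - w * y 0) \<le> M * (norm w)\<^sup>2"
proof -
  obtain r0 where r0: "r0 > 0" "y holomorphic_on ball 0 r0"
    using assms by (auto simp: analytic_on_def)
  obtain g0 where g0: "\<And>w. w \<in> ball 0 r0 \<Longrightarrow> (g0 has_field_derivative y w) (at w within ball 0 r0)"
  proof (rule holomorphic_convex_primitive[of "ball 0 r0" "{}" y])
    show "y field_differentiable at x" if "x \<in> interior (ball 0 r0) - {}" for x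
      using r0 that by (simp add: holomorphic_on_imp_differentiable_at)
  qed (use r0 holomorphic_on_imp_continuous_on in auto)
  define g where "g w = g0 w - g0 0" for w
  have g: "(g has_field_derivative y w) (at w)" if "w \<in> ball 0 r0" for w
    unfolding g_def using g0[OF that] that at_within_open[OF that]
    by (auto intro!: derivative_eq_intros)
  have "y field_differentiable (at 0)"
    using r0 by (intro holomorphic_on_imp_differentiable_at[of _ "ball 0 r0"]) auto
  then obtain y' where "(y has_field_derivative y') (at 0)" by (auto simp: field_differentiable_def)
  then have "((\<lambda>h. (y h - y 0) / h) \<longlongrightarrow> y') (at 0)" by (simp add: DERIV_def)
  then have "\<forall>\<^sub>F h in at 0. dist ((y h - y 0) / h) y' < 1" by (rule tendstoD) simp
  then obtain d where d: "d > 0" "\<And>h. h \<noteq> 0 \<Longrightarrow> dist h 0 < d \<Longrightarrow> dist ((y h - y 0) / h) y' < 1"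
    unfolding eventually_at by blast
  define L where "L = norm y' + 1"
  have Lip: "norm (y h - y 0) \<le> L * norm h" if "norm h < d" for h
  proof (cases "h = 0")
    case False
    then have "norm ((y h - y 0) / h - y') < 1" using d(2)[of h] that by (simp add: dist_norm)
    then have "norm ((y h - y 0) / h) \<le> L"
      unfolding L_def by (smt (verit) norm_triangle_sub)
    then show ?thesis using False by (simp add: norm_divide field_simps)
  qed simp
  define r where "r = min 1 (min r0 d)"
  define M where "M = L + norm (y 0) + 1"
  have L: "L \<ge> 0" by (simp add: L_def)
  have r: "r > 0" "r \<le> 1" "r \<le> r0" "r \<le> d" using r0 d by (auto simp: r_def)
  have M: "M > 0" "L \<le> M"
    using L norm_ge_zero[of "y 0"] unfolding M_def by linarith+
  have main: "(g has_field_derivative y w) (at w) \<and> norm (y w) \<le> M \<and>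
    norm (y w - y 0) \<le> M * norm w \<and> norm (g w) \<le> M * norm w \<and>
    norm (g w - w * y 0) \<le> M * (norm w)\<^sup>2" if w: "w \<in> ball 0 r" for w
  proof -
    have nw: "norm w < r" "norm w \<le> 1" using w r by auto
    have 1: "norm (y v - y 0) \<le> L * norm v" if "norm v \<le> norm w" for v
      using that nw r by (intro Lip) auto
    have yb: "norm (y v) \<le> L * norm v + norm (y 0)" if "norm v \<le> norm w" for v
      using 1[OF that] norm_triangle_sub[of "y v" "y 0"] by linarith
    have Lw: "L * norm w \<le> L" using nw L by (simp add: mult_left_le)
    have yM: "norm (y v) \<le> M" if "norm v \<le> norm w" for v
    proof -
      have "L * norm v \<le> L * norm w" using that L by (intro mult_left_mono)
      then show ?thesis using yb[OF that] Lw by (simp add: M_def)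
    qed
    have sub: "v \<in> ball 0 r0" if "v \<in> cball 0 (norm w)" for v :: complex
      using that nw r by auto
    have "norm (g w - g 0) \<le> M * norm (w - 0)"
    proof (rule field_differentiable_bound[of "cball 0 (norm w)" g y])
      show "(g has_field_derivative y v) (at v within cball 0 (norm w))" if "v \<in> cball 0 (norm w)" for v
        by (rule has_field_derivative_at_within[OF g[OF sub[OF that]]])
      show "norm (y v) \<le> M" if "v \<in> cball 0 (norm w)" for v
        using yM[of v] that by simp
    qed auto
    then have 2: "norm (g w) \<le> M * norm w" by (simp add: g_def)
    have "norm ((g w - w * y 0) - (g 0 - 0 * y 0)) \<le> (L * norm w) * norm (w - 0)"
    proof (rule field_differentiable_bound[of "cball 0 (norm w)" _ "\<lambda>v. y v - y 0"])
      show "((\<lambda>v. g v - v * y 0) has_field_derivative y v - y 0) (at v within cball 0 (norm w))"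
        if "v \<in> cball 0 (norm w)" for v
        using has_field_derivative_at_within[OF g[OF sub[OF that]]]
        by (auto intro!: derivative_eq_intros)
      show "norm (y v - y 0) \<le> L * norm w" if "v \<in> cball 0 (norm w)" for v
      proof -
        have "norm v \<le> norm w" using that by simp
        then have "L * norm v \<le> L * norm w" using L by (intro mult_left_mono)
        then show ?thesis using 1[of v] \<open>norm v \<le> norm w\<close> by linarith
      qed
    qed auto
    then have "norm (g w - w * y 0) \<le> L * (norm w)\<^sup>2" by (simp add: g_def power2_eq_square mult.assoc)
    also have "\<dots> \<le> M * (norm w)\<^sup>2" using M by (intro mult_right_mono) auto
    finally have 3: "norm (g w - w * y 0) \<le> M * (norm w)\<^sup>2" .
    have 4: "norm (y w - y 0) \<le> M * norm w"
      using 1[of w] M mult_right_mono[of L M "norm w"] by simp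
    show ?thesis using g[of w] w r yM[of w] 2 3 4 by auto
  qed
  show ?thesis using r(1) M(1) main by blast
qed

text \<open>
  The derivative of \<open>f\<close> is the real part of its complex derivative times the increment.
\<close>

lemma frechet_complex_deriv:
  assumes "f differentiable (at w)"
  shows "dird v f w $ k = Re (complex_deriv f w $ k * v)"
  unfolding linear_complex_expand[OF linear_frechet[OF assms], of v]
  by (simp add: complex_deriv_def)

lemma conformal_area_density:
  assumes "induced_metric f w 1 1 = induced_metric f w \<i> \<i>" "induced_metric f w 1 \<i> = 0"
  shows "area_density f w = induced_metric f w 1 1"
    and "area_density f w = (\<Sum>k\<in>UNIV. (norm (complex_deriv f w $ k))\<^sup>2 / 2)"
proof -
  have nn: "induced_metric f w 1 1 \<ge> 0" by (simp add: induced_metric_def)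
  show 1: "area_density f w = induced_metric f w 1 1"
    using assms nn by (simp add: metric_det_def flip: power2_eq_square)
  have "2 * area_density f w = induced_metric f w 1 1 + induced_metric f w \<i> \<i>"
    using 1 assms by simp
  also have "\<dots> = (\<Sum>k\<in>UNIV. (norm (complex_deriv f w $ k))\<^sup>2)"
  proof -
    have "(norm (complex_deriv f w $ k))\<^sup>2
        = dird 1 f w $ k * dird 1 f w $ k + dird \<i> f w $ k * dird \<i> f w $ k" for k
      unfolding cmod_power2 by (simp add: complex_deriv_def power2_eq_square)
    then show ?thesis by (simp add: induced_metric_def inner_vec_def sum.distrib)
  qed
  finally show "area_density f w = (\<Sum>k\<in>UNIV. (norm (complex_deriv f w $ k))\<^sup>2 / 2)"
    by (simp flip: sum_divide_distrib)
qed

text \<open>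
  One coordinate of the expansion of \<open>X \<bullet> Re(z X\<^sub>z)\<close>. Here \<open>g\<close> is the value of a primitive of \<open>Y\<close>, and the
  products of \<open>Re(a/w)\<close> with \<open>Re g\<close> and with \<open>Re(w y)\<close> cancel to leading order, because both of these equal
  \<open>Re(w y0)\<close> up to \<open>O(|w|\<^sup>2)\<close>.
\<close>

lemma pole_expansion_position:
  fixes a w y y0 g :: complex and c M :: real
  assumes w: "w \<noteq> 0" "norm w \<le> 1" and a: "norm a \<le> 2" and y: "norm y \<le> M" "norm (y - y0) \<le> M * norm w"
    and g: "norm g \<le> M * norm w" "norm (g - w * y0) \<le> M * (norm w)\<^sup>2"
  shows "\<bar>(Re (a / w) + c + Re g) * Re ((- (a / w\<^sup>2) + y) * w) - (- (Re (a / w))\<^sup>2 - c * Re (a / w))\<bar>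
    \<le> (4 * M + \<bar>c\<bar> * M + M\<^sup>2) * norm w"
proof -
  define n where "n = norm w"
  have n: "n > 0" "n \<le> 1" using w by (auto simp: n_def)
  have M: "M \<ge> 0" using y(1) norm_ge_zero[of y] by linarith
  have e0: "(- (a / w\<^sup>2) + y) * w = - (a / w) + y * w"
    using w by (simp add: field_simps power2_eq_square)
  have e: "(Re (a / w) + c + Re g) * Re ((- (a / w\<^sup>2) + y) * w) - (- (Re (a / w))\<^sup>2 - c * Re (a / w))
      = Re (a / w) * Re (w * y - g) + c * Re (w * y) + Re g * Re (w * y)"
    unfolding e0 by (simp add: algebra_simps power2_eq_square)
  have 1: "\<bar>Re (w * y - g)\<bar> \<le> 2 * M * n\<^sup>2"
  proof -
    have "norm (w * y - g) \<le> norm (w * (y - y0)) + norm (g - w * y0)"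
      using norm_triangle_ineq4[of "w * (y - y0)" "g - w * y0"] by (simp add: algebra_simps)
    also have "\<dots> \<le> n * (M * n) + M * n\<^sup>2"
      using y g by (auto simp: norm_mult n_def intro!: add_mono mult_left_mono)
    finally show ?thesis
      using abs_Re_le_cmod[of "w * y - g"] by (simp add: power2_eq_square)
  qed
  have 2: "\<bar>Re (w * y)\<bar> \<le> M * n"
    using abs_Re_le_cmod[of "w * y"] mult_left_mono[OF y(1) norm_ge_zero[of w]]
    by (simp add: norm_mult n_def mult.commute)
  have 3: "\<bar>Re g\<bar> \<le> M * n" using abs_Re_le_cmod[of g] g by (simp add: n_def)
  have 4: "\<bar>Re (a / w)\<bar> \<le> 2 / n"
    using abs_Re_le_cmod[of "a / w"] a n by (simp add: norm_divide n_def field_simps)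
  have "\<bar>Re (a / w) * Re (w * y - g)\<bar> \<le> (2 / n) * (2 * M * n\<^sup>2)"
    unfolding abs_mult using 1 4 n by (intro mult_mono) auto
  also have "\<dots> = 4 * M * n" using n by (simp add: power2_eq_square)
  finally have 5: "\<bar>Re (a / w) * Re (w * y - g)\<bar> \<le> 4 * M * n" .
  have 6: "\<bar>c * Re (w * y)\<bar> \<le> \<bar>c\<bar> * (M * n)"
    unfolding abs_mult using 2 by (intro mult_left_mono) auto
  have "\<bar>Re g * Re (w * y)\<bar> \<le> (M * n) * (M * n)"
    unfolding abs_mult using 2 3 n M by (intro mult_mono) auto
  also have "\<dots> = M\<^sup>2 * n * n" by (simp add: power2_eq_square)
  also have "\<dots> \<le> M\<^sup>2 * n * 1" using n by (intro mult_left_mono) auto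
  finally have 7: "\<bar>Re g * Re (w * y)\<bar> \<le> M\<^sup>2 * n" by simp
  have "\<bar>Re (a / w) * Re (w * y - g) + c * Re (w * y) + Re g * Re (w * y)\<bar>
      \<le> 4 * M * n + \<bar>c\<bar> * (M * n) + M\<^sup>2 * n"
    using 5 6 7 by linarith
  then show ?thesis unfolding e n_def[symmetric] by (simp add: algebra_simps)
qed

text \<open>
  One coordinate of the expansion of the area density, half the squared norm of the complex derivative.
\<close>

lemma pole_expansion_density:
  fixes a w y y0 :: complex and M :: real
  assumes w: "w \<noteq> 0" "norm w \<le> 1" and a: "norm a \<le> 2" and y: "norm y \<le> M" "norm (y - y0) \<le> M * norm w"
  shows "\<bar>(norm (- (a / w\<^sup>2) + y))\<^sup>2 / 2 - ((norm a)\<^sup>2 / 2 * (1 / norm w ^ 4) - Re (a / w\<^sup>2 * cnj y0))\<bar>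
    \<le> (2 * M + M\<^sup>2) / norm w"
proof -
  define n where "n = norm w"
  have n: "n > 0" "n \<le> 1" using w by (auto simp: n_def)
  have M: "M \<ge> 0" using y(1) norm_ge_zero[of y] by linarith
  define u where "u = a / w\<^sup>2"
  have u: "(norm u)\<^sup>2 = (norm a)\<^sup>2 * (1 / n ^ 4)" "norm u \<le> 2 / n\<^sup>2"
    using a n by (simp_all add: u_def norm_divide norm_power power_divide n_def divide_right_mono flip: power_mult)
  have "(norm (- u + y))\<^sup>2 = (norm u)\<^sup>2 - 2 * Re (u * cnj y) + (norm y)\<^sup>2"
    unfolding cmod_power2 by (simp add: algebra_simps power2_eq_square)
  then have e: "(norm (- u + y))\<^sup>2 / 2 - ((norm a)\<^sup>2 / 2 * (1 / n ^ 4) - Re (u * cnj y0))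
      = - Re (u * cnj (y - y0)) + (norm y)\<^sup>2 / 2"
    unfolding u(1)[symmetric] by (simp add: u(1) algebra_simps)
  have "\<bar>Re (u * cnj (y - y0))\<bar> \<le> norm u * norm (y - y0)"
    using abs_Re_le_cmod[of "u * cnj (y - y0)"]
    by (metis norm_mult complex_mod_cnj)
  also have "\<dots> \<le> (2 / n\<^sup>2) * (M * n)"
    using u y n by (intro mult_mono) (auto simp: n_def)
  also have "\<dots> = 2 * M / n" using n by (simp add: power2_eq_square)
  finally have 1: "\<bar>Re (u * cnj (y - y0))\<bar> \<le> 2 * M / n" .
  have "(norm y)\<^sup>2 \<le> M\<^sup>2" using y by (intro power_mono) auto
  also have "\<dots> \<le> M\<^sup>2 / n" using n by (simp add: pos_le_divide_eq mult_left_le)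
  finally have "(norm y)\<^sup>2 \<le> M\<^sup>2 / n" .
  then have 2: "\<bar>(norm y)\<^sup>2 / 2\<bar> \<le> M\<^sup>2 / n"
    using zero_le_power2[of "norm y"] by linarith
  have "\<bar>- Re (u * cnj (y - y0)) + (norm y)\<^sup>2 / 2\<bar> \<le> 2 * M / n + M\<^sup>2 / n"
    using 1 2 by linarith
  then show ?thesis unfolding e[unfolded u_def n_def] n_def add_divide_distrib by (simp add: u_def n_def)
qed

lemma sum_squares_isotropic:
  fixes a :: "complex^3" and w :: complex
  assumes a: "cdot a a = 0" "(norm a)\<^sup>2 = 2" and w: "w \<noteq> 0"
  shows "(\<Sum>k\<in>UNIV. (Re (a $ k / w))\<^sup>2) = 1 / (norm w)\<^sup>2" "(\<Sum>k\<in>UNIV. (norm (a $ k))\<^sup>2) = 2"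
proof -
  show n: "(\<Sum>k\<in>UNIV. (norm (a $ k))\<^sup>2) = 2"
    using a(2) by (simp add: norm_vec_def L2_set_def sum_nonneg)
  have sq: "(Re z)\<^sup>2 = ((norm z)\<^sup>2 + Re (z * z)) / 2" for z :: complex
    unfolding cmod_power2 by (simp add: power2_eq_square)
  have "(\<Sum>k\<in>UNIV. (Re (a $ k / w))\<^sup>2)
      = (\<Sum>k\<in>UNIV. ((norm (a $ k))\<^sup>2 / (norm w)\<^sup>2 + Re (a $ k * a $ k / w\<^sup>2)) / 2)"
    unfolding sq by (simp only: norm_divide power_divide times_divide_times_eq power2_eq_square[of w])
  also have "\<dots> = ((\<Sum>k\<in>UNIV. (norm (a $ k))\<^sup>2) / (norm w)\<^sup>2 + Re (cdot a a / w\<^sup>2)) / 2"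
    unfolding cdot_def by (simp only: sum_divide_distrib sum.distrib Re_sum add_divide_distrib)
  finally show "(\<Sum>k\<in>UNIV. (Re (a $ k / w))\<^sup>2) = 1 / (norm w)\<^sup>2"
    using n a(1) by simp
qed

text \<open>
  The expansions at a planar end. The remainders are uniform in the direction, and the intermediate terms
  \<open>\<alpha>\<close> and \<open>\<beta>\<close> have the symmetries that the averaging over rotations removes.
\<close>

lemma end_expansion:
  fixes f :: "complex \<Rightarrow> real^3" and a :: "complex^3" and Y :: "complex \<Rightarrow> complex^3"
  assumes a: "cdot a a = 0" "(norm a)\<^sup>2 = 2" and Y: "\<And>k. (\<lambda>w. Y w $ k) analytic_on {0}"
    and r: "r > 0"
    and f: "\<And>w. 0 < norm w \<Longrightarrow> norm w < r \<Longrightarrow> f differentiable (at w)"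
    and F: "\<And>w. 0 < norm w \<Longrightarrow> norm w < r \<Longrightarrow> complex_deriv f w = - ((1 / w\<^sup>2) *s a) + Y w"
    and conf: "\<And>w. 0 < norm w \<Longrightarrow> norm w < r \<Longrightarrow>
      induced_metric f w 1 1 = induced_metric f w \<i> \<i> \<and> induced_metric f w 1 \<i> = 0"
  shows "\<exists>\<delta>>0. \<delta> \<le> r \<and> (\<exists>C>0. \<exists>\<alpha> \<beta>. (\<forall>w. \<alpha> (- w) = - \<alpha> w) \<and> (\<forall>w. \<beta> (\<i> * w) = - \<beta> w) \<and>
    (\<forall>w. 0 < norm w \<and> norm w < \<delta> \<longrightarrow>
      \<bar>f w \<bullet> dird w f w - (- 1 / (norm w)\<^sup>2 - \<alpha> w)\<bar> \<le> C * norm w \<and>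
      \<bar>area_density f w - (1 / norm w ^ 4 - \<beta> w)\<bar> \<le> C / norm w))"
proof -
  obtain rr MM g where rr: "\<And>k. rr k > 0" and MM: "\<And>k. MM k > 0"
    and g: "\<And>k w. w \<in> ball 0 (rr k) \<Longrightarrow> (g k has_field_derivative Y w $ k) (at w) \<and>
      norm (Y w $ k) \<le> MM k \<and> norm (Y w $ k - Y 0 $ k) \<le> MM k * norm w \<and>
      norm (g k w) \<le> MM k * norm w \<and> norm (g k w - w * Y 0 $ k) \<le> MM k * (norm w)\<^sup>2"
    using analytic_primitive_bounds[OF Y] by metis
  define \<delta> where "\<delta> = min 1 (min r (Min (range rr)))"
  define M where "M = Max (range MM)"
  have \<delta>: "\<delta> > 0" "\<delta> \<le> 1" "\<delta> \<le> r" using r rr by (auto simp: \<delta>_def)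
  have \<delta>rr: "\<delta> \<le> rr k" for k
    unfolding \<delta>_def by (auto intro!: min.coboundedI2 Min_le)
  have MMM: "MM k \<le> M" for k by (auto simp: M_def intro!: Max_ge)
  have M: "M > 0" using MM MMM less_le_trans by blast
  have bd: "norm (Y w $ k) \<le> M" "norm (Y w $ k - Y 0 $ k) \<le> M * norm w"
    "norm (g k w) \<le> M * norm w" "norm (g k w - w * Y 0 $ k) \<le> M * (norm w)\<^sup>2"
    if "norm w < \<delta>" for k w
  proof -
    have w: "w \<in> ball 0 (rr k)" using that \<delta>rr[of k] by simp
    have m: "MM k * norm w \<le> M * norm w" "MM k * (norm w)\<^sup>2 \<le> M * (norm w)\<^sup>2"
      using MMM[of k] by (auto intro!: mult_right_mono)
    show "norm (Y w $ k) \<le> M" "norm (Y w $ k - Y 0 $ k) \<le> M * norm w"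
      "norm (g k w) \<le> M * norm w" "norm (g k w - w * Y 0 $ k) \<le> M * (norm w)\<^sup>2"
      using g[OF w] m MMM[of k] by linarith+
  qed
  let ?B = "ball 0 \<delta> - {0} :: complex set"
  have B: "open ?B" "connected ?B" by (auto intro: connected_open_delete)
  \<comment> \<open>what remains of \<open>f\<close> after removing the pole and the primitive of \<open>Y\<close> is constant\<close>
  define u where "u k w = f w $ k - Re (a $ k / w) - Re (g k w)" for k w
  have du: "(u k has_derivative (\<lambda>v. 0)) (at w)" if w: "w \<in> ?B" for k w
  proof -
    have w': "0 < norm w" "norm w < r" "w \<noteq> 0" "w \<in> ball 0 (rr k)"
      using w \<delta> \<delta>rr[of k] by auto
    have fd: "((\<lambda>w. f w $ k) has_derivative (\<lambda>v. Re (complex_deriv f w $ k * v))) (at w)"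
    proof -
      have "(f has_derivative frechet_derivative f (at w)) (at w)"
        using f[OF w'(1,2)] frechet_derivative_works by blast
      from bounded_linear.has_derivative[OF bounded_linear_vec_nth this]
      show ?thesis by (simp add: frechet_complex_deriv[OF f[OF w'(1,2)]])
    qed
    have "((\<lambda>w. a $ k / w) has_field_derivative - (a $ k / w\<^sup>2)) (at w)"
      using w'(3) by (auto intro!: derivative_eq_intros simp: power2_eq_square)
    from bounded_linear.has_derivative[OF bounded_linear_Re has_field_derivative_imp_has_derivative[OF this]]
    have ad: "((\<lambda>w. Re (a $ k / w)) has_derivative (\<lambda>v. Re (- (a $ k / w\<^sup>2) * v))) (at w)" .
    have "(g k has_field_derivative Y w $ k) (at w)" using g[OF w'(4)] by blast
    from bounded_linear.has_derivative[OF bounded_linear_Re has_field_derivative_imp_has_derivative[OF this]]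
    have gd: "((\<lambda>w. Re (g k w)) has_derivative (\<lambda>v. Re (Y w $ k * v))) (at w)" .
    have eq: "(\<lambda>v. Re (complex_deriv f w $ k * v) - Re (- (a $ k / w\<^sup>2) * v) - Re (Y w $ k * v)) = (\<lambda>v. 0)"
      unfolding F[OF w'(1,2)] by (simp add: fun_eq_iff algebra_simps)
    show ?thesis
      using has_derivative_diff[OF has_derivative_diff[OF fd ad] gd] unfolding eq u_def .
  qed
  define w0 where "w0 = complex_of_real (\<delta> / 2)"
  have w0: "w0 \<in> ?B" using \<delta> by (auto simp: w0_def)
  define c where "c k = u k w0" for k
  have fk: "f w $ k = Re (a $ k / w) + c k + Re (g k w)" if "w \<in> ?B" for w k
    using has_derivative_zero_unique_connected[OF B du that w0, of k] by (simp add: c_def u_def)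
  have ak: "norm (a $ k) \<le> 2" for k
  proof -
    have "norm a \<le> 2" by (rule power2_le_imp_le) (use a(2) in auto)
    then show ?thesis using Finite_Cartesian_Product.norm_nth_le[where x = a and i = k] by linarith
  qed
  define \<alpha> where "\<alpha> w = (\<Sum>k\<in>UNIV. c k * Re (a $ k / w))" for w
  define \<beta> where "\<beta> w = (\<Sum>k\<in>UNIV. Re (a $ k / w\<^sup>2 * cnj (Y 0 $ k)))" for w
  define C where "C = (\<Sum>k\<in>(UNIV :: 3 set). 4 * M + \<bar>c k\<bar> * M + M\<^sup>2) + (\<Sum>k\<in>(UNIV :: 3 set). 2 * M + M\<^sup>2)"
  have C1: "(\<Sum>k\<in>(UNIV :: 3 set). 4 * M + \<bar>c k\<bar> * M + M\<^sup>2) \<ge> 0"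
    "(\<Sum>k\<in>(UNIV :: 3 set). 2 * M + M\<^sup>2) > 0"
    using M by (auto intro!: sum_nonneg add_nonneg_nonneg simp: add_pos_nonneg)
  have C: "C > 0" using C1 by (simp add: C_def)
  have \<alpha>: "\<alpha> (- w) = - \<alpha> w" for w by (simp add: \<alpha>_def sum_negf)
  have \<beta>: "\<beta> (\<i> * w) = - \<beta> w" for w by (simp add: \<beta>_def sum_negf power_mult_distrib)
  have main: "\<bar>f w \<bullet> dird w f w - (- 1 / (norm w)\<^sup>2 - \<alpha> w)\<bar> \<le> C * norm w \<and>
      \<bar>area_density f w - (1 / norm w ^ 4 - \<beta> w)\<bar> \<le> C / norm w" if w: "0 < norm w" "norm w < \<delta>" for w
  proof
    have wr: "norm w < r" "w \<noteq> 0" "norm w \<le> 1" "w \<in> ?B" using w \<delta> by auto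
    have Fk: "complex_deriv f w $ k = - (a $ k / w\<^sup>2) + Y w $ k" for k
      using F[OF w(1) wr(1)] by simp
    have e1: "f w \<bullet> dird w f w
        = (\<Sum>k\<in>UNIV. (Re (a $ k / w) + c k + Re (g k w)) * Re ((- (a $ k / w\<^sup>2) + Y w $ k) * w))"
      by (simp add: inner_vec_def fk[OF wr(4)] frechet_complex_deriv[OF f[OF w(1) wr(1)]] Fk)
    have e2: "- 1 / (norm w)\<^sup>2 - \<alpha> w = (\<Sum>k\<in>UNIV. - (Re (a $ k / w))\<^sup>2 - c k * Re (a $ k / w))"
      using sum_squares_isotropic(1)[OF a wr(2)] by (simp add: \<alpha>_def sum_subtractf sum_negf)
    have "\<bar>f w \<bullet> dird w f w - (- 1 / (norm w)\<^sup>2 - \<alpha> w)\<bar>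
        \<le> (\<Sum>k\<in>(UNIV :: 3 set). (4 * M + \<bar>c k\<bar> * M + M\<^sup>2) * norm w)"
      unfolding e1 e2 sum_subtractf[symmetric]
      by (rule sum_abs[THEN order_trans], rule sum_mono,
          rule pole_expansion_position[OF wr(2,3) ak bd[OF w(2)]])
    also have "\<dots> \<le> C * norm w"
      unfolding sum_distrib_right[symmetric] using C1 by (intro mult_right_mono) (auto simp: C_def)
    finally show "\<bar>f w \<bullet> dird w f w - (- 1 / (norm w)\<^sup>2 - \<alpha> w)\<bar> \<le> C * norm w" .
    have e3: "area_density f w = (\<Sum>k\<in>UNIV. (norm (- (a $ k / w\<^sup>2) + Y w $ k))\<^sup>2 / 2)"
      using conformal_area_density(2)[of f w] conf[OF w(1) wr(1)] by (simp add: Fk)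
    have e4: "1 / norm w ^ 4 - \<beta> w
        = (\<Sum>k\<in>UNIV. (norm (a $ k))\<^sup>2 / 2 * (1 / norm w ^ 4) - Re (a $ k / w\<^sup>2 * cnj (Y 0 $ k)))"
      unfolding sum_subtractf sum_distrib_right[symmetric] sum_divide_distrib[symmetric]
        sum_squares_isotropic(2)[OF a wr(2)] by (simp add: \<beta>_def)
    have "\<bar>area_density f w - (1 / norm w ^ 4 - \<beta> w)\<bar> \<le> (\<Sum>k\<in>(UNIV :: 3 set). (2 * M + M\<^sup>2) / norm w)"
      unfolding e3 e4 sum_subtractf[symmetric]
      by (rule sum_abs[THEN order_trans], rule sum_mono,
          rule pole_expansion_density[OF wr(2,3) ak bd(1,2)[OF w(2)]])
    also have "\<dots> \<le> C / norm w"
      unfolding sum_divide_distrib[symmetric] using C1 by (intro divide_right_mono) (auto simp: C_def)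
    finally show "\<bar>area_density f w - (1 / norm w ^ 4 - \<beta> w)\<bar> \<le> C / norm w" .
  qed
  show ?thesis using \<delta>(1,3) C \<alpha> \<beta> main by blast
qed

section \<open>The contribution of an end\<close>

text \<open>
  A nonincreasing \<open>C\<^sup>1\<close> cutoff on the real line, equal to \<open>1\<close> for \<open>t \<le> 1/4\<close> and to \<open>0\<close> for \<open>t \<ge> 1\<close>, together with its
  derivative.
\<close>

definition cutoff :: "real \<Rightarrow> real"
  where "cutoff t = sqpos (1 - sqpos ((4 * t - 1) / 3))"

definition cutoff_deriv :: "real \<Rightarrow> real"
  where "cutoff_deriv t = - (16 / 3 * max 0 (1 - sqpos ((4 * t - 1) / 3)) * max 0 ((4 * t - 1) / 3))"

lemma cutoff_has_derivative: "(cutoff has_real_derivative cutoff_deriv t) (at t)"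
proof -
  have i: "((\<lambda>t. (4 * t - 1) / 3) has_real_derivative 4 / 3) (at t)"
    by (auto intro!: derivative_eq_intros)
  have "((\<lambda>t. 1 - sqpos ((4 * t - 1) / 3)) has_real_derivative
      0 - (2 * max 0 ((4 * t - 1) / 3)) * (4 / 3)) (at t)"
    by (intro derivative_intros DERIV_chain2[OF sqpos_has_derivative i])
  from DERIV_chain2[OF sqpos_has_derivative this] show ?thesis
    by (simp add: cutoff_def[abs_def] cutoff_deriv_def mult.commute mult.left_commute)
qed

lemma continuous_on_sqpos: "continuous_on A g \<Longrightarrow> continuous_on A (\<lambda>x. sqpos (g x))"
  unfolding sqpos_def by (intro continuous_intros)

lemma continuous_on_cutoff_deriv: "continuous_on A g \<Longrightarrow> continuous_on A (\<lambda>x. cutoff_deriv (g x))"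
  unfolding cutoff_deriv_def by (intro continuous_intros continuous_on_sqpos) auto

lemma continuous_on_cutoff: "continuous_on A g \<Longrightarrow> continuous_on A (\<lambda>x. cutoff (g x))"
  unfolding cutoff_def by (intro continuous_intros continuous_on_sqpos) auto

lemma cutoff_inner: "t \<le> 1 / 4 \<Longrightarrow> cutoff t = 1" "t \<le> 1 / 4 \<Longrightarrow> cutoff_deriv t = 0"
  by (simp_all add: cutoff_def cutoff_deriv_def sqpos_def)

lemma cutoff_outer:
  assumes "t \<ge> 1" shows "cutoff t = 0" "cutoff_deriv t = 0"
proof -
  have "1 \<le> ((4 * t - 1) / 3)\<^sup>2" using assms by (intro one_le_power) simp
  then have "1 - sqpos ((4 * t - 1) / 3) \<le> 0" using assms by (simp add: sqpos_def)
  then have "max 0 (1 - sqpos ((4 * t - 1) / 3)) = 0" by simp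
  then show "cutoff t = 0" "cutoff_deriv t = 0" by (simp_all add: cutoff_def cutoff_deriv_def sqpos_def[of "1 - _"])
qed

lemma cutoff_bounds: "0 \<le> cutoff t" "cutoff t \<le> 1"
proof -
  show "0 \<le> cutoff t" by (simp add: cutoff_def sqpos_def)
  have "0 \<le> sqpos ((4 * t - 1) / 3)" by (simp add: sqpos_def)
  then show "cutoff t \<le> 1"
    unfolding cutoff_def sqpos_def[of "1 - _"] by (intro power_le_one) auto
qed

lemma abs_cutoff_deriv_le: "\<bar>cutoff_deriv t\<bar> \<le> 6"
proof (cases "t \<ge> 1")
  case True
  then show ?thesis by (simp add: cutoff_outer)
next
  case False
  define q where "q = max 0 ((4 * t - 1) / 3)"
  define p where "p = max 0 (1 - sqpos ((4 * t - 1) / 3))"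
  have "0 \<le> sqpos ((4 * t - 1) / 3)" by (simp add: sqpos_def)
  then have "0 \<le> q" "q \<le> 1" "0 \<le> p" "p \<le> 1" using False by (auto simp: q_def p_def)
  then have "\<bar>p * q\<bar> \<le> 1" by (simp add: abs_mult mult_le_one)
  moreover have "cutoff_deriv t = - (16 / 3 * (p * q))" by (simp add: cutoff_deriv_def p_def q_def)
  ultimately show ?thesis by linarith
qed

text \<open>
  The radial cutoff in the coordinate at an end: \<open>1\<close> for \<open>|w| \<le> \<epsilon>/2\<close> and \<open>0\<close> for \<open>|w| \<ge> \<epsilon>\<close>.
\<close>

definition end_cutoff :: "real \<Rightarrow> complex \<Rightarrow> real"
  where "end_cutoff \<epsilon> w = cutoff ((norm w)\<^sup>2 / \<epsilon>\<^sup>2)"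

lemma end_cutoff_has_derivative:
  "(end_cutoff \<epsilon> has_derivative (\<lambda>v. cutoff_deriv ((norm w)\<^sup>2 / \<epsilon>\<^sup>2) * (2 * (w \<bullet> v) / \<epsilon>\<^sup>2))) (at w)"
proof -
  have "((\<lambda>w::complex. (w \<bullet> w) * inverse (\<epsilon>\<^sup>2)) has_derivative
      (\<lambda>v. (w \<bullet> v + v \<bullet> w) * inverse (\<epsilon>\<^sup>2))) (at w)"
    by (intro has_derivative_mult_left has_derivative_inner has_derivative_ident)
  then have "((\<lambda>w::complex. (w \<bullet> w) / \<epsilon>\<^sup>2) has_derivative (\<lambda>v. (w \<bullet> v + v \<bullet> w) / \<epsilon>\<^sup>2)) (at w)"
    by (simp only: divide_inverse)
  moreover have "(cutoff has_derivative (*) (cutoff_deriv ((w \<bullet> w) / \<epsilon>\<^sup>2))) (at ((w \<bullet> w) / \<epsilon>\<^sup>2))"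
    using cutoff_has_derivative by (simp add: has_field_derivative_def)
  ultimately have "((\<lambda>w. cutoff ((w \<bullet> w) / \<epsilon>\<^sup>2)) has_derivative
      (\<lambda>v. cutoff_deriv ((w \<bullet> w) / \<epsilon>\<^sup>2) * ((w \<bullet> v + v \<bullet> w) / \<epsilon>\<^sup>2))) (at w)"
    by (rule has_derivative_compose)
  then show ?thesis
    by (simp add: end_cutoff_def[abs_def] dot_square_norm inner_commute)
qed

lemma c1_on_end_cutoff: "c1_on A (end_cutoff \<epsilon>)"
  by (rule c1_onI[OF end_cutoff_has_derivative])
    (auto simp: divide_inverse intro!: continuous_intros continuous_on_cutoff_deriv)

lemma end_cutoff_inner:
  assumes "\<epsilon> > 0" "norm w \<le> \<epsilon> / 2"
  shows "end_cutoff \<epsilon> w = 1" "cutoff_deriv ((norm w)\<^sup>2 / \<epsilon>\<^sup>2) = 0"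
proof -
  have "(norm w)\<^sup>2 \<le> (\<epsilon> / 2)\<^sup>2" using assms by (intro power_mono) auto
  then have "(norm w)\<^sup>2 / \<epsilon>\<^sup>2 \<le> 1 / 4" using assms(1) by (simp add: field_simps power2_eq_square)
  then show "end_cutoff \<epsilon> w = 1" "cutoff_deriv ((norm w)\<^sup>2 / \<epsilon>\<^sup>2) = 0"
    by (simp_all add: end_cutoff_def cutoff_inner)
qed

lemma end_cutoff_outer:
  assumes "\<epsilon> > 0" "\<epsilon> \<le> norm w"
  shows "end_cutoff \<epsilon> w = 0" "cutoff_deriv ((norm w)\<^sup>2 / \<epsilon>\<^sup>2) = 0"
proof -
  have "\<epsilon>\<^sup>2 \<le> (norm w)\<^sup>2" using assms by (intro power_mono) auto
  then have "1 \<le> (norm w)\<^sup>2 / \<epsilon>\<^sup>2" using assms(1) by simp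
  then show "end_cutoff \<epsilon> w = 0" "cutoff_deriv ((norm w)\<^sup>2 / \<epsilon>\<^sup>2) = 0"
    by (simp_all add: end_cutoff_def cutoff_outer)
qed

text \<open>
  The leading part of half the flux integrand minus the collar integrand, as a function of \<open>s = |w|\<^sup>2\<close>. It is the
  derivative of \<open>(1 - cutoff (s / \<epsilon>\<^sup>2)) / s\<close>.
\<close>

definition end_density :: "real \<Rightarrow> real \<Rightarrow> real"
  where "end_density \<epsilon> s = - cutoff_deriv (s / \<epsilon>\<^sup>2) / (\<epsilon>\<^sup>2 * s) - (1 - cutoff (s / \<epsilon>\<^sup>2)) / s\<^sup>2"

lemma end_density_integral:
  assumes \<epsilon>: "\<epsilon> > 0"
  defines "G \<equiv> (\<lambda>s. indicator {..<\<epsilon>\<^sup>2} s * end_density \<epsilon> s)"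
  shows "integrable lborel (\<lambda>w::complex. G ((norm w)\<^sup>2))"
    and "(\<integral>w. G ((norm w)\<^sup>2) \<partial>(lborel :: complex measure)) = pi / \<epsilon>\<^sup>2"
proof -
  let ?I = "{\<epsilon>\<^sup>2 / 4 .. \<epsilon>\<^sup>2}"
  have pos: "s > 0" if "s \<in> ?I" for s
    using that zero_less_power[OF \<epsilon>, of 2] unfolding atLeastAtMost_iff by linarith
  have G[measurable]: "G \<in> borel_measurable borel"
  proof -
    have "continuous_on UNIV (\<lambda>s. cutoff_deriv (s / \<epsilon>\<^sup>2))" "continuous_on UNIV (\<lambda>s. cutoff (s / \<epsilon>\<^sup>2))"
      using \<epsilon> by (auto intro!: continuous_on_cutoff continuous_on_cutoff_deriv continuous_intros)
    then have "(\<lambda>s. cutoff_deriv (s / \<epsilon>\<^sup>2)) \<in> borel_measurable borel" "(\<lambda>s. cutoff (s / \<epsilon>\<^sup>2)) \<in> borel_measurable borel"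
      by (auto intro: borel_measurable_continuous_onI)
    then show ?thesis unfolding G_def end_density_def by measurable
  qed
  have F: "((\<lambda>s. (1 - cutoff (s / \<epsilon>\<^sup>2)) / s) has_real_derivative end_density \<epsilon> s) (at s)"
    if "\<epsilon>\<^sup>2 / 4 \<le> s" "s \<le> \<epsilon>\<^sup>2" for s
  proof -
    have s: "s > 0" using pos that by auto
    have "((\<lambda>s. s / \<epsilon>\<^sup>2) has_real_derivative 1 / \<epsilon>\<^sup>2) (at s)"
      by (rule DERIV_cdivide[OF DERIV_ident])
    note c = DERIV_chain2[OF cutoff_has_derivative this]
    have "((\<lambda>s. (1 - cutoff (s / \<epsilon>\<^sup>2)) / s) has_real_derivative
        ((0 - cutoff_deriv (s / \<epsilon>\<^sup>2) * (1 / \<epsilon>\<^sup>2)) * s - (1 - cutoff (s / \<epsilon>\<^sup>2)) * 1) / (s * s)) (at s)"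
      by (intro DERIV_divide DERIV_diff c DERIV_const DERIV_ident) (use s in simp)
    moreover have "((0 - cutoff_deriv (s / \<epsilon>\<^sup>2) * (1 / \<epsilon>\<^sup>2)) * s - (1 - cutoff (s / \<epsilon>\<^sup>2)) * 1) / (s * s)
        = end_density \<epsilon> s"
      using s \<epsilon> by (simp add: end_density_def field_simps power2_eq_square)
    ultimately show ?thesis by simp
  qed
  have cont: "isCont (end_density \<epsilon>) s" if "\<epsilon>\<^sup>2 / 4 \<le> s" "s \<le> \<epsilon>\<^sup>2" for s
  proof -
    have "continuous_on {0<..} (end_density \<epsilon>)"
      unfolding end_density_def using \<epsilon>
      by (intro continuous_intros continuous_on_cutoff continuous_on_cutoff_deriv) auto
    moreover have "s \<in> {0<..}" using pos[of s] that by simp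
    ultimately show ?thesis
      using continuous_on_eq_continuous_at[OF open_greaterThan] by blast
  qed
  have le: "\<epsilon>\<^sup>2 / 4 \<le> \<epsilon>\<^sup>2" by simp
  have v: "(1 - cutoff (\<epsilon>\<^sup>2 / \<epsilon>\<^sup>2)) / \<epsilon>\<^sup>2 - (1 - cutoff (\<epsilon>\<^sup>2 / 4 / \<epsilon>\<^sup>2)) / (\<epsilon>\<^sup>2 / 4) = 1 / \<epsilon>\<^sup>2"
    using \<epsilon> by (simp add: cutoff_inner cutoff_outer)
  have hb: "has_bochner_integral lborel (\<lambda>s. end_density \<epsilon> s * indicator ?I s) (1 / \<epsilon>\<^sup>2)"
    using has_bochner_integral_FTC_Icc_real[OF le F cont] unfolding v by blast
  have z: "end_density \<epsilon> s = 0" if "s < \<epsilon>\<^sup>2 / 4" "0 \<le> s" for s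
  proof -
    have "s / \<epsilon>\<^sup>2 \<le> 1 / 4" using that \<epsilon> by (simp add: field_simps)
    then show ?thesis by (simp add: end_density_def cutoff_inner)
  qed
  have ae: "AE s in lborel. end_density \<epsilon> s * indicator ?I s = indicator {0..} s * G s"
  proof -
    have "AE s in lborel. s \<noteq> \<epsilon>\<^sup>2" by (rule AE_lborel_singleton)
    then show ?thesis
    proof eventually_elim
      case (elim s)
      have e2: "\<epsilon>\<^sup>2 > 0" using \<epsilon> by simp
      consider "s < 0" | "0 \<le> s" "s < \<epsilon>\<^sup>2 / 4" | "\<epsilon>\<^sup>2 / 4 \<le> s" "s < \<epsilon>\<^sup>2" | "\<epsilon>\<^sup>2 < s"
        using elim by linarith
      then show ?case
      proof cases
        case 1
        then have "s \<notin> ?I" using pos[of s] by force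
        then show ?thesis using 1 by simp
      next
        case 2
        then show ?thesis using z by (simp add: G_def)
      next
        case 3
        then have "s \<in> ?I" "0 \<le> s" using pos[of s] by auto
        then show ?thesis using 3 by (simp add: G_def)
      next
        case 4
        then show ?thesis by (simp add: G_def)
      qed
    qed
  qed
  have m: "(\<lambda>s. end_density \<epsilon> s * indicator ?I s) \<in> borel_measurable lborel"
    using hb by (auto dest: borel_measurable_has_bochner_integral)
  have m2: "(\<lambda>s. indicator {0..} s * G s) \<in> borel_measurable lborel" by measurable
  have "integrable lborel (\<lambda>s. indicator {0..} s * G s)"
    using integrable_cong_AE[OF m m2 ae] hb by (simp add: has_bochner_integral_iff)
  then show "integrable lborel (\<lambda>w::complex. G ((norm w)\<^sup>2))"
    using lborel_integral_radial(2)[OF G] by simp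
  have "(\<integral>s. indicator {0..} s * G s \<partial>lborel) = 1 / \<epsilon>\<^sup>2"
    using integral_cong_AE[OF m m2 ae] hb by (simp add: has_bochner_integral_iff)
  then show "(\<integral>w. G ((norm w)\<^sup>2) \<partial>(lborel :: complex measure)) = pi / \<epsilon>\<^sup>2"
    using lborel_integral_radial(1)[OF G] by simp
qed

text \<open>
  The two integrands that an end contributes, in a chart with image \<open>W\<close> and surface map \<open>f\<close>: the first is
  the derivative of the cutoff along the position field, times the area density; the second is the
  area density on the disc of radius \<open>\<epsilon>\<close> weighted by the complementary cutoff, so that it lives on a collar.
\<close>

definition flux_integrand :: "complex set \<Rightarrow> (complex \<Rightarrow> real^3) \<Rightarrow> real \<Rightarrow> complex \<Rightarrow> real"
  where "flux_integrand W f \<epsilon> w = indicator W w * (area_density f w *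
    dird (position_field f w) (end_cutoff \<epsilon>) w)"

definition collar_integrand :: "complex set \<Rightarrow> (complex \<Rightarrow> real^3) \<Rightarrow> real \<Rightarrow> complex \<Rightarrow> real"
  where "collar_integrand W f \<epsilon> w = indicator W w * (area_density f w *
    (indicator (ball 0 \<epsilon>) w * (1 - end_cutoff \<epsilon> w)))"

context minimal_patch begin

text \<open>
  In a conformal coordinate the position field is the gradient of \<open>|f|\<^sup>2 / 2\<close> for the flat metric,
  divided by the area density.
\<close>

lemma conformal_radial_position:
  assumes w: "w \<in> W"
    and conf: "induced_metric f w 1 1 = induced_metric f w \<i> \<i>" "induced_metric f w 1 \<i> = 0"
  shows "area_density f w * (v \<bullet> position_field f w) = f w \<bullet> dird v f w"
proof -
  have A: "area_density f w = induced_metric f w 1 1" "area_density f w > 0"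
    using conformal_area_density(1)[OF conf] area_density_pos[OF w] by auto
  have "area_density f w *\<^sub>R conormal_x f w = area_density f w *\<^sub>R dird 1 f w"
    unfolding area_density_conormal_x using A conf by (simp add: induced_metric_def)
  then have x: "conormal_x f w = dird 1 f w" using A(2) by simp
  have "area_density f w *\<^sub>R conormal_y f w = area_density f w *\<^sub>R dird \<i> f w"
    unfolding area_density_conormal_y using A conf by (simp add: induced_metric_def)
  then have y: "conormal_y f w = dird \<i> f w" using A(2) by simp
  have AA: "\<And>A s t x y :: real. A > 0 \<Longrightarrow> A * (s * (x / A) + t * (y / A)) = s * x + t * y"
    by (simp add: field_simps)
  show ?thesis
    unfolding linear_complex_expand[OF linear_df[OF w], of v] inner_complex_def position_field_def
      complex.sel AA[OF A(2)] x y
    by (simp add: inner_add_right)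
qed

text \<open>
  The hypotheses are the expansions on the punctured disc of radius \<open>\<epsilon>\<close>. Both integrands are supported
  in the annulus between \<open>\<epsilon>/2\<close> and \<open>\<epsilon>\<close>; after averaging over rotations, their combination
  differs from the radial leading part by at most \<open>8 C / \<epsilon>\<close>, on a disc of area \<open>\<pi> \<epsilon>\<^sup>2\<close>.
\<close>

lemma end_integral:
  assumes \<epsilon>: "\<epsilon> > 0" and C: "C > 0"
    and W: "\<And>w. 0 < norm w \<Longrightarrow> norm w \<le> \<epsilon> \<Longrightarrow> w \<in> W"
    and conf: "\<And>w. w \<in> W \<Longrightarrow> induced_metric f w 1 1 = induced_metric f w \<i> \<i> \<and> induced_metric f w 1 \<i> = 0"
    and \<alpha>: "\<And>w. \<alpha> (- w) = - \<alpha> w" and \<beta>: "\<And>w. \<beta> (\<i> * w) = - \<beta> w"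
    and pos: "\<And>w. 0 < norm w \<Longrightarrow> norm w < \<epsilon> \<Longrightarrow>
      \<bar>f w \<bullet> dird w f w - (- 1 / (norm w)\<^sup>2 - \<alpha> w)\<bar> \<le> C * norm w"
    and dens: "\<And>w. 0 < norm w \<Longrightarrow> norm w < \<epsilon> \<Longrightarrow>
      \<bar>area_density f w - (1 / norm w ^ 4 - \<beta> w)\<bar> \<le> C / norm w"
  shows "integrable lborel (flux_integrand W f \<epsilon>)" "integrable lborel (collar_integrand W f \<epsilon>)"
    "\<bar>integral\<^sup>L lborel (flux_integrand W f \<epsilon>) / 2 - integral\<^sup>L lborel (collar_integrand W f \<epsilon>) - pi / \<epsilon>\<^sup>2\<bar>
      \<le> 8 * pi * C * \<epsilon>"
proof -
  define h1 where "h1 = flux_integrand W f \<epsilon>"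
  define h2 where "h2 = collar_integrand W f \<epsilon>"
  note h1_def' = h1_def[unfolded flux_integrand_def[abs_def]]
    and h2_def' = h2_def[unfolded collar_integrand_def[abs_def]]
  let ?K = "cball 0 \<epsilon> - ball 0 (\<epsilon> / 2) :: complex set"
  let ?c = "\<lambda>w. cutoff_deriv ((norm (w::complex))\<^sup>2 / \<epsilon>\<^sup>2)"
  let ?p = "\<lambda>w. f w \<bullet> dird w f w"
  have K: "compact ?K" by (intro compact_diff) auto
  have KW: "?K \<subseteq> W"
  proof
    fix w assume w: "w \<in> ?K"
    then have "\<epsilon> / 2 \<le> norm w" "norm w \<le> \<epsilon>" by auto
    then show "w \<in> W" using W[of w] \<epsilon> by linarith
  qed
  have h1: "h1 w = 2 / \<epsilon>\<^sup>2 * ?c w * ?p w" if "w \<in> W" for w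
  proof -
    have "h1 w = ?c w * (2 * (area_density f w * (w \<bullet> position_field f w)) / \<epsilon>\<^sup>2)"
      using that frechet_derivative_at[OF end_cutoff_has_derivative[where \<epsilon> = \<epsilon> and w = w], symmetric]
      by (simp add: h1_def')
    then show ?thesis
      using conformal_radial_position[OF that, of w] conf[OF that] by simp
  qed
  have h1_out: "h1 w = 0" if "w \<notin> ?K" for w
  proof (cases "w \<in> W")
    case True
    have "?c w = 0"
    proof (cases "norm w \<le> \<epsilon> / 2")
      case True
      then show ?thesis using end_cutoff_inner(2)[OF \<epsilon>] by blast
    next
      case False
      then have "\<epsilon> \<le> norm w" using that by auto
      then show ?thesis using end_cutoff_outer(2)[OF \<epsilon>] by blast
    qed
    then show ?thesis using h1[OF True] by simp
  qed (simp add: h1_def')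
  have cp: "continuous_on W ?p"
  proof -
    have "continuous_on W (\<lambda>w. f w \<bullet> (Re w *\<^sub>R dird 1 f w + Im w *\<^sub>R dird \<i> f w))"
      by (intro continuous_intros c1_on_continuous[OF c1(1)] c1_on_continuous[OF c1(2)])
    then show ?thesis
      by (rule continuous_on_eq) (simp add: linear_complex_expand[OF linear_df, symmetric])
  qed
  have "continuous_on ?K (\<lambda>w. 2 / \<epsilon>\<^sup>2 * ?c w * ?p w)"
    using \<epsilon> by (intro continuous_intros continuous_on_cutoff_deriv continuous_on_subset[OF cp KW]) auto
  then have ch1: "continuous_on ?K h1"
    by (rule continuous_on_eq) (use h1 KW in auto)
  have i1: "integrable lborel h1"
    by (rule integrable_continuous_compact_support[OF ch1 K h1_out])
  define k2 where "k2 w = indicator ?K w * (area_density f w * (1 - end_cutoff \<epsilon> w))" for w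
  have "continuous_on ?K (\<lambda>w. area_density f w * (1 - end_cutoff \<epsilon> w))"
    by (intro continuous_intros continuous_on_subset[OF c1_on_continuous[OF c1_area_density] KW]
        c1_on_continuous[OF c1_on_end_cutoff])
  then have "continuous_on ?K k2"
    by (rule continuous_on_eq) (simp add: k2_def)
  then have ik2: "integrable lborel k2"
    by (rule integrable_continuous_compact_support[OF _ K]) (simp add: k2_def)
  have h2: "h2 w = indicator (ball 0 \<epsilon>) w * k2 w" for w
  proof (cases "norm w < \<epsilon> / 2")
    case True
    then show ?thesis using end_cutoff_inner(1)[OF \<epsilon>, of w] by (simp add: h2_def' k2_def)
  next
    case False
    then have "w \<in> ?K \<and> w \<in> W \<or> w \<notin> ball 0 \<epsilon>" using KW by (auto simp: subset_iff)
    then show ?thesis by (elim disjE conjE) (simp_all add: h2_def' k2_def)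
  qed
  have i2: "integrable lborel h2"
    unfolding h2 using integrable_mult_indicator[OF _ ik2, of "ball 0 \<epsilon>"] by simp
  define g where "g w = h1 w / 2 - h2 w" for w
  have ig: "integrable lborel g" unfolding g_def using i1 i2 by simp
  have g: "g w = ?c w / \<epsilon>\<^sup>2 * ?p w - (1 - end_cutoff \<epsilon> w) * area_density f w"
    if "0 < norm w" "norm w < \<epsilon>" for w
    using h1[OF W, of w] W[of w] that by (simp add: g_def h2_def')
  have g_in: "g w = 0" if "norm w < \<epsilon> / 2" for w
    using h1_out[of w] end_cutoff_inner(1)[OF \<epsilon>, of w] that by (simp add: g_def h2_def')
  have g_out: "g w = 0" if "\<epsilon> \<le> norm w" for w
  proof -
    have "?c w = 0" using end_cutoff_outer(2)[OF \<epsilon>, of w] that by auto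
    then have "h1 w = 0" using h1[of w] by (cases "w \<in> W") (auto simp: h1_def')
    then show ?thesis using that by (auto simp: g_def h2_def')
  qed
  define avg where "avg w = (g w + g (\<i> * w) + g (- w) + g (- \<i> * w)) / 4" for w
  note avg = lborel_integral_rotation_average[OF ig, folded avg_def]
  define G where "G s = indicator {..<\<epsilon>\<^sup>2} s * end_density \<epsilon> s" for s
  note G = end_density_integral[OF \<epsilon>, folded G_def]
  have bound: "\<bar>avg w - G ((norm w)\<^sup>2)\<bar> \<le> 8 * C / \<epsilon> * indicator (ball 0 \<epsilon>) w" for w
  proof -
    consider "norm w < \<epsilon> / 2" | "\<epsilon> / 2 \<le> norm w" "norm w < \<epsilon>" | "\<epsilon> \<le> norm w" by linarith
    then show ?thesis
    proof cases
      case 1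
      have "avg w = 0" unfolding avg_def using 1 by (simp add: g_in norm_mult)
      moreover have "end_density \<epsilon> ((norm w)\<^sup>2) = 0"
        using end_cutoff_inner[OF \<epsilon>, of w] 1 by (simp add: end_density_def end_cutoff_def)
      ultimately show ?thesis using C \<epsilon> by (simp add: G_def)
    next
      case 3
      have "avg w = 0" unfolding avg_def using 3 by (simp add: g_out norm_mult)
      moreover have "\<epsilon>\<^sup>2 \<le> (norm w)\<^sup>2" using 3 \<epsilon> by (intro power_mono) auto
      then have "(norm w)\<^sup>2 \<notin> {..<\<epsilon>\<^sup>2}" by (simp only: lessThan_iff not_less)
      then have "G ((norm w)\<^sup>2) = 0" by (simp only: G_def indicator_simps mult_zero_left not_False_eq_True)
      ultimately show ?thesis using C \<epsilon> by simp
    next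
      case 2
      define n where "n = norm w"
      have n: "n > 0" "\<epsilon> / 2 \<le> n" "n < \<epsilon>" using 2 \<epsilon> by (auto simp: n_def)
      \<comment> \<open>the remainders of the two expansions\<close>
      define P where "P v = ?p v - (- 1 / n\<^sup>2 - \<alpha> v)" for v
      define A where "A v = area_density f v - (1 / n ^ 4 - \<beta> v)" for v
      have PA: "\<bar>P v\<bar> \<le> C * n" "\<bar>A v\<bar> \<le> C / n"
        and gv: "g v = ?c w / \<epsilon>\<^sup>2 * (- 1 / n\<^sup>2 - \<alpha> v + P v)
          - (1 - end_cutoff \<epsilon> w) * (1 / n ^ 4 - \<beta> v + A v)" if "norm v = n" for v
        using pos[of v] dens[of v] g[of v] that n
        by (simp_all add: P_def A_def n_def end_cutoff_def)
      let ?v1 = "\<i> * w" and ?v2 = "- w" and ?v3 = "- \<i> * w"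
      have nv: "norm w = n" "norm ?v1 = n" "norm ?v2 = n" "norm ?v3 = n"
        by (simp_all add: n_def norm_mult)
      have \<alpha>0: "\<alpha> ?v2 = - \<alpha> w" "\<alpha> ?v3 = - \<alpha> ?v1" using \<alpha>[of w] \<alpha>[of ?v1] by simp_all
      have \<beta>0: "\<beta> ?v1 = - \<beta> w" "\<beta> ?v2 = \<beta> w" "\<beta> ?v3 = - \<beta> w"
        using \<beta>[of w] \<beta>[of ?v1] \<beta>[of ?v2] by (simp_all flip: mult.assoc)
      define p where "p = (P w + P ?v1 + P ?v2 + P ?v3) / 4"
      define q where "q = (A w + A ?v1 + A ?v2 + A ?v3) / 4"
      have pq: "\<bar>p\<bar> \<le> C * n" "\<bar>q\<bar> \<le> C / n"
      proof -
        have quarter: "\<bar>(r + s + t + u) / 4\<bar> \<le> B"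
          if "\<bar>r\<bar> \<le> B" "\<bar>s\<bar> \<le> B" "\<bar>t\<bar> \<le> B" "\<bar>u\<bar> \<le> B" for r s t u B :: real
          using that by (simp add: abs_le_iff)
        show "\<bar>p\<bar> \<le> C * n" "\<bar>q\<bar> \<le> C / n"
          unfolding p_def q_def by (intro quarter PA nv)+
      qed
      have cancel: "((k * (N - a + p1) - e * (M - b + q1)) + (k * (N - a' + p2) - e * (M - - b + q2))
          + (k * (N - - a + p3) - e * (M - b + q3)) + (k * (N - - a' + p4) - e * (M - - b + q4))) / 4
        = k * (N + (p1 + p2 + p3 + p4) / 4) - e * (M + (q1 + q2 + q3 + q4) / 4)"
        for k e N M a a' b p1 p2 p3 p4 q1 q2 q3 q4 :: real
        by (simp add: field_simps)
      have "avg w = ?c w / \<epsilon>\<^sup>2 * (- 1 / n\<^sup>2 + p) - (1 - end_cutoff \<epsilon> w) * (1 / n ^ 4 + q)"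
        unfolding avg_def gv[OF nv(1)] gv[OF nv(2)] gv[OF nv(3)] gv[OF nv(4)] \<alpha>0 \<beta>0 p_def q_def
        by (rule cancel)
      moreover have "G (n\<^sup>2) = ?c w / \<epsilon>\<^sup>2 * (- 1 / n\<^sup>2) - (1 - end_cutoff \<epsilon> w) * (1 / n ^ 4)"
      proof -
        have "n\<^sup>2 < \<epsilon>\<^sup>2" using n by (intro power_strict_mono) auto
        then show ?thesis
          using n \<epsilon> by (simp add: G_def end_density_def end_cutoff_def n_def flip: power_mult)
      qed
      moreover have "x - y = k * p - e * q" if "x = k * (N + p) - e * (M + q)" "y = k * N - e * M"
        for x y k e N M :: real
        using that by (simp add: algebra_simps)
      ultimately have "avg w - G (n\<^sup>2) = ?c w / \<epsilon>\<^sup>2 * p - (1 - end_cutoff \<epsilon> w) * q"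
        by blast
      moreover have "\<bar>?c w / \<epsilon>\<^sup>2 * p\<bar> \<le> 6 * C / \<epsilon>"
      proof -
        have "\<bar>?c w / \<epsilon>\<^sup>2 * p\<bar> \<le> 6 / \<epsilon>\<^sup>2 * (C * \<epsilon>)"
          unfolding abs_mult abs_divide
        proof (rule mult_mono)
          show "\<bar>?c w\<bar> / \<bar>\<epsilon>\<^sup>2\<bar> \<le> 6 / \<epsilon>\<^sup>2"
            using abs_cutoff_deriv_le by (simp add: divide_right_mono)
          show "\<bar>p\<bar> \<le> C * \<epsilon>" using pq(1) n C by (meson less_imp_le mult_left_mono order_trans)
        qed (use \<epsilon> in auto)
        also have "\<dots> = 6 * C / \<epsilon>" using \<epsilon> by (simp add: power2_eq_square)
        finally show ?thesis .
      qed
      moreover have "\<bar>(1 - end_cutoff \<epsilon> w) * q\<bar> \<le> 2 * C / \<epsilon>"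
      proof -
        have "C / n \<le> C / (\<epsilon> / 2)" using n \<epsilon> C by (intro divide_left_mono) auto
        then have "\<bar>q\<bar> \<le> 2 * C / \<epsilon>" using pq(2) by (simp add: mult.commute)
        moreover have "\<bar>1 - end_cutoff \<epsilon> w\<bar> \<le> 1"
          using cutoff_bounds by (simp add: end_cutoff_def)
        ultimately show ?thesis
          unfolding abs_mult using mult_mono[of "\<bar>1 - end_cutoff \<epsilon> w\<bar>" 1 "\<bar>q\<bar>"] by simp
      qed
      ultimately have "\<bar>avg w - G (n\<^sup>2)\<bar> \<le> 6 * C / \<epsilon> + 2 * C / \<epsilon>" by linarith
      also have "\<dots> = 8 * C / \<epsilon>" by (simp add: field_simps)
      finally show ?thesis using n by (simp add: n_def)
    qed
  qed
  have fin: "integrable lborel (\<lambda>w::complex. 8 * C / \<epsilon> * indicator (ball 0 \<epsilon>) w)"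
    by (intro integrable_mult_right integrable_real_indicator emeasure_bounded_finite) auto
  have "\<bar>(\<integral>w. avg w - G ((norm w)\<^sup>2) \<partial>lborel)\<bar> \<le> (\<integral>w. 8 * C / \<epsilon> * indicator (ball 0 \<epsilon>) w \<partial>(lborel :: complex measure))"
  proof (rule order_trans[OF integral_abs_bound integral_mono])
    show "integrable lborel (\<lambda>w. \<bar>avg w - G ((norm w)\<^sup>2)\<bar>)" using avg(1) G(1) by simp
  qed (use fin bound in auto)
  also have "\<dots> = 8 * C / \<epsilon> * (pi * \<epsilon>\<^sup>2)"
    using \<epsilon> by (simp add: content_ball unit_ball_vol_2)
  also have "\<dots> = 8 * pi * C * \<epsilon>" using \<epsilon> by (simp add: power2_eq_square)
  finally have "\<bar>integral\<^sup>L lborel g - pi / \<epsilon>\<^sup>2\<bar> \<le> 8 * pi * C * \<epsilon>"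
    using avg G by simp
  moreover have "integral\<^sup>L lborel g = integral\<^sup>L lborel h1 / 2 - integral\<^sup>L lborel h2"
    unfolding g_def using i1 i2 by simp
  ultimately have "\<bar>integral\<^sup>L lborel h1 / 2 - integral\<^sup>L lborel h2 - pi / \<epsilon>\<^sup>2\<bar> \<le> 8 * pi * C * \<epsilon>"
    by simp
  with i1 i2 show "integrable lborel (flux_integrand W f \<epsilon>)" "integrable lborel (collar_integrand W f \<epsilon>)"
    "\<bar>integral\<^sup>L lborel (flux_integrand W f \<epsilon>) / 2 - integral\<^sup>L lborel (collar_integrand W f \<epsilon>) - pi / \<epsilon>\<^sup>2\<bar>
      \<le> 8 * pi * C * \<epsilon>"
    unfolding h1_def h2_def by simp_all
qed

end

section \<open>Area outside the coordinate discs\<close>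

context minimal_surface begin

lemma chart_disc_eventually:
  assumes c: "(U, \<phi>) \<in> \<A>" and q: "q \<in> U" "\<phi> q = 0" and T: "open T" "q \<in> T"
  shows "\<forall>\<^sub>F \<epsilon> in at_right 0. cball 0 \<epsilon> \<subseteq> \<phi> ` (U \<inter> T)"
proof -
  have "openin (top_of_set S) (U \<inter> T)"
    using chart(1)[OF c] T(1) by (auto simp: openin_open)
  then have "open (\<phi> ` (U \<inter> T))" using open_chart_image[OF c] by blast
  moreover have "0 \<in> \<phi> ` (U \<inter> T)" using q T by force
  ultimately obtain d where d: "d > 0" "cball 0 d \<subseteq> \<phi> ` (U \<inter> T)"
    using open_contains_cball by blast
  have "\<forall>\<^sub>F \<epsilon> in at_right 0. \<epsilon> < d"
    using d(1) unfolding eventually_at_right_field by blast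
  then show ?thesis
  proof eventually_elim
    case (elim \<epsilon>)
    then show ?case using d(2) by (auto simp: subset_iff)
  qed
qed

lemma end_integral_estimate:
  assumes end_coord: "normalized_end_coordinate \<A> P X q (U, \<phi>) a Y"
  defines "f \<equiv> local_rep X (U, \<phi>)" and "W \<equiv> \<phi> ` (U - P)"
  shows "\<exists>C. \<forall>\<^sub>F \<epsilon> in at_right 0.
    integrable lborel (flux_integrand W f \<epsilon>) \<and> integrable lborel (collar_integrand W f \<epsilon>) \<and>
    \<bar>integral\<^sup>L lborel (flux_integrand W f \<epsilon>) / 2 - integral\<^sup>L lborel (collar_integrand W f \<epsilon>) - pi / \<epsilon>\<^sup>2\<bar> \<le> C * \<epsilon>"
proof -
  have c: "(U, \<phi>) \<in> \<A>" and q: "q \<in> U" "\<phi> q = 0" and conf: "conformal_on W f"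
    and a: "cdot a a = 0" "(norm a)\<^sup>2 = 2" and Y: "\<And>k. (\<lambda>w. Y w $ k) analytic_on {0}"
    and F: "\<forall>\<^sub>F w in at 0. complex_deriv f w = - ((1 / w\<^sup>2) *s a) + Y w"
    using end_coord unfolding normalized_end_coordinate_def f_def W_def by auto
  interpret pU: minimal_patch W f unfolding W_def f_def by (rule patch[OF c])
  have "open (\<phi> ` (U - (P - {q})))"
    using open_chart_image[OF c openin_minus_finite[OF chart(1)[OF c], of "P - {q}"]] finite_P by blast
  moreover have "0 \<in> \<phi> ` (U - (P - {q}))" using q by force
  ultimately obtain r1 where r1: "r1 > 0" "ball 0 r1 \<subseteq> \<phi> ` (U - (P - {q}))"
    using open_contains_ball by blast
  obtain r2 where r2: "r2 > 0" "\<And>w. w \<noteq> 0 \<Longrightarrow> dist w 0 < r2 \<Longrightarrow>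
      complex_deriv f w = - ((1 / w\<^sup>2) *s a) + Y w"
    using F unfolding eventually_at by blast
  define r where "r = min r1 r2"
  have r: "r > 0" using r1 r2 by (simp add: r_def)
  have W: "w \<in> W" if "0 < norm w" "norm w < r" for w
  proof -
    have "w \<in> \<phi> ` (U - (P - {q}))" using that r1(2) by (auto simp: r_def)
    then obtain x where "x \<in> U - (P - {q})" "w = \<phi> x" by blast
    moreover from this have "x \<noteq> q" using q that by auto
    ultimately show ?thesis by (auto simp: W_def)
  qed
  have conf': "induced_metric f w 1 1 = induced_metric f w \<i> \<i> \<and> induced_metric f w 1 \<i> = 0" if "w \<in> W" for w
    using conf that by (simp add: conformal_on_def)
  have df: "f differentiable (at w)" if "0 < norm w" "norm w < r" for w
    using pU.c1(1) W[OF that] by (simp add: c1_on_def)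
  have Fr: "complex_deriv f w = - ((1 / w\<^sup>2) *s a) + Y w" if "0 < norm w" "norm w < r" for w
    using r2(2)[of w] that by (simp add: r_def)
  obtain \<delta> C \<alpha> \<beta> where \<delta>: "\<delta> > 0" "\<delta> \<le> r" and C: "C > 0"
    and \<alpha>: "\<And>w. \<alpha> (- w) = - \<alpha> w" and \<beta>: "\<And>w. \<beta> (\<i> * w) = - \<beta> w"
    and pos: "\<And>w. 0 < norm w \<Longrightarrow> norm w < \<delta> \<Longrightarrow>
      \<bar>f w \<bullet> dird w f w - (- 1 / (norm w)\<^sup>2 - \<alpha> w)\<bar> \<le> C * norm w"
    and dens: "\<And>w. 0 < norm w \<Longrightarrow> norm w < \<delta> \<Longrightarrow>
      \<bar>area_density f w - (1 / norm w ^ 4 - \<beta> w)\<bar> \<le> C / norm w"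
    using end_expansion[OF a Y r df Fr conf'[OF W]] by metis
  have "\<forall>\<^sub>F \<epsilon> in at_right 0. 0 < \<epsilon> \<and> \<epsilon> < \<delta>"
    using \<delta>(1) unfolding eventually_at_right_field by blast
  then have "\<forall>\<^sub>F \<epsilon> in at_right 0.
    integrable lborel (flux_integrand W f \<epsilon>) \<and> integrable lborel (collar_integrand W f \<epsilon>) \<and>
    \<bar>integral\<^sup>L lborel (flux_integrand W f \<epsilon>) / 2 - integral\<^sup>L lborel (collar_integrand W f \<epsilon>) - pi / \<epsilon>\<^sup>2\<bar> \<le> 8 * pi * C * \<epsilon>"
  proof eventually_elim
    case (elim \<epsilon>)
    have W\<epsilon>: "w \<in> W" if "0 < norm w" "norm w \<le> \<epsilon>" for w using W[of w] that elim \<delta> by simp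
    have pos\<epsilon>: "\<bar>f w \<bullet> dird w f w - (- 1 / (norm w)\<^sup>2 - \<alpha> w)\<bar> \<le> C * norm w"
      and dens\<epsilon>: "\<bar>area_density f w - (1 / norm w ^ 4 - \<beta> w)\<bar> \<le> C / norm w"
      if "0 < norm w" "norm w < \<epsilon>" for w
      using pos[of w] dens[of w] that elim by simp_all
    note ei = pU.end_integral[OF conjunct1[OF elim] C W\<epsilon> conf' \<alpha> \<beta> pos\<epsilon> dens\<epsilon>]
    show ?case by (intro conjI ei)
  qed
  then show ?thesis by blast
qed

lemma chart_disc_open:
  assumes c: "(U, \<phi>) \<in> \<A>" shows "openin (top_of_set S) {x \<in> U. \<phi> x \<in> ball 0 r}"
proof -
  have "openin (top_of_set U) (U \<inter> \<phi> -` ball 0 r)"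
    by (rule continuous_openin_preimage_gen[OF chart(5)[OF c]]) simp
  then show ?thesis
    using openin_trans[OF _ chart(1)[OF c]] by (simp add: vimage_def Int_def)
qed

text \<open>
  The area outside the discs equals the integral of \<open>\<eta> = 1 - \<Sum>\<^sub>i \<kappa>\<^sub>i\<close> less the integrals of \<open>\<eta>\<close>
  over the collars, and the divergence theorem trades the former for the flux integrals. The two
  integrands appear as \<open>h1\<close> and \<open>h2\<close>.
\<close>

lemma area_outside_discs:
  fixes I :: "'i set" and z :: "'i \<Rightarrow> 'a chart"
  assumes I: "finite I" and \<epsilon>: "\<epsilon> > 0"
    and z: "\<And>i. i \<in> I \<Longrightarrow> z i \<in> \<A>"
    and P: "\<And>x. x \<in> P \<Longrightarrow> \<exists>i\<in>I. x \<in> fst (z i) \<and> snd (z i) x = 0"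
    and sub: "\<And>i. i \<in> I \<Longrightarrow> cball 0 \<epsilon> \<subseteq> snd (z i) ` fst (z i)"
    and disj: "\<And>i j x. i \<in> I \<Longrightarrow> j \<in> I \<Longrightarrow> x \<in> fst (z i) \<Longrightarrow> snd (z i) x \<in> cball 0 \<epsilon> \<Longrightarrow>
      x \<in> fst (z j) \<Longrightarrow> snd (z j) x \<in> cball 0 \<epsilon> \<Longrightarrow> i = j"
  defines "h1 \<equiv> \<lambda>i. flux_integrand (snd (z i) ` (fst (z i) - P)) (local_rep X (z i)) \<epsilon>"
    and "h2 \<equiv> \<lambda>i. collar_integrand (snd (z i) ` (fst (z i) - P)) (local_rep X (z i)) \<epsilon>"
  assumes int1: "\<And>i. i \<in> I \<Longrightarrow> integrable lborel (h1 i)" and int2: "\<And>i. i \<in> I \<Longrightarrow> integrable lborel (h2 i)"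
  shows "(LINT x:(S - (\<Union>i\<in>I. coordinate_disc (z i) \<epsilon>))|\<mu>. 1)
    = (\<Sum>i\<in>I. integral\<^sup>L lborel (h1 i) / 2 - integral\<^sup>L lborel (h2 i))"
proof -
  define U where "U i = fst (z i)" for i
  define \<phi> where "\<phi> i = snd (z i)" for i
  have zp: "z i = (U i, \<phi> i)" for i by (simp add: U_def \<phi>_def)
  have c: "(U i, \<phi> i) \<in> \<A>" if "i \<in> I" for i using z[OF that] zp by simp
  have sub': "cball 0 \<epsilon> \<subseteq> \<phi> i ` U i" if "i \<in> I" for i using sub[OF that] by (simp add: U_def \<phi>_def)
  define \<kappa> where "\<kappa> i = extend_chart (U i, \<phi> i) (end_cutoff \<epsilon>)" for i
  have out: "end_cutoff \<epsilon> w = 0" if "w \<notin> cball 0 \<epsilon>" for w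
    using end_cutoff_outer(1)[OF \<epsilon>, of w] that by simp
  have \<kappa>: "C1_surface \<A> (\<kappa> i)" if "i \<in> I" for i
    unfolding \<kappa>_def
    by (rule C1_surface_extend_chart[OF c[OF that] c1_on_end_cutoff compact_cball sub'[OF that] out])
  have \<kappa>_out: "\<kappa> i x = 0" if "\<not> (x \<in> U i \<and> norm (\<phi> i x) < \<epsilon>)" for i x
    using that end_cutoff_outer(1)[OF \<epsilon>] by (auto simp: \<kappa>_def extend_chart_def)
  define \<eta> where "\<eta> x = 1 - (\<Sum>i\<in>I. \<kappa> i x)" for x
  have c1sum: "C1_surface \<A> (\<lambda>x. \<Sum>i\<in>I. \<kappa> i x)" by (rule C1_surface_sum) (rule \<kappa>)
  have \<eta>: "C1_surface \<A> \<eta>"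
    unfolding \<eta>_def[abs_def] by (rule C1_surface_diff[OF C1_surface_const c1sum])
  have sum_disc: "(\<Sum>j\<in>I. \<kappa> j x) = \<kappa> i x" if "i \<in> I" "x \<in> U i" "norm (\<phi> i x) < \<epsilon>" for i x
  proof -
    have "\<kappa> j x = 0" if j: "j \<in> I" "j \<noteq> i" for j
    proof (rule \<kappa>_out, rule notI)
      assume "x \<in> U j \<and> norm (\<phi> j x) < \<epsilon>"
      then have "i = j"
        using disj[of i j x] j \<open>i \<in> I\<close> \<open>x \<in> U i\<close> \<open>norm (\<phi> i x) < \<epsilon>\<close> by (simp add: U_def \<phi>_def)
      then show False using j by simp
    qed
    then have "(\<Sum>j\<in>I. \<kappa> j x) = (\<Sum>j\<in>{i}. \<kappa> j x)"
      using I \<open>i \<in> I\<close> by (intro sum.mono_neutral_right) auto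
    then show ?thesis by simp
  qed
  define N where "N = (\<Union>i\<in>I. {x \<in> U i. \<phi> i x \<in> ball 0 (\<epsilon> / 2)})"
  have N1: "openin (top_of_set S) N" unfolding N_def using chart_disc_open[OF c] by blast
  have N2: "P \<inter> S \<subseteq> N"
  proof
    fix x assume "x \<in> P \<inter> S"
    then obtain i where "i \<in> I" "x \<in> U i" "\<phi> i x = 0" using P[of x] by (auto simp: U_def \<phi>_def)
    then show "x \<in> N" using \<epsilon> by (auto simp: N_def)
  qed
  have N3: "\<eta> x = 0" if x: "x \<in> N" for x
  proof -
    obtain i where i: "i \<in> I" "x \<in> U i" "norm (\<phi> i x) < \<epsilon> / 2" using x by (auto simp: N_def)
    then have "\<kappa> i x = 1" using end_cutoff_inner(1)[OF \<epsilon>, of "\<phi> i x"] by (simp add: \<kappa>_def extend_chart_def)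
    then show ?thesis using sum_disc[OF i(1,2)] i \<epsilon> by (simp add: \<eta>_def)
  qed
  note div = divergence_theorem[OF \<eta> N1 N2 N3]
  \<comment> \<open>\<open>\<kappa> i\<close> does not vanish near its puncture, but it is constant there, so its derivative is integrable\<close>
  have T1: "integrable \<mu> (along (\<kappa> i))"
    "integral\<^sup>L \<mu> (along (\<kappa> i)) = integral\<^sup>L lborel (h1 i)" if i: "i \<in> I" for i
  proof -
    have m: "along (\<kappa> i) \<in> borel_measurable \<mu>"
      by (rule borel_measurable_continuous_surface[OF continuous_position_deriv[OF \<kappa>[OF i]]])
    have o: "along (\<kappa> i) x = 0" if x: "x \<in> S - P - U i" for x
    proof -
      have "openin (top_of_set S) (S - inv_into (U i) (\<phi> i) ` cball 0 \<epsilon>)"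
        by (rule openin_minus_chart_compact[OF c[OF i] compact_cball sub'[OF i] openin_subtopology_self])
      moreover have "inv_into (U i) (\<phi> i) ` cball 0 \<epsilon> \<subseteq> U i"
        using sub'[OF i] by (auto intro: inv_into_into)
      moreover have "\<kappa> i y = 0" if "y \<in> S - inv_into (U i) (\<phi> i) ` cball 0 \<epsilon>" for y
      proof (rule \<kappa>_out, rule notI)
        assume "y \<in> U i \<and> norm (\<phi> i y) < \<epsilon>"
        then have "y = inv_into (U i) (\<phi> i) (\<phi> i y)" "\<phi> i y \<in> cball 0 \<epsilon>"
          using chart(8)[OF c[OF i]] by auto
        then show False using that by blast
      qed
      ultimately have "along (\<kappa> i) x = along (\<lambda>x. 0) x"
        using x by (intro position_deriv_cong[OF \<kappa>[OF i] C1_surface_const]) auto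
      then show ?thesis using position_deriv_const[of x 0] x by simp
    qed
    have e: "indicator (\<phi> i ` (U i - P)) w * (area_density (local_rep X (U i, \<phi> i)) w *
        along (\<kappa> i) (inv_into (U i) (\<phi> i) w)) = h1 i w" for w
    proof (cases "w \<in> \<phi> i ` (U i - P)")
      case True
      then obtain x where x: "x \<in> U i - P" "w = \<phi> i x" by blast
      have "frechet_derivative (local_rep (\<kappa> i) (U i, \<phi> i)) (at w)
          = frechet_derivative (end_cutoff \<epsilon>) (at w)"
      proof (rule dird_cong_open[OF chart(3)[OF c[OF i]]])
        show "w \<in> \<phi> i ` U i" using x by blast
        show "local_rep (\<kappa> i) (U i, \<phi> i) y = end_cutoff \<epsilon> y" if "y \<in> \<phi> i ` U i" for y
          using that chart(8)[OF c[OF i]] by (auto simp: local_rep_pair \<kappa>_def extend_chart_def)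
      qed
      then show ?thesis
        using position_deriv_chart[OF \<kappa>[OF i] c[OF i] x(1)] x chart(8)[OF c[OF i]]
        by (simp add: h1_def flux_integrand_def zp)
    qed (simp add: h1_def flux_integrand_def zp)
    show "integrable \<mu> (along (\<kappa> i))"
      "integral\<^sup>L \<mu> (along (\<kappa> i)) = integral\<^sup>L lborel (h1 i)"
      using area_chart_integral[OF c[OF i] m o, unfolded e] int1[OF i] by simp_all
  qed
  have "integral\<^sup>L \<mu> (along \<eta>) = (\<integral>x. - (\<Sum>i\<in>I. along (\<kappa> i) x) \<partial>\<mu>)"
  proof (rule Bochner_Integration.integral_cong[OF refl])
    fix x assume "x \<in> space \<mu>"
    then have x: "x \<in> S - P" by (simp add: space_area)
    have "along (\<lambda>x. \<Sum>i\<in>I. \<kappa> i x) x = (\<Sum>i\<in>I. along (\<kappa> i) x)"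
      by (rule position_deriv_sum[OF \<kappa> x])
    then show "along \<eta> x = - (\<Sum>i\<in>I. along (\<kappa> i) x)"
      unfolding \<eta>_def[abs_def] position_deriv_diff[OF C1_surface_const c1sum x]
        position_deriv_const[OF x] by simp
  qed
  also have "\<dots> = - (\<Sum>i\<in>I. integral\<^sup>L lborel (h1 i))"
    using T1 by (simp add: Bochner_Integration.integral_sum)
  finally have int\<eta>: "integral\<^sup>L \<mu> \<eta> = (\<Sum>i\<in>I. integral\<^sup>L lborel (h1 i)) / 2"
    using div(3) by simp
  define D where "D i = {x \<in> U i. \<phi> i x \<in> ball 0 \<epsilon>}" for i
  define g where "g i x = (1 - \<kappa> i x) * indicator (D i - P) x" for i x
  have T2: "integrable \<mu> (g i)" "integral\<^sup>L \<mu> (g i) = integral\<^sup>L lborel (h2 i)" if i: "i \<in> I" for i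
  proof -
    have "\<kappa> i \<in> borel_measurable \<mu>"
      by (rule borel_measurable_continuous_surface[OF C1_surface_continuous[OF \<kappa>[OF i]]])
    moreover have "indicator (D i - P) \<in> borel_measurable \<mu>"
      using openin_area_measurable[OF chart_disc_open[OF c[OF i]]] by (simp add: D_def)
    ultimately have m: "g i \<in> borel_measurable \<mu>" unfolding g_def by measurable
    have o: "g i x = 0" if "x \<in> S - P - U i" for x using that by (simp add: g_def D_def)
    have e: "indicator (\<phi> i ` (U i - P)) w * (area_density (local_rep X (U i, \<phi> i)) w *
        g i (inv_into (U i) (\<phi> i) w)) = h2 i w" for w
    proof (cases "w \<in> \<phi> i ` (U i - P)")
      case True
      then obtain x where x: "x \<in> U i - P" "w = \<phi> i x" by blast
      then show ?thesis
        using chart(8)[OF c[OF i]]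
        by (simp add: h2_def collar_integrand_def zp g_def \<kappa>_def extend_chart_def D_def indicator_def)
    qed (simp add: h2_def collar_integrand_def zp)
    show "integrable \<mu> (g i)" "integral\<^sup>L \<mu> (g i) = integral\<^sup>L lborel (h2 i)"
      using area_chart_integral[OF c[OF i] m o, unfolded e] int2[OF i] by simp_all
  qed
  let ?A = "S - (\<Union>i\<in>I. coordinate_disc (z i) \<epsilon>)"
  have "(LINT x:?A|\<mu>. 1) = (\<integral>x. \<eta> x - (\<Sum>i\<in>I. g i x) \<partial>\<mu>)"
    unfolding set_lebesgue_integral_def
  proof (rule Bochner_Integration.integral_cong[OF refl])
    fix x assume "x \<in> space \<mu>"
    then have x: "x \<in> S - P" by (simp add: space_area)
    have cd: "coordinate_disc (z i) \<epsilon> = D i" for i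
      by (simp add: coordinate_disc_def D_def U_def \<phi>_def)
    show "indicator ?A x *\<^sub>R (1::real) = \<eta> x - (\<Sum>i\<in>I. g i x)"
    proof (cases "\<exists>i\<in>I. x \<in> D i")
      case True
      then obtain i where i: "i \<in> I" "x \<in> D i" by blast
      have xi: "x \<in> U i" "norm (\<phi> i x) < \<epsilon>" using i(2) by (auto simp: D_def)
      have "g j x = 0" if "j \<in> I" "j \<noteq> i" for j
      proof -
        have "x \<notin> D j"
          using disj[of i j x] that i xi by (auto simp: D_def U_def \<phi>_def)
        then show ?thesis by (simp add: g_def)
      qed
      then have "(\<Sum>j\<in>I. g j x) = (\<Sum>j\<in>{i}. g j x)"
        using I i(1) by (intro sum.mono_neutral_right) auto
      also have "\<dots> = 1 - \<kappa> i x" using i x by (simp add: g_def)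
      finally have "(\<Sum>j\<in>I. g j x) = 1 - \<kappa> i x" .
      then have "\<eta> x - (\<Sum>j\<in>I. g j x) = 0" using sum_disc[OF i(1) xi] by (simp add: \<eta>_def)
      moreover have "x \<notin> ?A" using i by (auto simp: cd)
      ultimately show ?thesis by simp
    next
      case False
      then have "\<kappa> i x = 0" "g i x = 0" if "i \<in> I" for i
        using that \<kappa>_out[of x i] by (auto simp: D_def g_def)
      then have "\<eta> x - (\<Sum>i\<in>I. g i x) = 1" by (simp add: \<eta>_def)
      moreover have "x \<in> ?A" using False x by (auto simp: cd)
      ultimately show ?thesis by simp
    qed
  qed
  also have "\<dots> = integral\<^sup>L \<mu> \<eta> - (\<Sum>i\<in>I. integral\<^sup>L \<mu> (g i))"
    using div(1) T2(1) by (simp add: Bochner_Integration.integral_diff Bochner_Integration.integral_sum)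
  also have "\<dots> = (\<Sum>i\<in>I. integral\<^sup>L lborel (h1 i)) / 2 - (\<Sum>i\<in>I. integral\<^sup>L lborel (h2 i))"
    using int\<eta> T2(2) by simp
  finally show ?thesis by (simp add: sum_subtractf sum_divide_distrib)
qed

end

theorem proposition1p3:
  fixes S :: "'a::t2_space set" and \<A> :: "'a chart set"
    and m :: nat and p :: "nat \<Rightarrow> 'a"
    and X :: "'a \<Rightarrow> real^3" and \<mu> :: "'a measure"
    and z :: "nat \<Rightarrow> 'a chart" and a :: "nat \<Rightarrow> complex^3"
    and Y :: "nat \<Rightarrow> complex \<Rightarrow> complex^3"
  assumes "closed_surface S \<A>"
    and "inj_on p {1..m}" and "p ` {1..m} \<subseteq> S"
    and "minimal_immersion \<A> (p ` {1..m}) X"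
    and "complete_immersion S (p ` {1..m}) X"
    and "is_area_measure S \<A> (p ` {1..m}) X \<mu>"
    and "finite_total_curvature \<A> X \<mu>"
    and "\<forall>i\<in>{1..m}. embedded_planar_end S (p ` {1..m}) X (p i)"
    and "\<forall>i\<in>{1..m}. normalized_end_coordinate \<A> (p ` {1..m}) X (p i) (z i) (a i) (Y i)"
  shows "((\<lambda>\<epsilon>. (LINT x:(S - (\<Union>i\<in>{1..m}. coordinate_disc (z i) \<epsilon>))|\<mu>. 1)
              - pi * real m / \<epsilon>\<^sup>2) \<longlongrightarrow> (0::real)) (at_right 0)"
proof -
  let ?I = "{1..m}"
  let ?P = "p ` ?I"
  interpret minimal_surface S \<A> ?P X \<mu>
    by unfold_locales (use assms in auto)
  define U where "U i = fst (z i)" for i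
  define \<phi> where "\<phi> i = snd (z i)" for i
  have zp: "z i = (U i, \<phi> i)" for i by (simp add: U_def \<phi>_def)
  have coord: "normalized_end_coordinate \<A> ?P X (p i) (U i, \<phi> i) (a i) (Y i)" if "i \<in> ?I" for i
    using assms(9) that by (simp add: zp)
  have c: "(U i, \<phi> i) \<in> \<A>" and q: "p i \<in> U i" "\<phi> i (p i) = 0" if "i \<in> ?I" for i
    using coord[OF that] by (simp_all add: normalized_end_coordinate_def)
  have disc: "\<forall>\<^sub>F \<epsilon> in at_right 0. cball 0 \<epsilon> \<subseteq> \<phi> i ` (U i \<inter> T)"
    if "i \<in> ?I" "open T" "p i \<in> T" for i T
    by (rule chart_disc_eventually[OF c[OF that(1)] q[OF that(1)] that(2,3)])
  define h1 where "h1 \<epsilon> i = flux_integrand (\<phi> i ` (U i - ?P)) (local_rep X (U i, \<phi> i)) \<epsilon>" for \<epsilon> i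
  define h2 where "h2 \<epsilon> i = collar_integrand (\<phi> i ` (U i - ?P)) (local_rep X (U i, \<phi> i)) \<epsilon>" for \<epsilon> i
  have ends: "\<exists>C. \<forall>\<^sub>F \<epsilon> in at_right 0. integrable lborel (h1 \<epsilon> i) \<and> integrable lborel (h2 \<epsilon> i) \<and>
      \<bar>integral\<^sup>L lborel (h1 \<epsilon> i) / 2 - integral\<^sup>L lborel (h2 \<epsilon> i) - pi / \<epsilon>\<^sup>2\<bar> \<le> C * \<epsilon>"
    if "i \<in> ?I" for i
    using end_integral_estimate[OF coord[OF that]]
    unfolding h1_def h2_def .
  obtain C where C: "\<forall>i\<in>?I. \<forall>\<^sub>F \<epsilon> in at_right 0. integrable lborel (h1 \<epsilon> i) \<and>
      integrable lborel (h2 \<epsilon> i) \<and>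
      \<bar>integral\<^sup>L lborel (h1 \<epsilon> i) / 2 - integral\<^sup>L lborel (h2 \<epsilon> i) - pi / \<epsilon>\<^sup>2\<bar> \<le> C i * \<epsilon>"
    using bchoice[OF ballI[OF ends]] by (rule exE)
  have ev1: "\<forall>\<^sub>F \<epsilon> in at_right 0. \<forall>i\<in>?I. integrable lborel (h1 \<epsilon> i) \<and> integrable lborel (h2 \<epsilon> i) \<and>
      \<bar>integral\<^sup>L lborel (h1 \<epsilon> i) / 2 - integral\<^sup>L lborel (h2 \<epsilon> i) - pi / \<epsilon>\<^sup>2\<bar> \<le> C i * \<epsilon>"
    using C by (intro eventually_ball_finite) auto
  have ev2: "\<forall>\<^sub>F \<epsilon> in at_right 0. \<forall>i\<in>?I. cball 0 \<epsilon> \<subseteq> \<phi> i ` U i"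
    using disc[of _ UNIV] by (intro eventually_ball_finite) auto
  have pair: "\<forall>\<^sub>F \<epsilon> in at_right 0. i \<noteq> j \<longrightarrow> \<not> (\<exists>x. x \<in> U i \<and> \<phi> i x \<in> cball 0 \<epsilon> \<and> x \<in> U j \<and> \<phi> j x \<in> cball 0 \<epsilon>)"
    if ij: "i \<in> ?I" "j \<in> ?I" for i j
  proof (cases "i = j")
    case False
    then have "p i \<noteq> p j" using inj_on_eq_iff[OF assms(2) ij] by simp
    from hausdorff[OF this] obtain T T'
      where T: "open T" "open T'" "p i \<in> T" "p j \<in> T'" "T \<inter> T' = {}" by blast
    have in_T: "x \<in> T" if "cball 0 \<epsilon> \<subseteq> \<phi> k ` (U k \<inter> T)" "x \<in> U k" "\<phi> k x \<in> cball 0 \<epsilon>" "k \<in> ?I" for x \<epsilon> k T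
    proof -
      have "\<phi> k x \<in> \<phi> k ` (U k \<inter> T)" using that by blast
      then show ?thesis using chart(7)[OF c[OF that(4)]] that(2) by (auto simp: inj_on_def)
    qed
    show ?thesis
      using disc[OF ij(1) T(1,3)] disc[OF ij(2) T(2,4)]
    proof eventually_elim
      case (elim \<epsilon>)
      show ?case
      proof (intro impI notI, elim exE conjE)
        fix x assume x: "x \<in> U i" "\<phi> i x \<in> cball 0 \<epsilon>" "x \<in> U j" "\<phi> j x \<in> cball 0 \<epsilon>"
        have "x \<in> T" by (rule in_T[OF elim(1) x(1,2) ij(1)])
        moreover have "x \<in> T'" by (rule in_T[OF elim(2) x(3,4) ij(2)])
        ultimately show False using T(5) by blast
      qed
    qed
  qed simp
  have ev3: "\<forall>\<^sub>F \<epsilon> in at_right 0. \<forall>i\<in>?I. \<forall>j\<in>?I. i \<noteq> j \<longrightarrow>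
      \<not> (\<exists>x. x \<in> U i \<and> \<phi> i x \<in> cball 0 \<epsilon> \<and> x \<in> U j \<and> \<phi> j x \<in> cball 0 \<epsilon>)"
    using pair by (intro eventually_ball_finite ballI) auto
  have bound: "\<forall>\<^sub>F \<epsilon> in at_right 0. norm ((LINT x:(S - (\<Union>i\<in>?I. coordinate_disc (z i) \<epsilon>))|\<mu>. 1)
      - pi * real m / \<epsilon>\<^sup>2) \<le> (\<Sum>i\<in>?I. C i) * \<epsilon>"
    using ev1 ev2 ev3 eventually_at_right_less[of 0]
  proof eventually_elim
    case (elim \<epsilon>)
    have "(LINT x:(S - (\<Union>i\<in>?I. coordinate_disc (z i) \<epsilon>))|\<mu>. 1)
      = (\<Sum>i\<in>?I. integral\<^sup>L lborel (h1 \<epsilon> i) / 2 - integral\<^sup>L lborel (h2 \<epsilon> i))"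
      unfolding h1_def h2_def U_def \<phi>_def prod.collapse
    proof (rule area_outside_discs)
      show "z i \<in> \<A>" if "i \<in> ?I" for i using c[OF that] by (simp add: zp)
      show "\<exists>i\<in>?I. x \<in> fst (z i) \<and> snd (z i) x = 0" if "x \<in> ?P" for x
      proof -
        obtain i where i: "i \<in> ?I" "x = p i" using \<open>x \<in> ?P\<close> by blast
        then show ?thesis using q[OF i(1)] by (intro bexI[OF _ i(1)]) (simp add: U_def \<phi>_def)
      qed
      show "cball 0 \<epsilon> \<subseteq> snd (z i) ` fst (z i)" if "i \<in> ?I" for i
        using elim(2) that by (simp add: U_def \<phi>_def)
      show "i = j" if "i \<in> ?I" "j \<in> ?I" "x \<in> fst (z i)" "snd (z i) x \<in> cball 0 \<epsilon>"
        "x \<in> fst (z j)" "snd (z j) x \<in> cball 0 \<epsilon>" for i j x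
        using elim(3) that unfolding U_def \<phi>_def by blast
    qed (use elim in \<open>simp_all add: h1_def h2_def U_def \<phi>_def\<close>)
    then have "(LINT x:(S - (\<Union>i\<in>?I. coordinate_disc (z i) \<epsilon>))|\<mu>. 1) - pi * real m / \<epsilon>\<^sup>2
      = (\<Sum>i\<in>?I. integral\<^sup>L lborel (h1 \<epsilon> i) / 2 - integral\<^sup>L lborel (h2 \<epsilon> i) - pi / \<epsilon>\<^sup>2)"
      by (simp add: sum_subtractf mult.commute)
    also have "norm \<dots> \<le> (\<Sum>i\<in>?I. C i * \<epsilon>)"
      unfolding real_norm_def using elim(1) by (intro sum_abs[THEN order_trans] sum_mono) blast
    finally show ?case by (simp add: sum_distrib_right)
  qed
  have "((\<lambda>\<epsilon>. (\<Sum>i\<in>?I. C i) * \<epsilon>) \<longlongrightarrow> (\<Sum>i\<in>?I. C i) * 0) (at_right 0)"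
    by (intro tendsto_intros)
  then show ?thesis
    using Lim_null_comparison[OF bound] by simp
qed

end
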